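(* Let $\rho>1$ and let $Q(x)=(q_{jk}(x))_{1\le j,k\le 4}$ be a function on $\mathbb{R}^3$ whose values are $4\times4$ Hermitian matrices, each $q_{jk}$ being measurable with $|q_{jk}(x)|\le C_0\langle x\rangle^{-\rho}$ for all $x\in\mathbb{R}^3$ and some constant $C_0>0$. Let $H=\alpha\cdot D+Q(x)$, and let $f$ be a zero mode of $H$, i.e. $f\in\mathrm{Dom}(H)=[H^1(\mathbb{R}^3)]^4$ and $Hf=0$. Then: (i) there is a constant $C=C_f$, depending only on the zero mode $f$, such that $|f(x)|\le C\langle x\rangle^{-2}$ for all $x\in\mathbb{R}^3$; (ii) $f$ is a continuous function on $\mathbb{R}^3$.
   Context: Notation: $\langle x\rangle=\sqrt{1+|x|^2}$, $D=\frac1i\nabla_x=(D_1,D_2,D_3)$, $\alpha\cdot D=\sum_{j=1}^3\alpha_jD_j$, where $\alpha_j=\begin{pmatrix}\mathbf 0&\sigma_j\\ \sigma_j&\mathbf 0\end{pmatrix}$ ($j=1,2,3$) are the $4\times4$ Dirac matrices built from the Pauli matrices $\sigma_1=\begin{pmatrix}0&1\\1&0\end{pmatrix}$, $\sigma_2=\begin{pmatrix}0&-i\\ i&0\end{pmatrix}$, $\sigma_3=\begin{pmatrix}1&0\\0&-1\end{pmatrix}$ and the $2\times 2$ zero matrix $\mathbf 0$. $H^1(\mathbb{R}^3)$ is the usual $L^2$-Sobolev space of order 1. Under the stated hypotheses $H$ is a self-adjoint operator in $[L^2(\mathbb{R}^3)]^4$ with domain $\mathrm{Dom}(H)=[H^1(\mathbb{R}^3)]^4$.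 $|f(x)|$ is the Euclidean norm of $f(x)\in\mathbb{C}^4$. As usual, functions equal almost everywhere are identified; the pointwise statements refer to the (unique) continuous representative of $f$. *)

theory Defs
  imports "HOL-Analysis.Analysis"
begin

definition japanese_bracket :: "real^'n \<Rightarrow> real" where
  "japanese_bracket x = sqrt (1 + (norm x)\<^sup>2)"

definition partial_derivative :: "'n \<Rightarrow> (real^'n \<Rightarrow> real) \<Rightarrow> real^'n \<Rightarrow> real" where
  "partial_derivative j \<phi> x = frechet_derivative \<phi> (at x) (axis j 1)"

text \<open>Differentiability everywhere together with continuity of the partial derivatives is
  continuous differentiability, so \<open>C_k k\<close> is the class of \<open>k\<close> times continuously
  differentiable functions.\<close>
primrec C_k :: "nat \<Rightarrow> (real^'n \<Rightarrow> real) \<Rightarrow> bool" where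
  "C_k 0 \<phi> \<longleftrightarrow> continuous_on UNIV \<phi>"
| "C_k (Suc k) \<phi> \<longleftrightarrow>
     (\<forall>x. \<phi> differentiable (at x)) \<and> (\<forall>j. C_k k (partial_derivative j \<phi>))"

definition test_function :: "(real^'n \<Rightarrow> real) \<Rightarrow> bool" where
  "test_function \<phi> \<longleftrightarrow> (\<forall>k. C_k k \<phi>) \<and> compact (closure {x. \<phi> x \<noteq> 0})"

definition locally_integrable :: "(real^'n \<Rightarrow> complex) \<Rightarrow> bool" where
  "locally_integrable u \<longleftrightarrow> (\<forall>K. compact K \<longrightarrow> set_integrable lebesgue K u)"

text \<open>Real-valued test functions suffice: the identity is linear in the test function.\<close>
definition has_weak_partial ::
    "'n \<Rightarrow> (real^'n \<Rightarrow> complex) \<Rightarrow> (real^'n \<Rightarrow> complex) \<Rightarrow> bool" where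
  "has_weak_partial j u v \<longleftrightarrow>
     locally_integrable u \<and> locally_integrable v \<and>
     (\<forall>\<phi>. test_function \<phi> \<longrightarrow>
        (\<integral>x. of_real (partial_derivative j \<phi> x) * u x \<partial>lebesgue) =
        - (\<integral>x. of_real (\<phi> x) * v x \<partial>lebesgue))"

text \<open>Weak derivatives are unique only up to null sets; this picks one representative.
  It is unspecified if no weak derivative exists.\<close>
definition weak_partial :: "'n \<Rightarrow> (real^'n \<Rightarrow> complex) \<Rightarrow> real^'n \<Rightarrow> complex" where
  "weak_partial j u = (SOME v. has_weak_partial j u v)"

text \<open>\<open>L2\<close> and \<open>H1\<close> consist of functions, not of classes modulo null sets.\<close>
definition L2 :: "(real^'n \<Rightarrow> complex) set" where
  "L2 = {u. u \<in> borel_measurable lebesgue \<and> integrable lebesgue (\<lambda>x. (cmod (u x))\<^sup>2)}"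

definition H1 :: "(real^'n \<Rightarrow> complex) set" where
  "H1 = {u \<in> L2. \<forall>j. \<exists>v \<in> L2. has_weak_partial j u v}"

definition pauli :: "3 \<Rightarrow> complex^2^2" where
  "pauli j =
     (if j = 1 then vector [vector [0, 1], vector [1, 0]]
      else if j = 2 then vector [vector [0, - \<i>], vector [\<i>, 0]]
      else vector [vector [1, 0], vector [0, - 1]])"

definition dirac_alpha :: "3 \<Rightarrow> complex^4^4" where
  "dirac_alpha j =
     (let \<sigma> = pauli j in
      vector [vector [0, 0, \<sigma>$1$1, \<sigma>$1$2],
              vector [0, 0, \<sigma>$2$1, \<sigma>$2$2],
              vector [\<sigma>$1$1, \<sigma>$1$2, 0, 0],
              vector [\<sigma>$2$1, \<sigma>$2$2, 0, 0]])"

definition hermitian :: "complex^'n^'n \<Rightarrow> bool" where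
  "hermitian A \<longleftrightarrow> (\<forall>j k. A $ j $ k = cnj (A $ k $ j))"

definition momentum :: "3 \<Rightarrow> (real^3 \<Rightarrow> complex^4) \<Rightarrow> real^3 \<Rightarrow> complex^4" where
  "momentum j f x = (\<chi> k. (1 / \<i>) * weak_partial j (\<lambda>y. f y $ k) x)"

definition dirac_domain :: "(real^3 \<Rightarrow> complex^4) set" where
  "dirac_domain = {f. \<forall>k. (\<lambda>x. f x $ k) \<in> H1}"

definition dirac_operator ::
    "(real^3 \<Rightarrow> complex^4^4) \<Rightarrow> (real^3 \<Rightarrow> complex^4) \<Rightarrow> real^3 \<Rightarrow> complex^4" where
  "dirac_operator Q f x = (\<Sum>j\<in>UNIV. dirac_alpha j *v momentum j f x) + Q x *v f x"

definition zero_mode :: "(real^3 \<Rightarrow> complex^4^4) \<Rightarrow> (real^3 \<Rightarrow> complex^4) \<Rightarrow> bool" where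
  "zero_mode Q f \<longleftrightarrow> f \<in> dirac_domain \<and> (AE x in lebesgue. dirac_operator Q f x = 0)"

end

theory Submission
  imports Defs "HOL-Computational_Algebra.Polynomial"
begin

text \<open>A zero mode satisfies \<open>\<alpha>\<cdot>D f = - Q f\<close>. Testing this against \<open>z\<^sub>m (|z|\<^sup>2 + \<epsilon>\<^sup>2)\<^sup>-\<^sup>3\<^sup>/\<^sup>2\<close>, \<open>z = y - x\<close>, and
  summing over \<open>m\<close> with the matrices \<open>\<alpha>\<^sub>m\<close>, the Clifford relations leave \<open>\<delta>\<^sub>\<epsilon> * f\<close> with the
  unnormalized approximate identity \<open>\<delta>\<^sub>\<epsilon> = 3 \<epsilon>\<^sup>2 (|z|\<^sup>2 + \<epsilon>\<^sup>2)\<^sup>-\<^sup>5\<^sup>/\<^sup>2\<close>; letting \<open>\<epsilon> \<rightarrow> 0\<close> represents \<open>f\<close> as a singular integral of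
  \<open>Q f\<close>. Hence \<open>|f|\<close> is dominated by the potential \<open>\<integral> |x - y|\<^sup>-\<^sup>2 \<langle>y\<rangle>\<^sup>-\<^sup>\<rho> |f(y)| dy\<close>. Iterating this bound
  once turns the kernel into \<open>|x - y|\<^sup>-\<^sup>1\<close>, which pairs with \<open>L\<^sup>2\<close> and makes \<open>f\<close> bounded; each further
  application improves the decay until it saturates at \<open>\<langle>x\<rangle>\<^sup>-\<^sup>2\<close>. With that decay the singular
  integral is a uniform limit of continuous functions, and so provides the continuous representative.\<close>

section \<open>Potentials with kernel \<open>|x - y|\<^sup>-\<^sup>2\<close>\<close>

text \<open>The limiting kernels \<open>z\<^sub>m |z|\<^sup>-\<^sup>3\<close> are singular and not
  compactly supported, so they are not test functions. The parameter \<epsilon> removes the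
  singularity. Cutoffs remove the support condition: the regularized kernel and its gradient are
  bounded by multiples of 1 / (|z|^2 + \<epsilon>^2), which is square integrable on R^3 and so pairs
  with \<open>f\<close> and \<open>Q f\<close>. The limit \<epsilon> -> 0 is taken after integrating
  over boxes, where a translation of \<open>f\<close> can be moved onto the indicator of the box.
  The iteration before the \<open>L\<^sup>2\<close> pairing is forced by dimension three: |z|^-2 is
  not square integrable near its pole, while |z|^-1 is. Until \<open>f\<close> is known to be
  bounded the potentials might be infinite, so these inequalities live in \<open>ennreal\<close>.
  The decay saturates because the potential of an integrable, rapidly decaying source behaves like
  its mass times |x|^-2. The problem is posed for \<open>lebesgue\<close>, while translations,
  products and Fubini are used on \<open>lborel\<close>; Borel representatives connect the
  two.\<close>

lemma ex_dyadic:
  fixes t :: real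
  assumes "1 \<le> t"
  shows "\<exists>n. 2 ^ n \<le> t \<and> t < 2 ^ Suc n"
proof -
  obtain m where m: "t < 2 ^ m" using real_arch_pow[of 2 t] by auto
  define k where "k = (LEAST m. t < 2 ^ m)"
  have k: "t < 2 ^ k" unfolding k_def by (rule LeastI[of _ m]) (rule m)
  have "k \<noteq> 0" using k assms by (intro notI) simp
  then obtain n where n: "k = Suc n" by (cases k) auto
  have "\<not> t < 2 ^ n" using not_less_Least[of n "\<lambda>m. t < 2 ^ m"] n by (auto simp: k_def)
  with k n show ?thesis by (intro exI[of _ n]) auto
qed

text \<open>Countable additivity reduces the integral of a dominating step function to the series of
  its shell masses. Both shell estimates below use this with \<open>q\<close> a power of 2 that is
  below 1 exactly when the kernel exponent lies on the convergent side of the dimension.\<close>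

lemma nn_integral_le_geometric:
  fixes F :: "'a::euclidean_space \<Rightarrow> ennreal" and A :: "nat \<Rightarrow> 'a set"
  assumes A: "\<And>n. A n \<in> sets lborel"
    and le: "\<And>y. F y \<le> (\<Sum>n. ennreal (c n) * indicator (A n) y)"
    and m: "\<And>n. ennreal (c n) * emeasure lborel (A n) \<le> ennreal (d * q ^ n)"
    and "0 \<le> q" "q < 1" "0 \<le> d"
  shows "(\<integral>\<^sup>+y. F y \<partial>lborel) \<le> ennreal (d / (1 - q))"
proof -
  have "(\<integral>\<^sup>+y. F y \<partial>lborel) \<le> (\<integral>\<^sup>+y. (\<Sum>n. ennreal (c n) * indicator (A n) y) \<partial>lborel)"
    by (rule nn_integral_mono) (rule le)
  also have "\<dots> = (\<Sum>n. \<integral>\<^sup>+y. ennreal (c n) * indicator (A n) y \<partial>lborel)"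
    using A by (intro nn_integral_suminf) auto
  also have "\<dots> = (\<Sum>n. ennreal (c n) * emeasure lborel (A n))"
    using A by (intro suminf_cong) (auto simp: nn_integral_cmult_indicator)
  also have "\<dots> \<le> (\<Sum>n. ennreal (d * q ^ n))"
    by (intro suminf_le m) auto
  also have "\<dots> = ennreal (d / (1 - q))"
  proof (rule suminf_ennreal_eq)
    show "(\<lambda>n. d * q ^ n) sums (d / (1 - q))"
      using sums_mult[OF geometric_sums[of q], of d] assms by (simp add: divide_inverse)
  qed (use assms in auto)
  finally show ?thesis .
qed

lemma suminf_ge_term:
  fixes f :: "nat \<Rightarrow> ennreal"
  shows "f n \<le> (\<Sum>n. f n)"
  using sum_le_suminf[of f "{n}"] by simp

text \<open>Since \<open>0 powr a = 0\<close>, the kernels \<open>norm (x - y) powr - b\<close> vanish at their pole; a dyadic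
  decomposition into shells covers the rest.\<close>
lemma nn_integral_ball_norm_powr:
  fixes b :: real
  assumes b: "0 \<le> b" "b < DIM('a::euclidean_space)"
  shows "\<exists>C>0. \<forall>(x::'a) r. 0 < r \<longrightarrow>
    (\<integral>\<^sup>+y. ennreal (norm (x - y) powr - b) * indicator {y. norm (x - y) < r} y \<partial>lborel)
      \<le> ennreal (C * r powr (DIM('a) - b))"
proof -
  \<comment> \<open>From one shell to the next the radius halves: the volume drops by the factor
    \<open>2 ^ DIM('a)\<close> while the kernel bound grows by \<open>2 powr b\<close>.\<close>
  define q where "q = 2 powr (b - DIM('a))"
  have q: "0 \<le> q" "q < 1" unfolding q_def using b powr_less_mono[of "b - DIM('a)" 0 2] by auto
  define v where "v = unit_ball_vol (real DIM('a))"
  have v: "v > 0" by (simp add: v_def)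
  define C where "C = v * 2 powr b / (1 - q)"
  have "(\<integral>\<^sup>+y. ennreal (norm (x - y) powr - b) * indicator {y. norm (x - y) < r} y \<partial>lborel)
      \<le> ennreal (C * r powr (DIM('a) - b))" if r: "0 < r" for x :: 'a and r
  proof -
    have "(\<integral>\<^sup>+y. ennreal (norm (x - y) powr - b) * indicator {y. norm (x - y) < r} y \<partial>lborel)
      \<le> ennreal (v * 2 powr b * r powr (DIM('a) - b) / (1 - q))"
    proof (rule nn_integral_le_geometric)
      show "ball x (r / 2 ^ n) \<in> sets lborel" for n by simp
      show "ennreal (norm (x - y) powr - b) * indicator {y. norm (x - y) < r} y
        \<le> (\<Sum>n. ennreal ((r / 2 ^ Suc n) powr - b) * indicator (ball x (r / 2 ^ n)) y)" for y
      proof (cases "norm (x - y) < r \<and> x \<noteq> y")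
        case True
        then have d: "0 < norm (x - y)" by simp
        obtain n where n: "2 ^ n \<le> r / norm (x - y)" "r / norm (x - y) < 2 ^ Suc n"
          using ex_dyadic[of "r / norm (x - y)"] True d by auto
        have 1: "norm (x - y) \<le> r / 2 ^ n" using n(1) d by (simp add: field_simps)
        have 2: "r / 2 ^ Suc n < norm (x - y)" using n(2) d by (simp add: field_simps)
        \<comment> \<open>The shells enter through open balls, but the dyadic index only gives
          \<open>norm (x - y) \<le> r / 2 ^ n\<close>. On the sphere of equality the previous index
          works; it exists because \<open>norm (x - y) < r\<close> excludes
          \<open>n = 0\<close>.\<close>
        obtain k where k: "norm (x - y) < r / 2 ^ k" "r / 2 ^ Suc k \<le> norm (x - y)"
        proof (cases "norm (x - y) = r / 2 ^ n")
          case False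
          then show ?thesis using 1 2 that[of n] by auto
        next
          case eq: True
          then have "n \<noteq> 0" using True by (intro notI) auto
          then obtain k where "n = Suc k" by (cases n) auto
          then show ?thesis using eq r that[of k] by (auto simp: field_simps)
        qed
        have "norm (x - y) powr - b \<le> (r / 2 ^ Suc k) powr - b"
          using k b r by (intro powr_mono2') auto
        then have "ennreal (norm (x - y) powr - b) * indicator {y. norm (x - y) < r} y
          \<le> ennreal ((r / 2 ^ Suc k) powr - b) * indicator (ball x (r / 2 ^ k)) y"
          using True k by (auto simp: dist_norm intro!: ennreal_leI)
        also have "\<dots> \<le> (\<Sum>n. ennreal ((r / 2 ^ Suc n) powr - b) * indicator (ball x (r / 2 ^ n)) y)"
          by (rule suminf_ge_term)
        finally show ?thesis .
      qed (auto simp: dist_norm)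
      show "ennreal ((r / 2 ^ Suc n) powr - b) * emeasure lborel (ball x (r / 2 ^ n))
        \<le> ennreal (v * 2 powr b * r powr (DIM('a) - b) * q ^ n)" for n
      proof -
        have "(r / 2 ^ Suc n) powr - b * (v * (r / 2 ^ n) ^ DIM('a))
          = v * 2 powr b * r powr (DIM('a) - b) * q ^ n"
          using r by (simp add: q_def powr_divide powr_minus powr_diff powr_mult powr_realpow[symmetric]
              powr_powr mult_ac power_divide divide_simps powr_add)
        moreover have "ennreal ((r / 2 ^ Suc n) powr - b) * emeasure lborel (ball x (r / 2 ^ n))
            = ennreal ((r / 2 ^ Suc n) powr - b * (v * (r / 2 ^ n) ^ DIM('a)))"
          using r v by (simp add: emeasure_ball v_def ennreal_mult[symmetric])
        ultimately show ?thesis by (simp only: order_refl)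
      qed
      show "0 \<le> v * 2 powr b * r powr (DIM('a) - b)" using v by simp
    qed (use q in auto)
    also have "v * 2 powr b * r powr (DIM('a) - b) / (1 - q) = C * r powr (DIM('a) - b)"
      by (simp add: C_def)
    finally show ?thesis .
  qed
  moreover have "C > 0" using v q by (simp add: C_def)
  ultimately show ?thesis by blast
qed

text \<open>Radii double from shell to shell, so the kernel bound shrinks by
  \<open>2 powr - b\<close> while the volume grows by \<open>2 ^ DIM('a)\<close>; the ratio is below
  1 because the exponent exceeds the dimension. This is the tail counterpart of the estimate inside
  a ball.\<close>

lemma nn_integral_outside_ball_norm_powr:
  fixes b :: real
  assumes b: "DIM('a::euclidean_space) < b"
  shows "\<exists>C>0. \<forall>(x::'a) r. 0 < r \<longrightarrow>
    (\<integral>\<^sup>+y. ennreal (norm (x - y) powr - b) * indicator {y. r \<le> norm (x - y)} y \<partial>lborel)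
      \<le> ennreal (C * r powr (DIM('a) - b))"
proof -
  define q where "q = 2 powr (DIM('a) - b)"
  have q: "0 \<le> q" "q < 1" unfolding q_def using b powr_less_mono[of "DIM('a) - b" 0 2] by auto
  define v where "v = unit_ball_vol (real DIM('a))"
  have v: "v > 0" by (simp add: v_def)
  define C where "C = v * 2 ^ DIM('a) / (1 - q)"
  have "(\<integral>\<^sup>+y. ennreal (norm (x - y) powr - b) * indicator {y. r \<le> norm (x - y)} y \<partial>lborel)
      \<le> ennreal (C * r powr (DIM('a) - b))" if r: "0 < r" for x :: 'a and r
  proof -
    have "(\<integral>\<^sup>+y. ennreal (norm (x - y) powr - b) * indicator {y. r \<le> norm (x - y)} y \<partial>lborel)
      \<le> ennreal (v * 2 ^ DIM('a) * r powr (DIM('a) - b) / (1 - q))"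
    proof (rule nn_integral_le_geometric)
      show "ball x (r * 2 ^ Suc n) \<in> sets lborel" for n by simp
      show "ennreal (norm (x - y) powr - b) * indicator {y. r \<le> norm (x - y)} y
        \<le> (\<Sum>n. ennreal ((r * 2 ^ n) powr - b) * indicator (ball x (r * 2 ^ Suc n)) y)" for y
      proof (cases "r \<le> norm (x - y)")
        case True
        obtain k where k: "2 ^ k \<le> norm (x - y) / r" "norm (x - y) / r < 2 ^ Suc k"
          using ex_dyadic[of "norm (x - y) / r"] True r by auto
        have "norm (x - y) powr - b \<le> (r * 2 ^ k) powr - b"
          using k b r by (intro powr_mono2') (auto simp: field_simps)
        then have "ennreal (norm (x - y) powr - b) * indicator {y. r \<le> norm (x - y)} y
          \<le> ennreal ((r * 2 ^ k) powr - b) * indicator (ball x (r * 2 ^ Suc k)) y"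
          using True k r by (auto simp: dist_norm field_simps indicator_def intro!: ennreal_leI)
        also have "\<dots> \<le> (\<Sum>n. ennreal ((r * 2 ^ n) powr - b) * indicator (ball x (r * 2 ^ Suc n)) y)"
          by (rule suminf_ge_term)
        finally show ?thesis .
      qed (auto simp: dist_norm)
      show "ennreal ((r * 2 ^ n) powr - b) * emeasure lborel (ball x (r * 2 ^ Suc n))
        \<le> ennreal (v * 2 ^ DIM('a) * r powr (DIM('a) - b) * q ^ n)" for n
      proof -
        have "(r * 2 ^ n) powr - b * (v * (r * 2 ^ Suc n) ^ DIM('a))
          = v * 2 ^ DIM('a) * r powr (DIM('a) - b) * q ^ n"
          using r by (simp add: q_def powr_divide powr_minus powr_diff powr_mult powr_realpow[symmetric]
              powr_powr mult_ac power_divide divide_simps powr_add)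
        moreover have "ennreal ((r * 2 ^ n) powr - b) * emeasure lborel (ball x (r * 2 ^ Suc n))
            = ennreal ((r * 2 ^ n) powr - b * (v * (r * 2 ^ Suc n) ^ DIM('a)))"
          using r v by (simp add: emeasure_ball v_def ennreal_mult[symmetric] del: power_Suc)
        ultimately show ?thesis by (simp only: order_refl)
      qed
      show "0 \<le> v * 2 ^ DIM('a) * r powr (DIM('a) - b)" using v by simp
    qed (use q in auto)
    also have "v * 2 ^ DIM('a) * r powr (DIM('a) - b) / (1 - q) = C * r powr (DIM('a) - b)"
      by (simp add: C_def)
    finally show ?thesis .
  qed
  moreover have "C > 0" using v q by (simp add: C_def)
  ultimately show ?thesis by blast
qed

section \<open>Elementary properties of the bracket weight\<close>

text \<open>Seen as the Euclidean length of the pair \<open>(1, x)\<close>, the bracket inherits the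
  triangle inequality and continuity from the norm.\<close>

lemma japanese_bracket_eq_norm: "japanese_bracket x = norm (1::real, x)"
  by (simp add: japanese_bracket_def norm_Pair)

lemma japanese_bracket_ge_1: "1 \<le> japanese_bracket x"
  by (simp add: japanese_bracket_def)

lemma japanese_bracket_pos [simp]: "0 < japanese_bracket x"
  using japanese_bracket_ge_1[of x] by linarith

lemma japanese_bracket_nonzero [simp]: "japanese_bracket x \<noteq> 0"
  using japanese_bracket_pos[of x] by linarith

lemma norm_le_japanese_bracket: "norm x \<le> japanese_bracket x"
  by (simp add: japanese_bracket_eq_norm norm_Pair real_le_rsqrt)

lemma japanese_bracket_triangle: "japanese_bracket x \<le> japanese_bracket y + norm (x - y)"
  using norm_triangle_ineq[of "(1::real, y)" "(0, x - y)"]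
  by (simp add: japanese_bracket_eq_norm norm_Pair)

lemma continuous_on_japanese_bracket [continuous_intros]: "continuous_on S japanese_bracket"
  unfolding japanese_bracket_eq_norm[abs_def] by (intro continuous_intros)

lemma borel_measurable_japanese_bracket [measurable]: "japanese_bracket \<in> borel_measurable borel"
  by (intro borel_measurable_continuous_onI continuous_intros)

section \<open>Potentials of power weights: slow and fast decay, and composition of kernels\<close>

text \<open>The nested form on the right is the one from which \<open>nn_integral_cmult\<close>
  extracts \<open>c\<close>, leaving an integral over \<open>S\<close> in the shape of the shell
  estimates.\<close>

lemma ennreal_le_mult_indicator:
  assumes "y \<in> S" "p \<le> c * s" "0 \<le> c" "0 \<le> s"
  shows "ennreal p \<le> ennreal c * (ennreal s * indicator S y)"
proof -
  have "ennreal p \<le> ennreal (c * s)" by (rule ennreal_leI[OF assms(2)])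
  also have "\<dots> = ennreal c * ennreal s" using assms(3,4) by (rule ennreal_mult)
  finally show ?thesis using assms(1) by simp
qed

lemma ennreal_le_add3:
  fixes a :: ennreal
  assumes "a \<le> x \<or> a \<le> y \<or> a \<le> z"
  shows "a \<le> x + y + z"
proof -
  have "x \<le> x + y + z" unfolding add.assoc by (rule add_increasing2) simp_all
  moreover have "y \<le> x + y + z" by (rule add_increasing2, simp, rule add_increasing) simp_all
  moreover have "z \<le> x + y + z" by (rule add_increasing) simp_all
  ultimately show ?thesis using assms by (metis order_trans)
qed

text \<open>With \<open>r = \<langle>x\<rangle>\<close> the regions are \<open>|x - y| < r / 2\<close>, where \<open>\<langle>y\<rangle> \<ge> r / 2\<close>, the far region
  \<open>|y| \<ge> 2 r\<close>, where \<open>|x - y| \<ge> |y| / 2\<close>, and the remainder, which is the integral on the right.\<close>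
lemma riesz_potential_split:
  assumes a: "1 < a"
  shows "\<exists>C>0. \<forall>x::real^3.
    (\<integral>\<^sup>+y. ennreal (norm (x - y) powr - 2 * japanese_bracket y powr - a) \<partial>lborel)
      \<le> ennreal (C * japanese_bracket x powr (1 - a)) + ennreal (4 * japanese_bracket x powr - 2) *
        (\<integral>\<^sup>+y. ennreal (japanese_bracket (y::real^3) powr - a) * indicator {y. norm y < 2 * japanese_bracket x} y \<partial>lborel)"
proof -
  obtain C1 where C1: "C1 > 0" "\<And>(x::real^3) r. 0 < r \<Longrightarrow>
    (\<integral>\<^sup>+y. ennreal (norm (x - y) powr - 2) * indicator {y. norm (x - y) < r} y \<partial>lborel) \<le> ennreal (C1 * r powr 1)"
    using nn_integral_ball_norm_powr[of 2, where 'a="real^3"] by auto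
  obtain C3 where C3: "C3 > 0" "\<And>(x::real^3) r. 0 < r \<Longrightarrow>
    (\<integral>\<^sup>+y. ennreal (norm (x - y) powr - (2 + a)) * indicator {y. r \<le> norm (x - y)} y \<partial>lborel) \<le> ennreal (C3 * r powr (1 - a))"
    using nn_integral_outside_ball_norm_powr[of "2 + a", where 'a="real^3"] a by auto
  \<comment> \<open>The first summand collects the region near \<open>x\<close>, the second the far
    region. Both scale as \<open>r powr (1 - a)\<close>, so only the middle region distinguishes the
    regimes of \<open>a\<close>.\<close>
  define C where "C = 2 powr a * (C1 / 2) + 4 * (C3 * 2 powr (1 - a))"
  have "(\<integral>\<^sup>+y. ennreal (norm (x - y) powr - 2 * japanese_bracket y powr - a) \<partial>lborel)
      \<le> ennreal (C * japanese_bracket x powr (1 - a)) + ennreal (4 * japanese_bracket x powr - 2) *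
        (\<integral>\<^sup>+y. ennreal (japanese_bracket (y::real^3) powr - a) * indicator {y. norm y < 2 * japanese_bracket x} y \<partial>lborel)"
    for x :: "real^3"
  proof -
    define r where "r = japanese_bracket x"
    have r: "r > 0" "norm x \<le> r" by (simp_all add: r_def norm_le_japanese_bracket)
    define F1 where "F1 y = ennreal ((r / 2) powr - a) * (ennreal (norm (x - y) powr - 2) * indicator {y. norm (x - y) < r / 2} y)" for y
    define F2 where "F2 y = ennreal (4 * r powr - 2) * (ennreal (japanese_bracket y powr - a) * indicator {y. norm y < 2 * r} y)" for y :: "real^3"
    \<comment> \<open>The far region is measured from the origin: halving the distance costs the
      factor 4, and kernel and weight merge into the single exponent \<open>2 + a > 3\<close>, to
      which the tail estimate centred at 0 applies.\<close>
    define F3 where "F3 y = ennreal 4 * (ennreal (norm y powr - (2 + a)) * indicator {y. 2 * r \<le> norm y} y)" for y :: "real^3"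
    have [measurable]: "F1 \<in> borel_measurable lborel" "F2 \<in> borel_measurable lborel" "F3 \<in> borel_measurable lborel"
      unfolding F1_def[abs_def] F2_def[abs_def] F3_def[abs_def] by simp_all
    have "ennreal (norm (x - y) powr - 2 * japanese_bracket y powr - a) \<le> F1 y + F2 y + F3 y" for y
    proof -
      consider "norm (x - y) < r / 2" | "r / 2 \<le> norm (x - y)" "norm y < 2 * r" | "2 * r \<le> norm y"
        by linarith
      then show ?thesis
      proof cases
        case 1
        then have "r / 2 \<le> japanese_bracket y"
          using japanese_bracket_triangle[of x y] by (simp add: r_def)
        then have jb: "japanese_bracket y powr - a \<le> (r / 2) powr - a"
          using a r by (intro powr_mono2') auto
        have "norm (x - y) powr - 2 * japanese_bracket y powr - a \<le> (r / 2) powr - a * norm (x - y) powr - 2"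
          by (subst mult.commute) (rule mult_right_mono[OF jb powr_ge_zero])
        from ennreal_le_mult_indicator[OF _ this powr_ge_zero powr_ge_zero, of y "{y. norm (x - y) < r / 2}"] 1
        have "ennreal (norm (x - y) powr - 2 * japanese_bracket y powr - a) \<le> F1 y"
          unfolding F1_def by blast
        then show ?thesis by (intro ennreal_le_add3 disjI1)
      next
        case 2
        have "norm (x - y) powr - 2 \<le> (r / 2) powr - 2"
          using r 2(1) by (intro powr_mono2') auto
        also have "(r / 2) powr - 2 = 4 * r powr - 2" using r by (simp add: powr_divide powr_minus_divide powr_numeral)
        finally have "norm (x - y) powr - 2 * japanese_bracket y powr - a \<le> 4 * r powr - 2 * japanese_bracket y powr - a"
          by (rule mult_right_mono) (rule powr_ge_zero)
        moreover have "0 \<le> 4 * r powr - 2" by simp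
        ultimately have "ennreal (norm (x - y) powr - 2 * japanese_bracket y powr - a) \<le> F2 y"
          unfolding F2_def using 2(2) by (intro ennreal_le_mult_indicator powr_ge_zero) blast+
        then show ?thesis by (intro ennreal_le_add3 disjI1 disjI2)
      next
        case 3
        then have y: "norm y > 0" using r by linarith
        have "norm y / 2 \<le> norm (x - y)"
          using 3 r norm_triangle_ineq2[of y x] by (simp add: norm_minus_commute)
        then have "norm (x - y) powr - 2 \<le> (norm y / 2) powr - 2"
          using y by (intro powr_mono2') auto
        also have "(norm y / 2) powr - 2 = 4 * norm y powr - 2" using y by (simp add: powr_divide powr_minus_divide powr_numeral)
        finally have 1: "norm (x - y) powr - 2 \<le> 4 * norm y powr - 2" .
        have "japanese_bracket y powr - a \<le> norm y powr - a"
          using y a norm_le_japanese_bracket by (intro powr_mono2') auto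
        with 1 have "norm (x - y) powr - 2 * japanese_bracket y powr - a \<le> 4 * norm y powr - 2 * norm y powr - a"
          by (rule mult_mono) (simp_all only: powr_ge_zero mult_nonneg_nonneg zero_le_numeral)
        also have "\<dots> = 4 * norm y powr - (2 + a)" using y by (simp add: powr_add[symmetric])
        finally have "norm (x - y) powr - 2 * japanese_bracket y powr - a \<le> 4 * norm y powr - (2 + a)" .
        then have "ennreal (norm (x - y) powr - 2 * japanese_bracket y powr - a) \<le> F3 y"
          unfolding F3_def using 3 by (intro ennreal_le_mult_indicator powr_ge_zero zero_le_numeral) blast+
        then show ?thesis by (intro ennreal_le_add3 disjI2)
      qed
    qed
    then have "(\<integral>\<^sup>+y. ennreal (norm (x - y) powr - 2 * japanese_bracket y powr - a) \<partial>lborel)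
      \<le> (\<integral>\<^sup>+y. F1 y + F2 y + F3 y \<partial>lborel)" by (intro nn_integral_mono)
    also have "\<dots> = (\<integral>\<^sup>+y. F1 y \<partial>lborel) + (\<integral>\<^sup>+y. F2 y \<partial>lborel) + (\<integral>\<^sup>+y. F3 y \<partial>lborel)"
      by (simp add: nn_integral_add)
    also have "\<dots> \<le> ennreal (2 powr a * (C1 / 2) * r powr (1 - a)) + ennreal (4 * r powr - 2) *
       (\<integral>\<^sup>+y. ennreal (japanese_bracket (y::real^3) powr - a) * indicator {y. norm y < 2 * r} y \<partial>lborel)
       + ennreal (4 * (C3 * 2 powr (1 - a)) * r powr (1 - a))"
    proof (intro add_mono)
      have "(\<integral>\<^sup>+y. F1 y \<partial>lborel) \<le> ennreal ((r / 2) powr - a) * ennreal (C1 * (r / 2) powr 1)"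
        unfolding F1_def using C1(2)[of "r / 2" x] r
        by (subst nn_integral_cmult) (auto intro!: mult_left_mono)
      also have "\<dots> = ennreal (2 powr a * (C1 / 2) * r powr (1 - a))"
      proof -
        have "(r / 2) powr - a * (r / 2) powr 1 = (r / 2) powr (1 - a)"
          by (metis powr_add uminus_add_conv_diff)
        also have "\<dots> = 2 powr a * r powr (1 - a) / 2"
        proof -
          have "2 powr (1 - a) = 2 / 2 powr a" by (simp only: powr_diff powr_one zero_le_numeral)
          moreover have "(r / 2) powr (1 - a) = r powr (1 - a) / 2 powr (1 - a)" using r by (intro powr_divide)
          ultimately show ?thesis by (simp only: divide_divide_eq_right mult_ac)
        qed
        finally have *: "(r / 2) powr - a * (r / 2) powr 1 = 2 powr a * r powr (1 - a) / 2" .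
        have eq: "(r / 2) powr - a * (C1 * (r / 2) powr 1) = 2 powr a * (C1 / 2) * r powr (1 - a)"
          unfolding mult.left_commute[of _ C1] * by (simp only: mult_ac times_divide_eq_right times_divide_eq_left)
        show ?thesis unfolding eq[symmetric] using C1 by (intro ennreal_mult[symmetric]) auto
      qed
      finally show "(\<integral>\<^sup>+y. F1 y \<partial>lborel) \<le> ennreal (2 powr a * (C1 / 2) * r powr (1 - a))" .
      have "(\<integral>\<^sup>+y. F3 y \<partial>lborel) \<le> ennreal 4 * ennreal (C3 * (2 * r) powr (1 - a))"
        unfolding F3_def using C3(2)[of "2 * r" 0] r
        by (subst nn_integral_cmult) (auto intro!: mult_left_mono)
      also have "\<dots> = ennreal (4 * (C3 * 2 powr (1 - a)) * r powr (1 - a))"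
        using r C3 by (subst ennreal_mult[symmetric]) (simp_all add: powr_mult mult_ac)
      finally show "(\<integral>\<^sup>+y. F3 y \<partial>lborel) \<le> ennreal (4 * (C3 * 2 powr (1 - a)) * r powr (1 - a))" .
      show "(\<integral>\<^sup>+y. F2 y \<partial>lborel) \<le> ennreal (4 * r powr - 2) *
         (\<integral>\<^sup>+y. ennreal (japanese_bracket (y::real^3) powr - a) * indicator {y. norm y < 2 * r} y \<partial>lborel)"
        unfolding F2_def by (subst nn_integral_cmult) auto
    qed
    also have "ennreal (2 powr a * (C1 / 2) * r powr (1 - a)) + ennreal (4 * r powr - 2) *
       (\<integral>\<^sup>+y. ennreal (japanese_bracket (y::real^3) powr - a) * indicator {y. norm y < 2 * r} y \<partial>lborel)
       + ennreal (4 * (C3 * 2 powr (1 - a)) * r powr (1 - a))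
      = ennreal (C * r powr (1 - a)) + ennreal (4 * r powr - 2) *
       (\<integral>\<^sup>+y. ennreal (japanese_bracket (y::real^3) powr - a) * indicator {y. norm y < 2 * r} y \<partial>lborel)"
      using C1 C3 unfolding C_def by (simp add: distrib_right ennreal_plus add_ac)
    finally show ?thesis unfolding r_def .
  qed
  moreover have "C > 0" using C1 C3 by (simp add: C_def add_pos_pos)
  ultimately show ?thesis by blast
qed

lemma nn_integral_japanese_bracket_powr_finite:
  assumes a: "3 < a"
  shows "(\<integral>\<^sup>+y. ennreal (japanese_bracket (y::real^3) powr - a) \<partial>lborel) < \<infinity>"
proof -
  obtain C where C: "\<And>(x::real^3) r. 0 < r \<Longrightarrow>
    (\<integral>\<^sup>+y. ennreal (norm (x - y) powr - a) * indicator {y. r \<le> norm (x - y)} y \<partial>lborel) \<le> ennreal (C * r powr (3 - a))"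
    using nn_integral_outside_ball_norm_powr[of a, where 'a="real^3"] a by auto
  have "(\<integral>\<^sup>+y. ennreal (japanese_bracket (y::real^3) powr - a) \<partial>lborel)
    \<le> (\<integral>\<^sup>+y. indicator {y. norm (y::real^3) < 1} y + ennreal (norm y powr - a) * indicator {y. 1 \<le> norm (y::real^3)} y \<partial>lborel)"
  proof (intro nn_integral_mono)
    fix y :: "real^3"
    have "japanese_bracket y powr - a \<le> 1"
      using japanese_bracket_ge_1[of y] a powr_mono[of "-a" 0 "japanese_bracket y"] by simp
    moreover have "japanese_bracket y powr - a \<le> norm y powr - a" if "1 \<le> norm y"
      using that a norm_le_japanese_bracket by (intro powr_mono2') auto
    ultimately show "ennreal (japanese_bracket y powr - a)
      \<le> indicator {y. norm (y::real^3) < 1} y + ennreal (norm y powr - a) * indicator {y. 1 \<le> norm (y::real^3)} y"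
      by (cases "norm y < 1") (auto simp: dist_norm ennreal_leI)
  qed
  also have "\<dots> = emeasure lborel {y. norm (y::real^3) < 1}
     + (\<integral>\<^sup>+y. ennreal (norm y powr - a) * indicator {y. 1 \<le> norm (y::real^3)} y \<partial>lborel)"
    by (subst nn_integral_add) auto
  also have "\<dots> \<le> emeasure lborel {y. norm (y::real^3) < 1} + ennreal (C * 1)"
    using C[of 1 0] by (intro add_left_mono) simp
  also have "\<dots> < \<infinity>"
    using emeasure_ball[of 1 "0::real^3"] by (simp add: ball_def)
  finally show ?thesis .
qed

text \<open>For \<open>a < 3\<close> the weight is dominated by the locally integrable
  \<open>norm y powr - a\<close>, whose mass up to radius \<open>2 r\<close> is of order
  \<open>r powr (3 - a)\<close>. Multiplied by \<open>r powr - 2\<close> this is again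
  \<open>r powr (1 - a)\<close>, so all three regions contribute equally.\<close>

lemma riesz_potential_decay_slow:
  assumes a: "1 < a" "a < 3"
  shows "\<exists>C>0. \<forall>x::real^3.
    (\<integral>\<^sup>+y. ennreal (norm (x - y) powr - 2 * japanese_bracket y powr - a) \<partial>lborel)
      \<le> ennreal (C * japanese_bracket x powr (1 - a))"
proof -
  obtain C where C: "C > 0" "\<And>x::real^3.
    (\<integral>\<^sup>+y. ennreal (norm (x - y) powr - 2 * japanese_bracket y powr - a) \<partial>lborel)
      \<le> ennreal (C * japanese_bracket x powr (1 - a)) + ennreal (4 * japanese_bracket x powr - 2) *
        (\<integral>\<^sup>+y. ennreal (japanese_bracket (y::real^3) powr - a) * indicator {y. norm y < 2 * japanese_bracket x} y \<partial>lborel)"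
    using riesz_potential_split[OF a(1)] by blast
  obtain K where K: "K > 0" "\<And>(x::real^3) r. 0 < r \<Longrightarrow>
    (\<integral>\<^sup>+y. ennreal (norm (x - y) powr - a) * indicator {y. norm (x - y) < r} y \<partial>lborel) \<le> ennreal (K * r powr (3 - a))"
    using nn_integral_ball_norm_powr[of a, where 'a="real^3"] a by auto
  have "(\<integral>\<^sup>+y. ennreal (norm (x - y) powr - 2 * japanese_bracket y powr - a) \<partial>lborel)
      \<le> ennreal ((C + 4 * (K * 2 powr (3 - a))) * japanese_bracket x powr (1 - a))" for x :: "real^3"
  proof -
    define r where "r = japanese_bracket x"
    have r: "r > 0" by (simp add: r_def)
    have "(\<integral>\<^sup>+y. ennreal (japanese_bracket (y::real^3) powr - a) * indicator {y. norm y < 2 * r} y \<partial>lborel)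
      \<le> (\<integral>\<^sup>+y. ennreal (norm (y::real^3) powr - a) * indicator {y. norm y < 2 * r} y \<partial>lborel)"
      \<comment> \<open>At the origin \<open>norm y powr - a\<close> is 0 by convention while the
        bracket is 1, so the comparison holds only off this null set.\<close>
      using AE_lborel_singleton[of "0::real^3"]
    proof (intro nn_integral_mono_AE, eventually_elim)
      case (elim y)
      then have "japanese_bracket y powr - a \<le> norm y powr - a"
        using a norm_le_japanese_bracket by (intro powr_mono2') auto
      then show ?case by (intro mult_right_mono ennreal_leI) auto
    qed
    also have "\<dots> \<le> ennreal (K * (2 * r) powr (3 - a))" using K(2)[of "2 * r" 0] r by simp
    finally have "ennreal (4 * r powr - 2) * (\<integral>\<^sup>+y. ennreal (japanese_bracket (y::real^3) powr - a) * indicator {y. norm y < 2 * r} y \<partial>lborel)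
      \<le> ennreal (4 * r powr - 2) * ennreal (K * (2 * r) powr (3 - a))"
      by (intro mult_left_mono) auto
    also have "\<dots> = ennreal (4 * (K * 2 powr (3 - a)) * r powr (1 - a))"
      using r K powr_add[of r "-2" "3 - a"] by (simp add: ennreal_mult[symmetric] powr_mult mult_ac)
    finally have "ennreal (C * r powr (1 - a)) + ennreal (4 * r powr - 2) *
        (\<integral>\<^sup>+y. ennreal (japanese_bracket (y::real^3) powr - a) * indicator {y. norm y < 2 * r} y \<partial>lborel)
      \<le> ennreal (C * r powr (1 - a)) + ennreal (4 * (K * 2 powr (3 - a)) * r powr (1 - a))"
      by (rule add_left_mono)
    also have "\<dots> = ennreal ((C + 4 * (K * 2 powr (3 - a))) * r powr (1 - a))"
      using C(1) K(1) by (simp add: distrib_right ennreal_plus)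
    finally show ?thesis unfolding r_def by (rule order_trans[OF C(2)])
  qed
  moreover have "C + 4 * (K * 2 powr (3 - a)) > 0" using C(1) K(1) by (simp add: add_pos_pos)
  ultimately show ?thesis by blast
qed

text \<open>For \<open>a > 3\<close> the weight has finite total mass \<open>K\<close>, so the
  middle region contributes \<open>r powr - 2\<close>. This dominates \<open>r powr (1 - a)\<close>,
  which is why a larger \<open>a\<close> gives no further decay.\<close>

lemma riesz_potential_decay_fast:
  assumes a: "3 < a"
  shows "\<exists>C>0. \<forall>x::real^3.
    (\<integral>\<^sup>+y. ennreal (norm (x - y) powr - 2 * japanese_bracket y powr - a) \<partial>lborel)
      \<le> ennreal (C * japanese_bracket x powr - 2)"
proof -
  obtain C where C: "C > 0" "\<And>x::real^3.
    (\<integral>\<^sup>+y. ennreal (norm (x - y) powr - 2 * japanese_bracket y powr - a) \<partial>lborel)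
      \<le> ennreal (C * japanese_bracket x powr (1 - a)) + ennreal (4 * japanese_bracket x powr - 2) *
        (\<integral>\<^sup>+y. ennreal (japanese_bracket (y::real^3) powr - a) * indicator {y. norm y < 2 * japanese_bracket x} y \<partial>lborel)"
    using riesz_potential_split[of a] a by auto
  obtain K where K: "K \<ge> 0" "(\<integral>\<^sup>+y. ennreal (japanese_bracket (y::real^3) powr - a) \<partial>lborel) = ennreal K"
    using nn_integral_japanese_bracket_powr_finite[OF a]
    by (intro that[of "enn2real (\<integral>\<^sup>+y. ennreal (japanese_bracket (y::real^3) powr - a) \<partial>lborel)"]) auto
  have "(\<integral>\<^sup>+y. ennreal (norm (x - y) powr - 2 * japanese_bracket y powr - a) \<partial>lborel)
      \<le> ennreal ((C + 4 * K) * japanese_bracket x powr - 2)" for x :: "real^3"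
  proof -
    define r where "r = japanese_bracket x"
    have r: "r \<ge> 1" by (simp add: r_def japanese_bracket_ge_1)
    have "(\<integral>\<^sup>+y. ennreal (japanese_bracket (y::real^3) powr - a) * indicator {y. norm y < 2 * r} y \<partial>lborel) \<le> ennreal K"
      unfolding K(2)[symmetric] by (intro nn_integral_mono) (auto simp: indicator_def)
    then have "ennreal (4 * r powr - 2) * (\<integral>\<^sup>+y. ennreal (japanese_bracket (y::real^3) powr - a) * indicator {y. norm y < 2 * r} y \<partial>lborel)
      \<le> ennreal (4 * r powr - 2) * ennreal K"
      by (intro mult_left_mono) auto
    moreover have "ennreal (C * r powr (1 - a)) \<le> ennreal (C * r powr - 2)"
      using C(1) a r by (intro ennreal_leI mult_left_mono powr_mono) auto
    ultimately have "ennreal (C * r powr (1 - a)) + ennreal (4 * r powr - 2) *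
        (\<integral>\<^sup>+y. ennreal (japanese_bracket (y::real^3) powr - a) * indicator {y. norm y < 2 * r} y \<partial>lborel)
      \<le> ennreal (C * r powr - 2) + ennreal (4 * r powr - 2) * ennreal K"
      by (intro add_mono)
    also have "\<dots> = ennreal ((C + 4 * K) * r powr - 2)"
      using C(1) K(1) by (simp add: ring_distribs ennreal_plus ennreal_mult[symmetric] mult_ac)
    finally show ?thesis unfolding r_def by (rule order_trans[OF C(2)])
  qed
  moreover have "C + 4 * K > 0" using C(1) K(1) by (simp add: add_pos_nonneg)
  ultimately show ?thesis by blast
qed

text \<open>The domain is split at half the distance between the two poles.\<close>
lemma riesz_kernel_convolution:
  "\<exists>C>0. \<forall>x z::real^3. x \<noteq> z \<longrightarrow>
    (\<integral>\<^sup>+y. ennreal (norm (x - y) powr - 2 * norm (z - y) powr - 2) \<partial>lborel)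
      \<le> ennreal (C * norm (x - z) powr - 1)"
proof -
  obtain C1 where C1: "C1 > 0" "\<And>(x::real^3) r. 0 < r \<Longrightarrow>
    (\<integral>\<^sup>+y. ennreal (norm (x - y) powr - 2) * indicator {y. norm (x - y) < r} y \<partial>lborel) \<le> ennreal (C1 * r powr 1)"
    using nn_integral_ball_norm_powr[of 2, where 'a="real^3"] by auto
  obtain C3 where C3: "C3 > 0" "\<And>(x::real^3) r. 0 < r \<Longrightarrow>
    (\<integral>\<^sup>+y. ennreal (norm (x - y) powr - 4) * indicator {y. r \<le> norm (x - y)} y \<partial>lborel) \<le> ennreal (C3 * r powr - 1)"
    using nn_integral_outside_ball_norm_powr[of "4", where 'a="real^3"] by auto
  have "(\<integral>\<^sup>+y. ennreal (norm (x - y) powr - 2 * norm (z - y) powr - 2) \<partial>lborel)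
      \<le> ennreal ((4 * C1 + 18 * C3) * norm (x - z) powr - 1)" if "x \<noteq> z" for x z :: "real^3"
  proof -
    define r where "r = norm (x - z)"
    have r: "r > 0" using that by (simp add: r_def)
    have half: "(r / 2) powr - 2 = 4 * r powr - 2" using r by (simp add: powr_divide powr_minus_divide powr_numeral)
    define F where "F u y = ennreal (4 * r powr - 2) * (ennreal (norm (u - y) powr - 2) * indicator {y. norm (u - y) < r / 2} y)" for u y :: "real^3"
    \<comment> \<open>Away from both poles \<open>r \<le> 2 * norm (x - y)\<close>, hence
      \<open>norm (z - y) \<le> 3 * norm (x - y)\<close>; squaring gives the factor 9. The resulting
      exponent 4 exceeds the dimension, and the tail beyond radius \<open>r / 2\<close> scales as
      \<open>1 / r\<close>.\<close>
    define G where "G y = ennreal 9 * (ennreal (norm (z - y) powr - 4) * indicator {y. r / 2 \<le> norm (z - y)} y)" for y :: "real^3"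
    have [measurable]: "F u \<in> borel_measurable borel" "G \<in> borel_measurable borel" for u
      unfolding F_def[abs_def] G_def[abs_def] by simp_all
    have "ennreal (norm (x - y) powr - 2 * norm (z - y) powr - 2) \<le> F x y + F z y + G y" for y
    proof -
      have tri: "r \<le> norm (x - y) + norm (z - y)"
        using norm_triangle_ineq4[of "x - y" "z - y"] by (simp add: r_def)
      have tri2: "norm (z - y) \<le> norm (x - y) + r"
        using norm_triangle_ineq4[of "x - y" "x - z"] by (simp add: r_def norm_minus_commute)
      consider "norm (x - y) < r / 2" | "norm (z - y) < r / 2" | "r / 2 \<le> norm (x - y)" "r / 2 \<le> norm (z - y)"
        by linarith
      then show ?thesis
      proof cases
        case 1
        then have "norm (z - y) powr - 2 \<le> (r / 2) powr - 2"
          using r tri by (intro powr_mono2') auto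
        then have "norm (x - y) powr - 2 * norm (z - y) powr - 2 \<le> 4 * r powr - 2 * norm (x - y) powr - 2"
          unfolding half by (subst mult.commute) (rule mult_right_mono, simp_all)
        then have "ennreal (norm (x - y) powr - 2 * norm (z - y) powr - 2) \<le> F x y"
          unfolding F_def using 1 by (intro ennreal_le_mult_indicator) simp_all
        then show ?thesis by (intro ennreal_le_add3) simp
      next
        case 2
        then have "norm (x - y) powr - 2 \<le> (r / 2) powr - 2"
          using r tri by (intro powr_mono2') auto
        then have "norm (x - y) powr - 2 * norm (z - y) powr - 2 \<le> 4 * r powr - 2 * norm (z - y) powr - 2"
          unfolding half by (rule mult_right_mono) simp
        then have "ennreal (norm (x - y) powr - 2 * norm (z - y) powr - 2) \<le> F z y"
          unfolding F_def using 2 by (intro ennreal_le_mult_indicator) simp_all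
        then show ?thesis by (intro ennreal_le_add3) simp
      next
        case 3
        then have pos: "0 < norm (z - y)" using r by linarith
        have "norm (z - y) / 3 \<le> norm (x - y)" using 3 tri2 by linarith
        then have "norm (x - y) powr - 2 \<le> (norm (z - y) / 3) powr - 2"
          using pos by (intro powr_mono2') auto
        also have "\<dots> = 9 * norm (z - y) powr - 2" using pos by (simp add: powr_divide powr_minus_divide powr_numeral)
        finally have "norm (x - y) powr - 2 * norm (z - y) powr - 2 \<le> 9 * norm (z - y) powr - 2 * norm (z - y) powr - 2"
          by (rule mult_right_mono) simp
        also have "\<dots> = 9 * norm (z - y) powr - 4" using pos by (simp add: powr_add[symmetric])
        finally have "ennreal (norm (x - y) powr - 2 * norm (z - y) powr - 2) \<le> G y"
          unfolding G_def using 3 by (intro ennreal_le_mult_indicator) simp_all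
        then show ?thesis by (intro ennreal_le_add3) simp
      qed
    qed
    then have "(\<integral>\<^sup>+y. ennreal (norm (x - y) powr - 2 * norm (z - y) powr - 2) \<partial>lborel)
      \<le> (\<integral>\<^sup>+y. F x y + F z y + G y \<partial>lborel)" by (intro nn_integral_mono)
    also have "\<dots> = (\<integral>\<^sup>+y. F x y \<partial>lborel) + (\<integral>\<^sup>+y. F z y \<partial>lborel) + (\<integral>\<^sup>+y. G y \<partial>lborel)"
      by (simp add: nn_integral_add)
    also have "\<dots> \<le> ennreal (2 * C1 * r powr - 1) + ennreal (2 * C1 * r powr - 1) + ennreal (18 * C3 * r powr - 1)"
    proof (intro add_mono)
      have F: "(\<integral>\<^sup>+y. F u y \<partial>lborel) \<le> ennreal (2 * C1 * r powr - 1)" for u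
      proof -
        have "(\<integral>\<^sup>+y. F u y \<partial>lborel) \<le> ennreal (4 * r powr - 2) * ennreal (C1 * (r / 2) powr 1)"
          unfolding F_def using C1(2)[of "r / 2" u] r
          by (subst nn_integral_cmult) (auto intro!: mult_left_mono)
        also have "\<dots> = ennreal (2 * C1 * r powr - 1)"
          using r C1 powr_add[of r "-2" 1] by (simp add: ennreal_mult[symmetric] mult_ac)
        finally show ?thesis .
      qed
      show "(\<integral>\<^sup>+y. F x y \<partial>lborel) \<le> ennreal (2 * C1 * r powr - 1)"
        "(\<integral>\<^sup>+y. F z y \<partial>lborel) \<le> ennreal (2 * C1 * r powr - 1)" by (rule F)+
      have "(\<integral>\<^sup>+y. G y \<partial>lborel) \<le> ennreal 9 * ennreal (C3 * (r / 2) powr - 1)"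
        unfolding G_def using C3(2)[of "r / 2" z] r
        by (subst nn_integral_cmult) (auto intro!: mult_left_mono)
      also have "\<dots> = ennreal (9 * (C3 * (r / 2) powr - 1))"
        using C3 by (subst ennreal_mult[symmetric]) simp_all
      also have "9 * (C3 * (r / 2) powr - 1) = 18 * C3 * r powr - 1"
        using r by (simp add: powr_divide powr_minus_divide)
      finally show "(\<integral>\<^sup>+y. G y \<partial>lborel) \<le> ennreal (18 * C3 * r powr - 1)" .
    qed
    also have "\<dots> = ennreal ((4 * C1 + 18 * C3) * r powr - 1)"
      using C1 C3 by (simp add: ennreal_plus[symmetric] distrib_right add_divide_distrib del: ennreal_plus)
    finally show ?thesis by (simp add: r_def)
  qed
  moreover have "4 * C1 + 18 * C3 > 0" using C1 C3 by simp
  ultimately show ?thesis by blast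
qed

section \<open>Smooth functions and cutoffs\<close>

lemma partial_derivative_eq:
  assumes "(\<phi> has_derivative D) (at x)"
  shows "partial_derivative j \<phi> x = D (axis j 1)"
  unfolding partial_derivative_def using frechet_derivative_at[OF assms] by simp

lemma partial_derivative_const: "partial_derivative j (\<lambda>x. c) = (\<lambda>x. 0)"
  by (rule ext) (rule partial_derivative_eq, rule has_derivative_const)

lemma partial_derivative_component:
  "partial_derivative j (\<lambda>x. x $ i) = (\<lambda>x. if i = j then 1 else 0)"
  by (rule ext) (auto simp: axis_def partial_derivative_eq[OF bounded_linear.has_derivative[OF bounded_linear_vec_nth has_derivative_ident]])

lemma partial_derivative_add:
  assumes "f differentiable at x" "g differentiable at x"
  shows "partial_derivative j (\<lambda>x. f x + g x) x = partial_derivative j f x + partial_derivative j g x"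
  using partial_derivative_eq[OF has_derivative_add[OF assms[unfolded frechet_derivative_works]]]
  by (simp add: partial_derivative_def)

lemma partial_derivative_mult:
  assumes "f differentiable at x" "g differentiable at x"
  shows "partial_derivative j (\<lambda>x. f x * g x) x = partial_derivative j f x * g x + f x * partial_derivative j g x"
  using partial_derivative_eq[OF has_derivative_mult[OF assms[unfolded frechet_derivative_works]]]
  by (simp add: partial_derivative_def)

lemma has_derivative_real_compose:
  assumes "(h has_real_derivative h') (at (g x))" "g differentiable at x"
  shows "((\<lambda>x. h (g x)) has_derivative (\<lambda>v. h' * frechet_derivative g (at x) v)) (at x)"
  using has_derivative_compose[OF assms(2)[unfolded frechet_derivative_works] assms(1)[unfolded has_field_derivative_def]] .

lemma partial_derivative_compose:
  assumes "(h has_real_derivative h') (at (g x))" "g differentiable at x"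
  shows "partial_derivative j (\<lambda>x. h (g x)) x = h' * partial_derivative j g x"
  using partial_derivative_eq[OF has_derivative_real_compose[OF assms]]
  by (simp add: partial_derivative_def)

lemma C_k_SucD: "C_k (Suc k) \<phi> \<Longrightarrow> C_k k \<phi>"
proof (induction k arbitrary: \<phi>)
  case 0
  then show ?case
    by (auto simp: continuous_on_eq_continuous_at intro: differentiable_imp_continuous_within)
qed simp

lemma C_k_const: "C_k k (\<lambda>x. c)"
  by (induction k arbitrary: c) (simp_all add: partial_derivative_const)

lemma C_k_component: "C_k k (\<lambda>x. x $ i)"
proof (cases k)
  case 0
  then show ?thesis by (auto intro!: continuous_intros)
next
  case (Suc n)
  then show ?thesis
    by (simp add: partial_derivative_component C_k_const bounded_linear_imp_differentiable[OF bounded_linear_vec_nth])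
qed

lemma C_k_add: "C_k k f \<Longrightarrow> C_k k g \<Longrightarrow> C_k k (\<lambda>x. f x + g x)"
proof (induction k arbitrary: f g)
  case 0
  then show ?case by (auto intro!: continuous_intros)
next
  case (Suc k)
  have "partial_derivative j (\<lambda>x. f x + g x) = (\<lambda>x. partial_derivative j f x + partial_derivative j g x)" for j
    using Suc.prems by (intro ext partial_derivative_add) auto
  with Suc show ?case by auto
qed

lemma C_k_mult: "C_k k f \<Longrightarrow> C_k k g \<Longrightarrow> C_k k (\<lambda>x. f x * g x)"
proof (induction k arbitrary: f g)
  case 0
  then show ?case by (auto intro!: continuous_intros)
next
  case (Suc k)
  have "partial_derivative j (\<lambda>x. f x * g x) = (\<lambda>x. partial_derivative j f x * g x + f x * partial_derivative j g x)" for j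
    using Suc.prems by (intro ext partial_derivative_mult) auto
  moreover have "C_k k f" "C_k k g" using Suc.prems by (auto dest: C_k_SucD simp del: C_k.simps)
  ultimately show ?case using Suc by (auto intro!: C_k_add)
qed

lemma C_k_sum: "(\<And>i. i \<in> I \<Longrightarrow> C_k k (f i)) \<Longrightarrow> C_k k (\<lambda>x. \<Sum>i\<in>I. f i x)"
  by (induction I rule: infinite_finite_induct) (simp_all add: C_k_const C_k_add)

text \<open>The chain rule replaces \<open>d n\<close> by \<open>d (Suc n)\<close>, so the induction
  needs the whole tower of derivatives of the outer function at once. The set \<open>S\<close>
  admits outer functions that are smooth only on part of the line, such as real powers on the
  positive half-line.\<close>

lemma C_k_compose:
  assumes d: "\<And>n t. t \<in> S \<Longrightarrow> (d n has_real_derivative d (Suc n) t) (at t)"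
    and S: "\<And>x. g x \<in> S" and g: "C_k k g"
  shows "C_k k (\<lambda>x. d n (g x))"
  using g
proof (induction k arbitrary: n)
  case 0
  have "isCont (d n) (g x)" for x using d[OF S] by (rule DERIV_isCont)
  with 0 show ?case
    by (auto simp: continuous_on_eq_continuous_at intro: isCont_o2)
next
  case (Suc k)
  then have g: "g differentiable at x" for x by simp
  have "partial_derivative j (\<lambda>x. d n (g x)) = (\<lambda>x. d (Suc n) (g x) * partial_derivative j g x)" for j
    by (rule ext) (rule partial_derivative_compose[OF d[OF S] g])
  moreover have "C_k k g" using Suc.prems by (rule C_k_SucD)
  moreover have "(\<lambda>x. d n (g x)) differentiable at x" for x
    using has_derivative_real_compose[OF d[OF S] g] by (rule differentiableI)
  ultimately show ?case using Suc by (auto intro!: C_k_mult)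
qed

section \<open>A flat function and the cutoffs built from it\<close>

text \<open>The polynomial parameter makes the family closed under differentiation, so smoothness
  follows from a single derivative formula. The case \<open>p = 1\<close> is the classical flat
  function.\<close>

definition exp_bump :: "real poly \<Rightarrow> real \<Rightarrow> real" where
  "exp_bump p t = (if 0 < t then poly p (1 / t) * exp (- (1 / t)) else 0)"

lemma tendsto_poly_exp_minus: "((\<lambda>s::real. poly p s * exp (- s)) \<longlongrightarrow> 0) at_top"
proof (induction p)
  case (pCons a p)
  show ?case
  proof -
    have "((\<lambda>s::real. \<Sum>i\<le>degree (pCons a p). coeff (pCons a p) i * (s ^ i / exp s)) \<longlongrightarrow> (\<Sum>i\<le>degree (pCons a p). coeff (pCons a p) i * 0)) at_top"
      by (intro tendsto_intros tendsto_power_div_exp_0)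
    then show ?thesis by (simp add: poly_altdef exp_minus divide_inverse sum_distrib_right mult.assoc)
  qed
qed simp

text \<open>With \<open>s = 1 / t\<close> one has ds/dt = - s^2, so differentiating
  \<open>p(s) * exp (- s)\<close> yields \<open>s\<^sup>2 * (p(s) - p'(s)) * exp (- s)\<close>; the
  polynomial \<open>[:0, 0, 1:]\<close> is the factor \<open>s\<^sup>2\<close>.\<close>

lemma DERIV_exp_bump:
  "(exp_bump p has_real_derivative exp_bump ([:0, 0, 1:] * (p - pderiv p)) t) (at t)"
proof -
  consider "t < 0" | "t = 0" | "0 < t" by linarith
  then show ?thesis
  proof cases
    case 1
    have "((\<lambda>t. 0) has_real_derivative 0) (at t)" by simp
    then have "(exp_bump p has_real_derivative 0) (at t)"
      by (rule has_field_derivative_transform_within_open[where S="{..<0}"]) (use 1 in \<open>auto simp: exp_bump_def\<close>)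
    then show ?thesis using 1 by (simp add: exp_bump_def)
  next
    case 3
    have "((\<lambda>t. poly p (1 / t) * exp (- (1 / t))) has_real_derivative
        poly ([:0, 0, 1:] * (p - pderiv p)) (1 / t) * exp (- (1 / t))) (at t)"
      using 3 by (auto intro!: derivative_eq_intros simp: field_simps power2_eq_square)
    then have "(exp_bump p has_real_derivative poly ([:0, 0, 1:] * (p - pderiv p)) (1 / t) * exp (- (1 / t))) (at t)"
      by (rule has_field_derivative_transform_within_open[where S="{0<..}"]) (use 3 in \<open>auto simp: exp_bump_def\<close>)
    then show ?thesis using 3 by (simp add: exp_bump_def)
  next
    case 2
    \<comment> \<open>The value at 0 is 0, so this is the difference quotient. Dividing by
      \<open>h\<close> multiplies the polynomial by \<open>1 / h\<close>, which is
      \<open>pCons 0 p\<close>, and the exponential wins as \<open>1 / h\<close> tends to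
      infinity.\<close>
    have "((\<lambda>h. exp_bump p h / h) \<longlongrightarrow> 0) (at_right 0)"
    proof -
      have "((\<lambda>h::real. poly (pCons 0 p) (inverse h) * exp (- inverse h)) \<longlongrightarrow> 0) (at_right 0)"
        using tendsto_poly_exp_minus filterlim_inverse_at_top_right by (rule filterlim_compose)
      then show ?thesis
        by (rule Lim_transform_eventually)
          (auto simp: exp_bump_def divide_inverse mult_ac eventually_at_filter)
    qed
    moreover have "((\<lambda>h. exp_bump p h / h) \<longlongrightarrow> 0) (at_left 0)"
      by (rule Lim_transform_eventually[OF tendsto_const])
        (auto simp: exp_bump_def eventually_at_filter)
    ultimately have "((\<lambda>h. exp_bump p h / h) \<longlongrightarrow> 0) (at 0)"
      by (simp add: filterlim_split_at_real)
    then show ?thesis using 2 by (simp add: DERIV_def exp_bump_def[of _ 0])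
  qed
qed

lemma C_k_exp_bump:
  assumes "C_k k g"
  shows "C_k k (\<lambda>x. exp_bump p (g x))"
proof -
  define d where "d n = exp_bump (((\<lambda>p. [:0, 0, 1:] * (p - pderiv p)) ^^ n) p)" for n
  have "C_k k (\<lambda>x. d 0 (g x))"
    by (rule C_k_compose[where S=UNIV and d=d]) (use DERIV_exp_bump in \<open>auto simp: d_def assms\<close>)
  then show ?thesis by (simp add: d_def)
qed

lemma C_k_powr:
  assumes "C_k k g" "\<And>x. 0 < g x"
  shows "C_k k (\<lambda>x. g x powr a)"
proof -
  define d where "d n t = (\<Prod>i<n. a - real i) * t powr (a - real n)" for n t
  have "C_k k (\<lambda>x. d 0 (g x))"
  proof (rule C_k_compose[where S="{0<..}" and d=d])
    show "(d n has_real_derivative d (Suc n) t) (at t)" if "t \<in> {0<..}" for n t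
      unfolding d_def[abs_def] using that
      by (auto intro!: derivative_eq_intros simp: algebra_simps)
  qed (use assms in auto)
  then show ?thesis by (simp add: d_def)
qed

text \<open>The polynomial \<open>[:0, 0, 1:]\<close> belongs to the derivative of
  \<open>exp_bump 1\<close>, so the four bounds control the cutoffs and their gradients. The value
  \<open>exp (- 1)\<close> comes from \<open>1 / t \<ge> 1\<close>, the value 2 from the quadratic
  Taylor bound of the exponential.\<close>

lemma exp_bump_bounds:
  assumes "t \<le> 1"
  shows "0 \<le> exp_bump 1 t" "exp_bump 1 t \<le> exp (- 1)"
    "0 \<le> exp_bump [:0, 0, 1:] t" "exp_bump [:0, 0, 1:] t \<le> 2"
proof -
  have 1: "1 \<le> 1 / t" if "0 < t" using that assms by simp
  show "0 \<le> exp_bump 1 t" by (simp add: exp_bump_def)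
  show "exp_bump 1 t \<le> exp (- 1)" using 1 by (simp add: exp_bump_def)
  show "0 \<le> exp_bump [:0, 0, 1:] t" by (simp add: exp_bump_def)
  have "s\<^sup>2 \<le> 2 * exp s" if "0 \<le> s" for s :: real
    using exp_lower_Taylor_quadratic[OF that] that by (simp add: field_simps)
  then have "s\<^sup>2 * exp (- s) \<le> 2" if "0 \<le> s" for s :: real
    using that by (simp add: exp_minus field_simps)
  from this[of "1 / t"] show "exp_bump [:0, 0, 1:] t \<le> 2"
    by (simp add: exp_bump_def power2_eq_square)
qed

lemma norm_power2_eq_sum: "(norm (x::real^'n))\<^sup>2 = (\<Sum>i\<in>UNIV. x $ i * x $ i)"
  by (simp add: power2_norm_eq_inner inner_vec_def)

lemma C_k_norm_power2: "C_k k (\<lambda>x. (norm (x - a))\<^sup>2)"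
proof -
  have "C_k k (\<lambda>x. \<Sum>i\<in>UNIV. (x $ i + - a $ i) * (x $ i + - a $ i))"
    by (intro C_k_sum C_k_mult C_k_add C_k_component C_k_const)
  then show ?thesis by (simp add: norm_power2_eq_sum)
qed

lemma has_derivative_norm_power2: "((\<lambda>x. (norm (x - a))\<^sup>2) has_derivative (\<lambda>v. 2 * ((x - a) \<bullet> v))) (at x)"
  unfolding power2_norm_eq_inner by (auto intro!: derivative_eq_intros simp: inner_commute)

lemma partial_derivative_norm_power2:
  "partial_derivative j (\<lambda>x. (norm (x - a))\<^sup>2) x = 2 * (x - a) $ j"
  by (subst partial_derivative_eq[OF has_derivative_norm_power2]) (simp add: inner_axis)

lemma norm_power2_differentiable: "(\<lambda>x. (norm (x - a))\<^sup>2) differentiable (at x)" for a :: "real^'n"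
  using has_derivative_norm_power2 by (rule differentiableI)

text \<open>Each cutoff is the flat bump evaluated at 1 - |x|^2 / (n + 1)^2, multiplied by
  \<open>exp 1\<close> because the bump equals \<open>exp (- 1)\<close> at argument 1. The cutoffs
  approach 1 only pointwise instead of equalling 1 on growing balls; together with the uniform
  gradient bound this is what dominated convergence consumes.\<close>

lemma ex_cutoff_sequence:
  obtains \<eta> :: "nat \<Rightarrow> real^'n \<Rightarrow> real" and M :: real where
    "\<And>n. test_function (\<eta> n)"
    "\<And>n x. \<bar>\<eta> n x\<bar> \<le> 1"
    "\<And>n j x. \<bar>partial_derivative j (\<eta> n) x\<bar> \<le> M"
    "\<And>x. (\<lambda>n. \<eta> n x) \<longlonglongrightarrow> 1"
    "\<And>j x. (\<lambda>n. partial_derivative j (\<eta> n) x) \<longlonglongrightarrow> 0"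
proof -
  define c where "c n = (1 / real (Suc n))\<^sup>2" for n
  have c: "0 < c n" "c n \<le> 1" for n by (simp_all add: c_def power_le_one)
  have c_lim: "c \<longlonglongrightarrow> 0"
    unfolding c_def using tendsto_power[OF LIMSEQ_inverse_real_of_nat, of 2] by (simp add: inverse_eq_divide)
  define g where "g n x = 1 + - c n * (norm (x - 0))\<^sup>2" for n and x :: "real^'n"
  define \<eta> where "\<eta> n x = exp 1 * exp_bump 1 (g n x)" for n and x :: "real^'n"
  have g_le: "g n x \<le> 1" for n x using c(1)[of n] by (simp add: g_def)
  have g_lim: "(\<lambda>n. g n x) \<longlonglongrightarrow> 1" for x
    unfolding g_def by (rule tendsto_eq_intros c_lim refl)+ simp
  have C_k_g: "C_k k (g n)" for k n
    unfolding g_def by (intro C_k_add C_k_mult C_k_const C_k_norm_power2)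
  have C_k_\<eta>: "C_k k (\<eta> n)" for k n
    unfolding \<eta>_def by (intro C_k_mult C_k_const C_k_exp_bump C_k_g)
  have g_diff: "g n differentiable at x" for n x
    using C_k_g[of "Suc 0"] by simp
  have dg: "partial_derivative j (g n) x = - c n * (2 * x $ j)" for j n x
  proof -
    have d0: "(\<lambda>x. - c n * (norm (x - 0))\<^sup>2) differentiable at x"
      by (intro differentiable_mult differentiable_const norm_power2_differentiable)
    show ?thesis
      unfolding g_def partial_derivative_add[OF differentiable_const d0]
        partial_derivative_mult[OF differentiable_const norm_power2_differentiable]
      by (simp only: partial_derivative_const partial_derivative_norm_power2) simp
  qed
  have deriv: "(exp_bump 1 has_real_derivative exp_bump [:0, 0, 1:] t) (at t)" for t
    using DERIV_exp_bump[of 1 t] by simp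
  have d\<eta>: "partial_derivative j (\<eta> n) x = exp 1 * (exp_bump [:0, 0, 1:] (g n x) * (- c n * (2 * x $ j)))" for j n x
    unfolding \<eta>_def
    using differentiableI[OF has_derivative_real_compose[OF deriv g_diff]]
    by (subst partial_derivative_mult)
      (auto simp: partial_derivative_const dg partial_derivative_compose[OF deriv g_diff])
  show thesis
  proof
    show "test_function (\<eta> n)" for n
      unfolding test_function_def
    proof (intro conjI allI C_k_\<eta>)
      have "{x. \<eta> n x \<noteq> 0} \<subseteq> cball 0 (real (Suc n))"
      proof
        fix x assume "x \<in> {x. \<eta> n x \<noteq> 0}"
        then have "0 < g n x" by (simp add: \<eta>_def exp_bump_def split: if_splits)
        then have "(norm x / real (Suc n))\<^sup>2 < 1\<^sup>2" by (simp add: g_def c_def power_divide)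
        then have "norm x / real (Suc n) < 1" by (rule power2_less_imp_less) simp
        then show "x \<in> cball 0 (real (Suc n))" by (simp add: field_simps)
      qed
      then show "compact (closure {x. \<eta> n x \<noteq> 0})"
        using bounded_subset[OF bounded_cball] by (simp add: compact_closure)
    qed
    show "\<bar>\<eta> n x\<bar> \<le> 1" for n x
      using exp_bump_bounds(1,2)[OF g_le[of n x]] by (simp add: \<eta>_def exp_minus field_simps)
    \<comment> \<open>The factor \<open>exp 1\<close> is the normalization, one 2 bounds the
      derivative of the bump, and the other bounds the gradient of \<open>g n\<close>: where
      \<open>g n x > 0\<close> one has \<open>c n * (norm x)\<^sup>2 < 1\<close>, and
      \<open>c n \<le> 1\<close> then gives \<open>c n * norm x \<le> 1\<close>. Where
      \<open>g n x \<le> 0\<close> the derivative vanishes.\<close>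
    show "\<bar>partial_derivative j (\<eta> n) x\<bar> \<le> exp 1 * (2 * 2)" for j n x
    proof (cases "0 < g n x")
      case True
      then have "c n * (norm x)\<^sup>2 < 1" by (simp add: g_def)
      then have "c n * (c n * (norm x)\<^sup>2) \<le> 1 * 1" using c by (intro mult_mono) (auto simp: less_imp_le)
      then have "(c n * norm x)\<^sup>2 \<le> 1\<^sup>2" by (simp add: power2_eq_square mult_ac)
      then have "c n * norm x \<le> 1" by (rule power2_le_imp_le) simp
      moreover have "c n * \<bar>x $ j\<bar> \<le> c n * norm x"
        using c(1)[of n] component_le_norm_cart[of x j] by (intro mult_left_mono) auto
      ultimately have "c n * \<bar>x $ j\<bar> \<le> 1" by (rule order_trans[rotated])
      then have "\<bar>- c n * (2 * x $ j)\<bar> \<le> 2" using c(1)[of n] by (simp add: abs_mult)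
      then have "exp_bump [:0, 0, 1:] (g n x) * \<bar>- c n * (2 * x $ j)\<bar> \<le> 2 * 2"
        using exp_bump_bounds(3,4)[OF g_le[of n x]] by (intro mult_mono) auto
      moreover have "\<bar>partial_derivative j (\<eta> n) x\<bar> = exp 1 * (exp_bump [:0, 0, 1:] (g n x) * \<bar>- c n * (2 * x $ j)\<bar>)"
        using exp_bump_bounds(3)[OF g_le[of n x]] unfolding d\<eta>
        by (simp only: abs_mult abs_exp_cancel abs_of_nonneg)
      ultimately show ?thesis by (simp only: mult_left_mono exp_ge_zero)
    qed (simp add: d\<eta> exp_bump_def)
    have "(\<lambda>n. exp_bump 1 (g n x)) \<longlonglongrightarrow> exp_bump 1 1" for x
      by (rule isCont_tendsto_compose[OF DERIV_isCont[OF deriv] g_lim])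
    from tendsto_mult[OF tendsto_const this, of "exp 1"]
    show "(\<lambda>n. \<eta> n x) \<longlonglongrightarrow> 1" for x
      by (simp add: \<eta>_def exp_bump_def exp_minus)
    show "(\<lambda>n. partial_derivative j (\<eta> n) x) \<longlonglongrightarrow> 0" for j x
    proof -
      have "(\<lambda>n. exp_bump [:0, 0, 1:] (g n x)) \<longlonglongrightarrow> exp_bump [:0, 0, 1:] 1"
        by (rule isCont_tendsto_compose[OF DERIV_isCont[OF DERIV_exp_bump] g_lim])
      then show ?thesis unfolding d\<eta> by (auto intro!: tendsto_eq_intros c_lim)
    qed
  qed
qed

section \<open>Extending the weak identity to test objects without compact support\<close>

lemma integrable_mult_L2:
  fixes u v :: "'a \<Rightarrow> real"
  assumes [measurable]: "u \<in> borel_measurable M" "v \<in> borel_measurable M"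
    and "integrable M (\<lambda>x. (u x)\<^sup>2)" "integrable M (\<lambda>x. (v x)\<^sup>2)"
  shows "integrable M (\<lambda>x. u x * v x)"
proof (rule Bochner_Integration.integrable_bound)
  show "integrable M (\<lambda>x. (u x)\<^sup>2 + (v x)\<^sup>2)" using assms by simp
  have "\<bar>u x * v x\<bar> \<le> (u x)\<^sup>2 + (v x)\<^sup>2" for x
  proof -
    have "2 * (\<bar>u x\<bar> * \<bar>v x\<bar>) \<le> (u x)\<^sup>2 + (v x)\<^sup>2"
      using sum_squares_bound[of "\<bar>u x\<bar>" "\<bar>v x\<bar>"] by simp
    moreover have "0 \<le> \<bar>u x\<bar> * \<bar>v x\<bar>" by simp
    ultimately show ?thesis unfolding abs_mult by linarith
  qed
  then show "AE x in M. norm (u x * v x) \<le> norm ((u x)\<^sup>2 + (v x)\<^sup>2)" by simp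
qed measurable

lemma borel_measurable_C_k: "C_k k \<phi> \<Longrightarrow> \<phi> \<in> borel_measurable borel"
  by (induction k arbitrary: \<phi>)
    (auto intro: borel_measurable_continuous_onI dest: C_k_SucD simp del: C_k.simps(2))

text \<open>The kernels used later decay only polynomially, whereas their products with the cutoffs
  are test functions. The gradients of the cutoffs are uniformly bounded and tend to 0, so in the
  limit the product rule leaves only the gradient of \<phi>. The majorants are built from products
  of two square integrable functions.\<close>

lemma weak_identity_L2_test_function:
  fixes f w :: "real^'n \<Rightarrow> 'b::euclidean_space"
  assumes A: "\<And>j. bounded_linear (A j)"
    and weak: "\<And>\<phi>. test_function \<phi> \<Longrightarrow>
      (\<Sum>j\<in>UNIV. A j (\<integral>x. partial_derivative j \<phi> x *\<^sub>R f x \<partial>lborel)) = (\<integral>x. \<phi> x *\<^sub>R w x \<partial>lborel)"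
    and [measurable]: "f \<in> borel_measurable borel" "w \<in> borel_measurable borel"
    and f: "integrable lborel (\<lambda>x. (norm (f x))\<^sup>2)" and w: "integrable lborel (\<lambda>x. (norm (w x))\<^sup>2)"
    and \<phi>: "\<And>k. C_k k \<phi>" "integrable lborel (\<lambda>x. (\<phi> x)\<^sup>2)"
      "\<And>j. integrable lborel (\<lambda>x. (partial_derivative j \<phi> x)\<^sup>2)"
  shows "(\<Sum>j\<in>UNIV. A j (\<integral>x. partial_derivative j \<phi> x *\<^sub>R f x \<partial>lborel)) = (\<integral>x. \<phi> x *\<^sub>R w x \<partial>lborel)"
proof -
  obtain \<eta> :: "nat \<Rightarrow> real^'n \<Rightarrow> real" and M where \<eta>:
    "\<And>n. test_function (\<eta> n)"
    "\<And>n x. \<bar>\<eta> n x\<bar> \<le> 1"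
    "\<And>n j x. \<bar>partial_derivative j (\<eta> n) x\<bar> \<le> M"
    "\<And>x. (\<lambda>n. \<eta> n x) \<longlonglongrightarrow> 1"
    "\<And>j x. (\<lambda>n. partial_derivative j (\<eta> n) x) \<longlonglongrightarrow> 0"
    using ex_cutoff_sequence by blast
  have C_\<eta>: "C_k k (\<eta> n)" for k n using \<eta>(1) by (simp add: test_function_def)
  have diff: "\<eta> n differentiable at x" "\<phi> differentiable at x" for n x
    using C_\<eta>[of "Suc 0" n] \<phi>(1)[of "Suc 0"] by simp_all
  have C_p: "C_k 0 (partial_derivative j (\<eta> n))" "C_k 0 (partial_derivative j \<phi>)" for j n
    using C_\<eta>[of "Suc 0" n] \<phi>(1)[of "Suc 0"] by simp_all
  note [measurable] = borel_measurable_C_k[OF C_p(1)] borel_measurable_C_k[OF C_p(2)]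
    borel_measurable_C_k[OF C_\<eta>[of 0]] borel_measurable_C_k[OF \<phi>(1)[of 0]]
  have test: "test_function (\<lambda>x. \<eta> n x * \<phi> x)" for n
    unfolding test_function_def
  proof (intro conjI allI C_k_mult C_\<eta> \<phi>(1))
    have "closure {x. \<eta> n x * \<phi> x \<noteq> 0} \<subseteq> closure {x. \<eta> n x \<noteq> 0}" by (intro closure_mono) auto
    then show "compact (closure {x. \<eta> n x * \<phi> x \<noteq> 0})"
      using \<eta>(1)[of n] compact_Int_closed[of "closure {x. \<eta> n x \<noteq> 0}" "closure {x. \<eta> n x * \<phi> x \<noteq> 0}"]
      by (simp add: test_function_def Int_absorb1)
  qed
  have pd: "partial_derivative j (\<lambda>x. \<eta> n x * \<phi> x) = (\<lambda>x. partial_derivative j (\<eta> n) x * \<phi> x + \<eta> n x * partial_derivative j \<phi> x)" for n j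
    by (intro ext partial_derivative_mult diff)
  have lim1: "(\<lambda>n. \<integral>x. partial_derivative j (\<lambda>x. \<eta> n x * \<phi> x) x *\<^sub>R f x \<partial>lborel) \<longlonglongrightarrow> (\<integral>x. partial_derivative j \<phi> x *\<^sub>R f x \<partial>lborel)" for j
  proof (rule integral_dominated_convergence)
    show "integrable lborel (\<lambda>x. (M * (\<bar>\<phi> x\<bar> * norm (f x)) + \<bar>partial_derivative j \<phi> x\<bar> * norm (f x)))"
      using \<phi> f by (intro Bochner_Integration.integrable_add integrable_mult_right integrable_mult_L2) simp_all
    show "AE x in lborel. (\<lambda>n. partial_derivative j (\<lambda>x. \<eta> n x * \<phi> x) x *\<^sub>R f x) \<longlonglongrightarrow> partial_derivative j \<phi> x *\<^sub>R f x"
      unfolding pd by (intro AE_I2) ((rule tendsto_eq_intros \<eta> refl)+, simp)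
    show "AE x in lborel. norm (partial_derivative j (\<lambda>x. \<eta> n x * \<phi> x) x *\<^sub>R f x)
        \<le> M * (\<bar>\<phi> x\<bar> * norm (f x)) + \<bar>partial_derivative j \<phi> x\<bar> * norm (f x)" for n
    proof (rule AE_I2)
      fix x
      have "\<bar>partial_derivative j (\<eta> n) x * \<phi> x + \<eta> n x * partial_derivative j \<phi> x\<bar>
        \<le> M * \<bar>\<phi> x\<bar> + 1 * \<bar>partial_derivative j \<phi> x\<bar>"
        by (intro order_trans[OF abs_triangle_ineq] add_mono; unfold abs_mult; intro mult_right_mono \<eta>) auto
      then have "\<bar>partial_derivative j (\<eta> n) x * \<phi> x + \<eta> n x * partial_derivative j \<phi> x\<bar> * norm (f x)
        \<le> (M * \<bar>\<phi> x\<bar> + 1 * \<bar>partial_derivative j \<phi> x\<bar>) * norm (f x)"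
        by (rule mult_right_mono) simp
      then show "norm (partial_derivative j (\<lambda>x. \<eta> n x * \<phi> x) x *\<^sub>R f x)
        \<le> M * (\<bar>\<phi> x\<bar> * norm (f x)) + \<bar>partial_derivative j \<phi> x\<bar> * norm (f x)"
        unfolding pd norm_scaleR real_norm_def by (simp add: algebra_simps)
    qed
  qed (simp_all add: pd)
  have lim2: "(\<lambda>n. \<integral>x. (\<eta> n x * \<phi> x) *\<^sub>R w x \<partial>lborel) \<longlonglongrightarrow> (\<integral>x. \<phi> x *\<^sub>R w x \<partial>lborel)"
  proof (rule integral_dominated_convergence)
    show "integrable lborel (\<lambda>x. \<bar>\<phi> x\<bar> * norm (w x))"
      using \<phi> w by (intro integrable_mult_L2) simp_all
    show "AE x in lborel. (\<lambda>n. (\<eta> n x * \<phi> x) *\<^sub>R w x) \<longlonglongrightarrow> \<phi> x *\<^sub>R w x"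
      by (intro AE_I2) ((rule tendsto_eq_intros \<eta> refl)+, simp)
    show "AE x in lborel. norm ((\<eta> n x * \<phi> x) *\<^sub>R w x) \<le> \<bar>\<phi> x\<bar> * norm (w x)" for n
      using mult_right_mono[OF \<eta>(2)] by (intro AE_I2) (simp add: abs_mult mult.assoc mult_left_le_one_le \<eta>(2))
  qed simp_all
  have "(\<lambda>n. \<Sum>j\<in>UNIV. A j (\<integral>x. partial_derivative j (\<lambda>x. \<eta> n x * \<phi> x) x *\<^sub>R f x \<partial>lborel))
    \<longlonglongrightarrow> (\<Sum>j\<in>UNIV. A j (\<integral>x. partial_derivative j \<phi> x *\<^sub>R f x \<partial>lborel))"
    by (intro tendsto_sum bounded_linear.tendsto[OF A] lim1)
  then show ?thesis
    using lim2 unfolding weak[OF test] by (rule LIMSEQ_unique)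
qed

section \<open>The regularized fundamental solution\<close>

text \<open>Up to sign this is the gradient in \<open>y\<close> of the regularized Newtonian
  potential (|y - x|^2 + \<epsilon>^2)^(-1/2). Its Jacobian is therefore a Hessian, hence
  symmetric.\<close>

definition soft_kernel :: "real \<Rightarrow> real^3 \<Rightarrow> 3 \<Rightarrow> real^3 \<Rightarrow> real" where
  "soft_kernel \<epsilon> x m y = (y - x) $ m * ((norm (y - x))\<^sup>2 + \<epsilon>\<^sup>2) powr (- 3 / 2)"

text \<open>This is minus the Laplacian of the regularized Newtonian potential, an approximation of
  a multiple of the Dirac delta.\<close>

definition approx_identity :: "real \<Rightarrow> real^3 \<Rightarrow> real" where
  "approx_identity \<epsilon> z = 3 * \<epsilon>\<^sup>2 * ((norm z)\<^sup>2 + \<epsilon>\<^sup>2) powr (- 5 / 2)"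

context
  fixes \<epsilon> :: real
  assumes \<epsilon>: "0 < \<epsilon>"
begin

lemma soft_pos: "0 < (norm z)\<^sup>2 + \<epsilon>\<^sup>2"
  using \<epsilon> by (simp add: add_nonneg_pos)

lemma C_k_soft_kernel: "C_k k (soft_kernel \<epsilon> x m)"
proof -
  have "C_k k (\<lambda>y. (y $ m + - x $ m) * ((norm (y - x))\<^sup>2 + \<epsilon>\<^sup>2) powr (- 3 / 2))"
    by (intro C_k_mult C_k_add C_k_component C_k_const C_k_powr C_k_norm_power2 soft_pos)
  then show ?thesis by (simp add: soft_kernel_def[abs_def])
qed

lemma has_derivative_soft_kernel:
  "(soft_kernel \<epsilon> x m has_derivative (\<lambda>v. v $ m * ((norm (y - x))\<^sup>2 + \<epsilon>\<^sup>2) powr (- 3 / 2)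
     - 3 * (y - x) $ m * ((y - x) \<bullet> v) * ((norm (y - x))\<^sup>2 + \<epsilon>\<^sup>2) powr (- 5 / 2))) (at y)"
proof -
  define s where "s = (norm (y - x))\<^sup>2 + \<epsilon>\<^sup>2"
  have s: "0 < s" by (simp add: s_def soft_pos)
  have "((\<lambda>t. t powr (- 3 / 2)) has_real_derivative (- 3 / 2) * s powr (- 5 / 2)) (at s)"
    using has_real_derivative_powr[OF s, of "- 3 / 2"] by simp
  moreover have "((\<lambda>y. (norm (y - x))\<^sup>2 + \<epsilon>\<^sup>2) has_derivative (\<lambda>v. 2 * ((y - x) \<bullet> v) + 0)) (at y)"
    by (intro has_derivative_add has_derivative_norm_power2 has_derivative_const)
  ultimately have "((\<lambda>y. ((norm (y - x))\<^sup>2 + \<epsilon>\<^sup>2) powr (- 3 / 2)) has_derivative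
      (\<lambda>v. (- 3 / 2) * s powr (- 5 / 2) * (2 * ((y - x) \<bullet> v) + 0))) (at y)"
    unfolding s_def has_field_derivative_def
    by (rule has_derivative_compose[rotated])
  then have "((\<lambda>y. ((norm (y - x))\<^sup>2 + \<epsilon>\<^sup>2) powr (- 3 / 2)) has_derivative
      (\<lambda>v. - 3 * s powr (- 5 / 2) * ((y - x) \<bullet> v))) (at y)"
    by (rule has_derivative_eq_rhs) (simp add: fun_eq_iff)
  moreover have "((\<lambda>y. (y - x) $ m) has_derivative (\<lambda>v. v $ m)) (at y)"
    by (auto intro!: derivative_eq_intros bounded_linear.has_derivative[OF bounded_linear_vec_nth])
  ultimately show ?thesis
    unfolding soft_kernel_def[abs_def] s_def[symmetric]
    by (intro has_derivative_eq_rhs[OF has_derivative_mult[rotated]])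
      (assumption, assumption, auto simp: fun_eq_iff s_def algebra_simps)
qed

lemma partial_derivative_soft_kernel:
  "partial_derivative j (soft_kernel \<epsilon> x m) y =
     (if j = m then 1 else 0) * ((norm (y - x))\<^sup>2 + \<epsilon>\<^sup>2) powr (- 3 / 2)
     - 3 * (y - x) $ m * (y - x) $ j * ((norm (y - x))\<^sup>2 + \<epsilon>\<^sup>2) powr (- 5 / 2)"
  by (subst partial_derivative_eq[OF has_derivative_soft_kernel])
    (simp add: inner_axis, simp add: axis_def)

lemma partial_derivative_soft_kernel_commute:
  "partial_derivative j (soft_kernel \<epsilon> x m) = partial_derivative m (soft_kernel \<epsilon> x j)"
  by (rule ext) (auto simp: partial_derivative_soft_kernel algebra_simps)

text \<open>The three diagonal terms give \<open>3 * s powr (- 3 / 2)\<close>; factoring out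
  \<open>s powr (- 5 / 2)\<close> leaves three times \<open>s\<close> minus the squared distance,
  which is \<open>3 * \<epsilon>\<^sup>2\<close>.\<close>

lemma divergence_soft_kernel:
  "(\<Sum>m\<in>UNIV. partial_derivative m (soft_kernel \<epsilon> x m) y) = approx_identity \<epsilon> (y - x)"
proof -
  define s where "s = (norm (y - x))\<^sup>2 + \<epsilon>\<^sup>2"
  have s: "0 < s" by (simp add: s_def soft_pos)
  have "(\<Sum>m\<in>UNIV. partial_derivative m (soft_kernel \<epsilon> x m) y)
    = 3 * s powr (- 3 / 2) - 3 * (norm (y - x))\<^sup>2 * s powr (- 5 / 2)"
  proof -
    have "(\<Sum>m\<in>UNIV. 3 * (y - x) $ m * (y - x) $ m * s powr (- 5 / 2)) = 3 * (norm (y - x))\<^sup>2 * s powr (- 5 / 2)"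
      unfolding norm_power2_eq_sum sum_distrib_left sum_distrib_right by (simp only: mult.assoc)
    then show ?thesis
      unfolding partial_derivative_soft_kernel s_def[symmetric] sum_subtractf by simp
  qed
  also have "s powr (- 3 / 2) = s * s powr (- 5 / 2)"
    using s powr_add[of s 1 "- 5 / 2"] by simp
  also have "3 * (s * s powr (- 5 / 2)) - 3 * (norm (y - x))\<^sup>2 * s powr (- 5 / 2)
    = 3 * (s - (norm (y - x))\<^sup>2) * s powr (- 5 / 2)" by (simp add: algebra_simps)
  finally show ?thesis by (simp add: s_def approx_identity_def)
qed

text \<open>Every component of \<open>y - x\<close> is at most \<open>s powr (1 / 2)\<close>, so
  everything is measured in powers of \<open>s\<close>. The gradient has size
  \<open>4 * s powr (- 3 / 2)\<close>, with 1 and 3 from its two terms, and half a power is traded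
  for \<open>1 / \<epsilon>\<close> so that kernel and gradient share the square integrable majorant
  \<open>1 / s\<close>.\<close>

lemma soft_kernel_bounds:
  fixes x y :: "real^3"
  defines "s \<equiv> (norm (y - x))\<^sup>2 + \<epsilon>\<^sup>2"
  shows "norm (y - x) * s powr (- 3 / 2) \<le> 1 / s"
    "\<bar>soft_kernel \<epsilon> x m y\<bar> \<le> 1 / s"
    "\<bar>partial_derivative j (soft_kernel \<epsilon> x m) y\<bar> \<le> 4 / \<epsilon> * (1 / s)"
proof -
  have pos: "0 < s" by (simp add: s_def soft_pos)
  have "norm (y - x) \<le> sqrt s" unfolding s_def by (intro real_le_rsqrt) simp
  then have n: "norm (y - x) \<le> s powr (1 / 2)" using pos by (simp add: powr_half_sqrt)
  have c: "\<bar>(y - x) $ i\<bar> \<le> s powr (1 / 2)" for i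
    using component_le_norm_cart[of "y - x" i] n by linarith
  have 1: "s powr (1 / 2) * s powr (- 3 / 2) = 1 / s"
    using pos by (simp add: powr_add[symmetric])
  show "norm (y - x) * s powr (- 3 / 2) \<le> 1 / s"
    using mult_right_mono[OF n powr_ge_zero[of s "- 3 / 2"]] by (simp only: 1)
  have "\<bar>(y - x) $ m\<bar> * s powr (- 3 / 2) \<le> 1 / s"
    using mult_right_mono[OF c[of m] powr_ge_zero[of s "- 3 / 2"]] by (simp only: 1)
  then show "\<bar>soft_kernel \<epsilon> x m y\<bar> \<le> 1 / s"
    by (simp add: soft_kernel_def abs_mult s_def)
  have "\<bar>(y - x) $ m\<bar> * \<bar>(y - x) $ j\<bar> * s powr (- 5 / 2)
     \<le> s powr (1 / 2) * s powr (1 / 2) * s powr (- 5 / 2)"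
    by (intro mult_right_mono mult_mono c) auto
  also have "\<dots> = s powr (- 3 / 2)" by (simp only: powr_add[symmetric]) simp
  finally have "\<bar>3 * (y - x) $ m * (y - x) $ j * s powr (- 5 / 2)\<bar> \<le> 3 * s powr (- 3 / 2)"
    by (simp only: abs_mult abs_numeral powr_ge_zero abs_of_nonneg mult.assoc)
  moreover have "\<bar>(if j = m then 1 else 0) * s powr (- 3 / 2)\<bar> \<le> s powr (- 3 / 2)" by simp
  ultimately have "\<bar>partial_derivative j (soft_kernel \<epsilon> x m) y\<bar> \<le> s powr (- 3 / 2) + 3 * s powr (- 3 / 2)"
    unfolding partial_derivative_soft_kernel s_def[symmetric]
    by (intro order_trans[OF abs_triangle_ineq4] add_mono)
  also have "\<dots> = 4 * s powr (- 1 / 2) * (1 / s)"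
  proof -
    have "s powr (- 1 / 2) * s powr (- 1) = s powr (- 3 / 2)" by (simp only: powr_add[symmetric]) simp
    then show ?thesis using pos by simp
  qed
  also have "\<dots> \<le> 4 * (1 / \<epsilon>) * (1 / s)"
  proof -
    have "s powr (- 1 / 2) \<le> (\<epsilon>\<^sup>2) powr (- 1 / 2)"
      using \<epsilon> by (intro powr_mono2') (auto simp: s_def)
    also have "(\<epsilon>\<^sup>2) powr (- 1 / 2) = 1 / \<epsilon>"
      using \<epsilon> by (simp add: powr_minus_divide powr_half_sqrt)
    finally show ?thesis using pos by (intro mult_right_mono mult_left_mono) auto
  qed
  finally show "\<bar>partial_derivative j (soft_kernel \<epsilon> x m) y\<bar> \<le> 4 / \<epsilon> * (1 / s)" by simp
qed

text \<open>Near the centre \<epsilon> bounds the integrand; far away it is below the fourth inverse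
  power of the distance, and 4 exceeds the dimension 3.\<close>

lemma integrable_soft_square:
  "integrable lborel (\<lambda>y::real^3. (1 / ((norm (y - x))\<^sup>2 + \<epsilon>\<^sup>2))\<^sup>2)"
proof (rule integrableI_bounded)
  obtain C where C: "\<And>(x::real^3) r. 0 < r \<Longrightarrow>
    (\<integral>\<^sup>+y. ennreal (norm (x - y) powr - 4) * indicator {y. r \<le> norm (x - y)} y \<partial>lborel) \<le> ennreal (C * r powr - 1)"
    using nn_integral_outside_ball_norm_powr[of "4", where 'a="real^3"] by auto
  have "(\<integral>\<^sup>+y. ennreal (norm ((1 / ((norm (y - x))\<^sup>2 + \<epsilon>\<^sup>2))\<^sup>2)) \<partial>lborel)
    \<le> (\<integral>\<^sup>+y. ennreal ((1 / \<epsilon>\<^sup>2)\<^sup>2) * indicator {y. norm (x - y) < 1} y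
        + ennreal (norm (x - y) powr - 4) * indicator {y. 1 \<le> norm (x - y)} y \<partial>lborel)"
  proof (rule nn_integral_mono)
    fix y
    define s where "s = (norm (y - x))\<^sup>2 + \<epsilon>\<^sup>2"
    have s: "0 < s" by (simp add: s_def soft_pos)
    have 1: "norm ((1 / s)\<^sup>2) \<le> (1 / \<epsilon>\<^sup>2)\<^sup>2"
      using \<epsilon> s by (simp, intro power_mono frac_le divide_left_mono) (auto simp: s_def)
    have 2: "norm ((1 / s)\<^sup>2) \<le> norm (x - y) powr - 4" if "1 \<le> norm (x - y)"
    proof -
      have n: "0 < norm (x - y)" using that by linarith
      then have "(1 / s)\<^sup>2 \<le> (1 / (norm (x - y))\<^sup>2)\<^sup>2"
        using s by (intro power_mono frac_le zero_less_power) (simp_all add: s_def norm_minus_commute)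
      also have "\<dots> = norm (x - y) powr - 4"
        using n by (simp add: powr_minus_divide powr_numeral power_divide power_mult[symmetric])
      finally show ?thesis by simp
    qed
    show "ennreal (norm ((1 / s)\<^sup>2))
      \<le> ennreal ((1 / \<epsilon>\<^sup>2)\<^sup>2) * indicator {y. norm (x - y) < 1} y
        + ennreal (norm (x - y) powr - 4) * indicator {y. 1 \<le> norm (x - y)} y"
      using ennreal_leI[OF 1] ennreal_leI[OF 2]
      by (cases "norm (x - y) < 1") (simp_all add: dist_norm)
  qed
  also have "\<dots> = ennreal ((1 / \<epsilon>\<^sup>2)\<^sup>2) * emeasure lborel {y. norm (x - y) < 1}
     + (\<integral>\<^sup>+y. ennreal (norm (x - y) powr - 4) * indicator {y. 1 \<le> norm (x - y)} y \<partial>lborel)"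
    by (subst nn_integral_add) (auto simp: nn_integral_cmult)
  also have "\<dots> \<le> ennreal ((1 / \<epsilon>\<^sup>2)\<^sup>2) * emeasure lborel {y. norm (x - y) < 1} + ennreal (C * 1)"
    using C[of 1 x] by (intro add_left_mono) simp
  also have "\<dots> < \<infinity>"
    using emeasure_ball[of 1 x] by (simp add: ennreal_mult_less_top ball_def dist_norm)
  finally show "(\<integral>\<^sup>+y. ennreal (norm ((1 / ((norm (y - x))\<^sup>2 + \<epsilon>\<^sup>2))\<^sup>2)) \<partial>lborel) < \<infinity>" .
qed simp

lemma integrable_square_bound:
  fixes u :: "real^3 \<Rightarrow> real"
  assumes "u \<in> borel_measurable borel" "\<And>y. \<bar>u y\<bar> \<le> c * (1 / ((norm (y - x))\<^sup>2 + \<epsilon>\<^sup>2))"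
  shows "integrable lborel (\<lambda>y. (u y)\<^sup>2)"
proof (rule Bochner_Integration.integrable_bound)
  show "integrable lborel (\<lambda>y. c\<^sup>2 * (1 / ((norm (y - x))\<^sup>2 + \<epsilon>\<^sup>2))\<^sup>2)"
    by (intro integrable_mult_right integrable_soft_square)
  have "(u y)\<^sup>2 \<le> c\<^sup>2 * (1 / ((norm (y - x))\<^sup>2 + \<epsilon>\<^sup>2))\<^sup>2" for y
    unfolding power_mult_distrib[symmetric] using assms(2)[of y]
    by (subst abs_le_square_iff[symmetric]) (rule order_trans[OF _ abs_ge_self])
  then show "AE y in lborel. norm ((u y)\<^sup>2) \<le> norm (c\<^sup>2 * (1 / ((norm (y - x))\<^sup>2 + \<epsilon>\<^sup>2))\<^sup>2)" by simp
qed (use assms in simp)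

lemma soft_kernel_L2:
  "integrable lborel (\<lambda>y. (soft_kernel \<epsilon> x m y)\<^sup>2)"
  "integrable lborel (\<lambda>y. (partial_derivative j (soft_kernel \<epsilon> x m) y)\<^sup>2)"
  "soft_kernel \<epsilon> x m \<in> borel_measurable borel"
  "partial_derivative j (soft_kernel \<epsilon> x m) \<in> borel_measurable borel"
proof -
  show [measurable]: "soft_kernel \<epsilon> x m \<in> borel_measurable borel"
    by (rule borel_measurable_C_k[OF C_k_soft_kernel])
  show [measurable]: "partial_derivative j (soft_kernel \<epsilon> x m) \<in> borel_measurable borel"
    using C_k_soft_kernel[of "Suc 0" x m] by (intro borel_measurable_C_k[of 0]) simp
  show "integrable lborel (\<lambda>y. (soft_kernel \<epsilon> x m y)\<^sup>2)"
    using soft_kernel_bounds(2) by (intro integrable_square_bound[of _ 1 x]) auto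
  show "integrable lborel (\<lambda>y. (partial_derivative j (soft_kernel \<epsilon> x m) y)\<^sup>2)"
    using soft_kernel_bounds(3) by (intro integrable_square_bound[of _ "4 / \<epsilon>" x]) auto
qed

text \<open>The Clifford relations turn the gradient of the kernel, which is symmetric in both indices,
  into its divergence.\<close>
lemma regularized_representation:
  fixes f w :: "real^3 \<Rightarrow> 'b::euclidean_space"
  assumes A: "\<And>j. bounded_linear (A j)"
    and clifford: "\<And>i j v. A i (A j v) + A j (A i v) = (if i = j then 2 else 0) *\<^sub>R v"
    and weak: "\<And>\<phi>. test_function \<phi> \<Longrightarrow>
      (\<Sum>j\<in>UNIV. A j (\<integral>x. partial_derivative j \<phi> x *\<^sub>R f x \<partial>lborel)) = (\<integral>x. \<phi> x *\<^sub>R w x \<partial>lborel)"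
    and meas [measurable]: "f \<in> borel_measurable borel" "w \<in> borel_measurable borel"
    and f: "integrable lborel (\<lambda>x. (norm (f x))\<^sup>2)" and w: "integrable lborel (\<lambda>x. (norm (w x))\<^sup>2)"
  shows "(\<integral>y. approx_identity \<epsilon> (y - x) *\<^sub>R f y \<partial>lborel)
    = (\<integral>y. ((norm (y - x))\<^sup>2 + \<epsilon>\<^sup>2) powr (- 3 / 2) *\<^sub>R (\<Sum>m\<in>UNIV. (y - x) $ m *\<^sub>R A m (w y)) \<partial>lborel)"
proof -
  note [measurable] = soft_kernel_L2(3,4)
  define I where "I j m = (\<integral>y. partial_derivative j (soft_kernel \<epsilon> x m) y *\<^sub>R f y \<partial>lborel)" for j m
  have I_int: "integrable lborel (\<lambda>y. partial_derivative j (soft_kernel \<epsilon> x m) y *\<^sub>R f y)" for j m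
    using integrable_mult_L2[of "partial_derivative j (soft_kernel \<epsilon> x m)" lborel "\<lambda>y. norm (f y)"] f soft_kernel_L2(2)
    by (subst integrable_norm_iff[symmetric]) (auto simp: abs_mult elim!: integrable_abs_cancel dest: integrable_abs)
  have w_int: "integrable lborel (\<lambda>y. soft_kernel \<epsilon> x m y *\<^sub>R w y)" for m
    using integrable_mult_L2[of "soft_kernel \<epsilon> x m" lborel "\<lambda>y. norm (w y)"] w soft_kernel_L2(1)
    by (subst integrable_norm_iff[symmetric]) (auto simp: abs_mult elim!: integrable_abs_cancel dest: integrable_abs)
  have sym: "I j m = I m j" for j m
    unfolding I_def by (subst partial_derivative_soft_kernel_commute) simp
  have lin: "linear (A j)" for j using A by (simp add: bounded_linear.linear)
  have weak_m: "(\<Sum>j\<in>UNIV. A j (I j m)) = (\<integral>y. soft_kernel \<epsilon> x m y *\<^sub>R w y \<partial>lborel)" for m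
    unfolding I_def
    by (rule weak_identity_L2_test_function[OF A weak meas f w C_k_soft_kernel soft_kernel_L2(1) soft_kernel_L2(2)])
  \<comment> \<open>Doubling allows every pair of indices to be written in both orders. By the
    symmetry of \<open>I\<close> both orders carry the same vector, so the anticommutator appears:
    off-diagonal pairs cancel and diagonal ones double.\<close>
  have "2 *\<^sub>R (\<Sum>m\<in>UNIV. A m (\<Sum>j\<in>UNIV. A j (I j m)))
    = (\<Sum>m\<in>UNIV. \<Sum>j\<in>UNIV. A m (A j (I j m))) + (\<Sum>j\<in>UNIV. \<Sum>m\<in>UNIV. A m (A j (I j m)))"
    by (subst sum.swap) (simp add: scaleR_2 linear_sum[OF lin])
  also have "\<dots> = (\<Sum>m\<in>UNIV. \<Sum>j\<in>UNIV. A m (A j (I j m)) + A j (A m (I j m)))"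
    by (simp add: sum.distrib sym)
  also have "\<dots> = 2 *\<^sub>R (\<Sum>m\<in>UNIV. I m m)"
    by (simp add: clifford if_distrib[of "\<lambda>c. c *\<^sub>R _"] scaleR_sum_right sum.delta' cong: if_cong)
  finally have "(\<Sum>m\<in>UNIV. I m m) = (\<Sum>m\<in>UNIV. A m (\<Sum>j\<in>UNIV. A j (I j m)))" by simp
  moreover have "(\<Sum>m\<in>UNIV. I m m) = (\<integral>y. approx_identity \<epsilon> (y - x) *\<^sub>R f y \<partial>lborel)"
    unfolding I_def divergence_soft_kernel[symmetric] scaleR_sum_left
    by (rule Bochner_Integration.integral_sum[symmetric]) (rule I_int)
  moreover have "(\<Sum>m\<in>UNIV. A m (\<integral>y. soft_kernel \<epsilon> x m y *\<^sub>R w y \<partial>lborel))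
    = (\<integral>y. ((norm (y - x))\<^sup>2 + \<epsilon>\<^sup>2) powr (- 3 / 2) *\<^sub>R (\<Sum>m\<in>UNIV. (y - x) $ m *\<^sub>R A m (w y)) \<partial>lborel)"
  proof -
    have "(\<Sum>m\<in>UNIV. A m (\<integral>y. soft_kernel \<epsilon> x m y *\<^sub>R w y \<partial>lborel))
      = (\<Sum>m\<in>UNIV. (\<integral>y. A m (soft_kernel \<epsilon> x m y *\<^sub>R w y) \<partial>lborel))"
      by (intro sum.cong refl integral_bounded_linear[OF A w_int, symmetric])
    also have "\<dots> = (\<integral>y. (\<Sum>m\<in>UNIV. A m (soft_kernel \<epsilon> x m y *\<^sub>R w y)) \<partial>lborel)"
      by (rule Bochner_Integration.integral_sum[symmetric]) (intro integrable_bounded_linear[OF A] w_int)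
    finally show ?thesis
      by (simp add: soft_kernel_def linear_scale[OF lin] scaleR_sum_right mult.commute)
  qed
  ultimately show ?thesis by (simp add: weak_m)
qed

end

section \<open>Passing to the limit\<close>

text \<open>Boxes are stable under intersection and generate the Borel sets, so a Dynkin argument
  spreads the vanishing from boxes to all Borel sets. Restricting \<open>u\<close> to a box
  \<open>B n\<close> first makes it integrable, and intersecting a box with \<open>B n\<close> gives
  a box again, so the hypothesis still applies.\<close>

lemma AE_eq_0_if_box_integrals_0:
  fixes u :: "'a::euclidean_space \<Rightarrow> 'b::euclidean_space"
  assumes int: "\<And>a b. set_integrable lborel (box a b) u"
    and zero: "\<And>a b. set_lebesgue_integral lborel (box a b) u = 0"
  shows "AE x in lborel. u x = 0"
proof -
  define B where "B n = box (- real n *\<^sub>R One) (real n *\<^sub>R (One::'a))" for n :: nat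
  have AE_n: "AE x in lborel. indicat_real (B n) x *\<^sub>R u x = 0" for n
  proof (rule sigma_finite_measure.density_zero[OF lborel.sigma_finite_measure_axioms])
    define v where "v x = indicat_real (B n) x *\<^sub>R u x" for x
    have v: "integrable lborel v" using int unfolding v_def B_def set_integrable_def .
    then have v_set: "set_integrable lborel A v" if "A \<in> sets lborel" for A
      unfolding set_integrable_def using that by (intro integrable_mult_indicator)
    show "integrable lborel (\<lambda>x. indicat_real (B n) x *\<^sub>R u x)" using v unfolding v_def .
    fix A :: "'a set" assume "A \<in> sets lborel"
    then have A: "A \<in> sigma_sets UNIV (range (\<lambda>(a, b). box a b))"
      by (simp add: borel_eq_box)
    have "Int_stable (range (\<lambda>(a, b). box a b :: 'a set))"
      by (auto simp: Int_stable_def box_Int_box)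
    moreover have "range (\<lambda>(a, b). box a b :: 'a set) \<subseteq> Pow UNIV" by simp
    ultimately show "set_lebesgue_integral lborel A (\<lambda>x. indicat_real (B n) x *\<^sub>R u x) = 0"
      unfolding v_def[symmetric] using A
    proof (induction A rule: sigma_sets_induct_disjoint)
      case (basic A)
      then obtain a b where A: "A = box a b" by auto
      have "indicat_real A x *\<^sub>R v x = indicat_real (A \<inter> B n) x *\<^sub>R u x" for x
        by (auto simp: v_def indicator_def)
      then show ?case
        using zero unfolding A set_lebesgue_integral_def B_def by (simp add: box_Int_box)
    next
      case empty
      then show ?case by (simp add: set_lebesgue_integral_def)
    next
      case (compl A)
      then have A: "A \<in> sets lborel" by (simp add: borel_eq_box)
      have "indicat_real (UNIV - A) x *\<^sub>R v x = v x - indicat_real A x *\<^sub>R v x" for x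
        by (auto simp: indicator_def)
      moreover have "integral\<^sup>L lborel v = 0"
        using zero unfolding v_def B_def set_lebesgue_integral_def .
      ultimately show ?case
        using compl v_set[OF A] v unfolding set_lebesgue_integral_def set_integrable_def by simp
    next
      case (union A)
      have A: "A i \<in> sets lborel" for i using union(2) by (auto simp: borel_eq_box)
      have "set_lebesgue_integral lborel (\<Union>i. A i) v = (\<Sum>i. set_lebesgue_integral lborel (A i) v)"
        using union(1) A by (intro lebesgue_integral_countable_add v_set) (auto simp: disjoint_family_on_def)
      then show ?case using union(3) by simp
    qed
  qed
  have "AE x in lborel. \<forall>n. indicat_real (B n) x *\<^sub>R u x = 0"
    unfolding AE_all_countable using AE_n by blast
  then show ?thesis
  proof eventually_elim
    case (elim x)
    obtain n where "x \<in> B n" using UN_box_eq_UNIV by (force simp: B_def)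
    with elim show ?case by (metis indicator_simps(1) scaleR_one)
  qed
qed

lemma integral_lborel_translate:
  fixes f :: "'a::euclidean_space \<Rightarrow> 'b::euclidean_space"
  assumes [measurable]: "f \<in> borel_measurable borel"
  shows "(\<integral>x. f (x + a) \<partial>lborel) = (\<integral>x. f x \<partial>lborel)"
proof -
  have "(\<integral>x. f x \<partial>lborel) = (\<integral>x. f x \<partial>distr lborel borel ((+) a))" by (simp add: lborel_distr_plus)
  also have "\<dots> = (\<integral>x. f (a + x) \<partial>lborel)" by (rule integral_distr) auto
  finally show ?thesis by (simp add: add.commute)
qed

lemma nn_integral_lborel_translate:
  fixes f :: "'a::euclidean_space \<Rightarrow> ennreal"
  assumes [measurable]: "f \<in> borel_measurable borel"
  shows "(\<integral>\<^sup>+x. f (x + a) \<partial>lborel) = (\<integral>\<^sup>+x. f x \<partial>lborel)"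
proof -
  have "(\<integral>\<^sup>+x. f x \<partial>lborel) = (\<integral>\<^sup>+x. f x \<partial>distr lborel borel ((+) a))" by (simp add: lborel_distr_plus)
  also have "\<dots> = (\<integral>\<^sup>+x. f (a + x) \<partial>lborel)" by (rule nn_integral_distr) auto
  finally show ?thesis by (simp add: add.commute)
qed

lemma integral_lborel_affine:
  fixes f :: "'a::euclidean_space \<Rightarrow> 'b::euclidean_space"
  assumes [measurable]: "f \<in> borel_measurable borel" and c: "0 < c"
  shows "(\<integral>x. f x \<partial>lborel) = c ^ DIM('a) *\<^sub>R (\<integral>x. f (a + c *\<^sub>R x) \<partial>lborel)"
proof -
  have "(\<integral>x. f x \<partial>lborel) = (\<integral>x. f x \<partial>density (distr lborel borel (\<lambda>x. a + c *\<^sub>R x)) (\<lambda>_. \<bar>c\<bar> ^ DIM('a)))"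
    using lborel_affine[of c a] c by simp
  also have "\<dots> = (\<integral>x. c ^ DIM('a) *\<^sub>R f x \<partial>distr lborel borel (\<lambda>x. a + c *\<^sub>R x))"
    using c by (subst integral_density) auto
  also have "\<dots> = (\<integral>x. c ^ DIM('a) *\<^sub>R f (a + c *\<^sub>R x) \<partial>lborel)"
    by (rule integral_distr) auto
  finally show ?thesis by simp
qed

section \<open>Mass, scaling and weak convergence of the approximate identity\<close>

lemma approx_identity_nonneg: "0 \<le> approx_identity \<epsilon> z"
  by (simp add: approx_identity_def)

lemma borel_measurable_approx_identity [measurable]: "approx_identity \<epsilon> \<in> borel_measurable borel"
  unfolding approx_identity_def[abs_def] by measurable

lemma integrable_japanese_bracket_powr:
  assumes "3 < a"
  shows "integrable lborel (\<lambda>y::real^3. japanese_bracket y powr - a)"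
  using nn_integral_japanese_bracket_powr_finite[OF assms] by (intro integrableI_bounded) simp_all

text \<open>At scale 1 the kernel is three times the bracket to the power -5, and 5 exceeds the
  dimension.\<close>

lemma integrable_approx_identity: "integrable lborel (approx_identity 1)"
proof -
  have "approx_identity 1 z = 3 * japanese_bracket z powr - 5" for z
  proof -
    have "0 \<le> 1 + (norm z)\<^sup>2" by simp
    then have "japanese_bracket z = (1 + (norm z)\<^sup>2) powr (1 / 2)"
      unfolding japanese_bracket_def by (rule powr_half_sqrt[symmetric])
    then have "japanese_bracket z powr - 5 = (1 + (norm z)\<^sup>2) powr (1 / 2 * - 5)"
      by (simp only: powr_powr)
    then show ?thesis by (simp add: approx_identity_def add.commute)
  qed
  then have "approx_identity 1 = (\<lambda>z. 3 * japanese_bracket z powr - 5)" by (rule ext)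
  then show ?thesis using integrable_japanese_bracket_powr[of 5] by simp
qed

text \<open>A nonnegative function with zero integral vanishes almost everywhere, but this one
  vanishes nowhere, which would make the whole space a null set. Positivity permits dividing the
  representation formula by this constant.\<close>

lemma integral_approx_identity_pos: "0 < (\<integral>z. approx_identity 1 z \<partial>lborel)"
proof -
  have "(\<integral>z. approx_identity 1 z \<partial>lborel) \<noteq> 0"
  proof
    assume "(\<integral>z. approx_identity 1 z \<partial>lborel) = 0"
    then have "AE z in lborel. approx_identity 1 z = 0"
      using integral_nonneg_eq_0_iff_AE[OF integrable_approx_identity] approx_identity_nonneg by simp
    then have "AE z::real^3 in lborel. False"
      by (rule eventually_mono) (simp add: approx_identity_def add_nonneg_eq_0_iff)
    then have "(UNIV :: (real^3) set) \<in> null_sets lborel"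
      using AE_iff_null[of lborel "\<lambda>_::real^3. False"] by simp
    then show False using null_setsD1 emeasure_lborel_UNIV[where 'a="real^3"] by fastforce
  qed
  moreover have "0 \<le> (\<integral>z. approx_identity 1 z \<partial>lborel)"
    by (intro integral_nonneg_AE) (simp add: approx_identity_nonneg)
  ultimately show ?thesis by simp
qed

text \<open>The powers of \<epsilon> balance: 3 from the volume element, 2 from the prefactor and -5
  from the bracket. Hence the mass is the same at every scale.\<close>

lemma approx_identity_scale:
  assumes "0 < \<epsilon>"
  shows "\<epsilon> ^ 3 * approx_identity \<epsilon> (\<epsilon> *\<^sub>R z) = approx_identity 1 z"
proof -
  have "\<epsilon>\<^sup>2 * (norm z)\<^sup>2 + \<epsilon>\<^sup>2 = \<epsilon>\<^sup>2 * ((norm z)\<^sup>2 + 1)" by (simp add: algebra_simps)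
  then have "((norm (\<epsilon> *\<^sub>R z))\<^sup>2 + \<epsilon>\<^sup>2) powr (- 5 / 2) = (\<epsilon>\<^sup>2) powr (- 5 / 2) * ((norm z)\<^sup>2 + 1) powr (- 5 / 2)"
    using assms by (simp add: power_mult_distrib powr_mult)
  moreover have "(\<epsilon>\<^sup>2) powr (- 5 / 2) = \<epsilon> powr - 5"
    using assms powr_powr[of \<epsilon> 2 "- 5 / 2"] by simp
  moreover have "\<epsilon> ^ 3 * \<epsilon>\<^sup>2 * \<epsilon> powr - 5 = 1"
    using assms by (simp add: powr_minus powr_numeral power_add[symmetric])
  ultimately have "\<epsilon> ^ 3 * (3 * \<epsilon>\<^sup>2 * ((norm (\<epsilon> *\<^sub>R z))\<^sup>2 + \<epsilon>\<^sup>2) powr (- 5 / 2))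
    = 3 * 1 * ((norm z)\<^sup>2 + 1) powr (- 5 / 2)"
  proof -
    assume eqs: "((norm (\<epsilon> *\<^sub>R z))\<^sup>2 + \<epsilon>\<^sup>2) powr (- 5 / 2) = (\<epsilon>\<^sup>2) powr (- 5 / 2) * ((norm z)\<^sup>2 + 1) powr (- 5 / 2)"
      "(\<epsilon>\<^sup>2) powr (- 5 / 2) = \<epsilon> powr - 5" "\<epsilon> ^ 3 * \<epsilon>\<^sup>2 * \<epsilon> powr - 5 = 1"
    have "\<epsilon> ^ 3 * (3 * \<epsilon>\<^sup>2 * (\<epsilon> powr - 5 * ((norm z)\<^sup>2 + 1) powr (- 5 / 2)))
      = 3 * (\<epsilon> ^ 3 * \<epsilon>\<^sup>2 * \<epsilon> powr - 5) * ((norm z)\<^sup>2 + 1) powr (- 5 / 2)"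
      by (simp only: mult_ac)
    then show ?thesis by (simp only: eqs)
  qed
  then show ?thesis by (simp add: approx_identity_def)
qed

lemma integrable_indicator_scaleR_L2:
  fixes f :: "'a::euclidean_space \<Rightarrow> 'b::euclidean_space"
  assumes [measurable]: "f \<in> borel_measurable borel" "S \<in> sets borel"
    and f: "integrable lborel (\<lambda>x. (norm (f x))\<^sup>2)" and S: "emeasure lborel S < \<infinity>"
  shows "integrable lborel (\<lambda>x. indicat_real S x *\<^sub>R f x)"
proof -
  have "(\<lambda>x. (indicat_real S x)\<^sup>2) = indicat_real S" by (auto simp: indicator_def)
  then have "integrable lborel (\<lambda>x. (indicat_real S x)\<^sup>2)"
    using S by (simp add: integrable_indicator_iff)
  then have "integrable lborel (\<lambda>x. indicat_real S x * norm (f x))"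
    using f by (intro integrable_mult_L2) simp_all
  then show ?thesis by (subst integrable_norm_iff[symmetric]) (simp_all add: abs_mult)
qed

text \<open>From \<open>t \<le> 1 + t\<^sup>2\<close> and translation invariance the bound is
  independent of \<open>v\<close>; this uniformity supplies the dominating constant for averages
  over shifted boxes.\<close>

lemma nn_integral_indicator_translate_le:
  fixes f :: "'a::euclidean_space \<Rightarrow> 'b::euclidean_space"
  assumes [measurable]: "f \<in> borel_measurable borel" "S \<in> sets borel"
    and f: "integrable lborel (\<lambda>x. (norm (f x))\<^sup>2)" and S: "emeasure lborel S < \<infinity>"
  shows "(\<integral>\<^sup>+x. ennreal (norm (indicat_real S x *\<^sub>R f (x + v))) \<partial>lborel)
    \<le> ennreal (measure lborel S + (\<integral>x. (norm (f x))\<^sup>2 \<partial>lborel))"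
proof -
  have "(\<integral>\<^sup>+x. ennreal (norm (indicat_real S x *\<^sub>R f (x + v))) \<partial>lborel)
    \<le> (\<integral>\<^sup>+x. indicator S x + ennreal ((norm (f (x + v)))\<^sup>2) \<partial>lborel)"
  proof (rule nn_integral_mono)
    fix x
    have "norm (f (x + v)) \<le> 1 + (norm (f (x + v)))\<^sup>2"
      using sum_squares_bound[of 1 "norm (f (x + v))"] norm_ge_zero[of "f (x + v)"] by (simp only: power_one mult_1_right)
    then show "ennreal (norm (indicat_real S x *\<^sub>R f (x + v))) \<le> indicator S x + ennreal ((norm (f (x + v)))\<^sup>2)"
      by (auto simp: indicator_def ennreal_plus[symmetric] ennreal_1[symmetric] simp del: ennreal_plus ennreal_1 intro!: ennreal_leI)
  qed
  also have "\<dots> = emeasure lborel S + (\<integral>\<^sup>+x. ennreal ((norm (f x))\<^sup>2) \<partial>lborel)"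
    using nn_integral_lborel_translate[of "\<lambda>x. ennreal ((norm (f x))\<^sup>2)" v]
    by (subst nn_integral_add) simp_all
  also have "\<dots> = ennreal (measure lborel S) + ennreal (\<integral>x. (norm (f x))\<^sup>2 \<partial>lborel)"
    using S f by (simp add: emeasure_eq_ennreal_measure less_top nn_integral_eq_integral)
  finally show ?thesis by (simp add: ennreal_plus)
qed

text \<open>The translation is moved from \<open>f\<close>, which is merely measurable, onto the
  indicator of the box. Shifted indicators converge off the boundary of the box, a null set, and all
  shifted boxes lie in one ball on which \<open>f\<close> is integrable.\<close>

lemma box_average_tendsto:
  fixes f :: "'a::euclidean_space \<Rightarrow> 'b::euclidean_space" and a b :: 'a
  assumes [measurable]: "f \<in> borel_measurable borel"
    and f: "integrable lborel (\<lambda>x. (norm (f x))\<^sup>2)"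
  shows "(\<lambda>n. \<integral>x. indicat_real (box a b) x *\<^sub>R f (x + (1 / real (Suc n)) *\<^sub>R z) \<partial>lborel)
    \<longlonglongrightarrow> (\<integral>x. indicat_real (box a b) x *\<^sub>R f x \<partial>lborel)"
proof -
  define v where "v n = (1 / real (Suc n)) *\<^sub>R z" for n
  have v_lim: "v \<longlonglongrightarrow> 0"
    unfolding v_def using tendsto_scaleR[OF LIMSEQ_inverse_real_of_nat tendsto_const, of z] by (simp add: inverse_eq_divide)
  have v_le: "norm (v n) \<le> norm z" for n
    unfolding v_def norm_scaleR by (rule order_trans[OF mult_right_mono[of _ 1]]) simp_all
  obtain R where R: "box a b \<subseteq> ball 0 R"
    using bounded_box[of a b] bounded_subset_ballD by metis
  have eq: "(\<integral>x. indicat_real (box a b) x *\<^sub>R f (x + v n) \<partial>lborel)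
    = (\<integral>x. indicat_real (box a b) (x - v n) *\<^sub>R f x \<partial>lborel)" for n
    using integral_lborel_translate[of "\<lambda>x. indicat_real (box a b) (x - v n) *\<^sub>R f x" "v n"] by simp
  have "(\<lambda>n. \<integral>x. indicat_real (box a b) (x - v n) *\<^sub>R f x \<partial>lborel)
    \<longlonglongrightarrow> (\<integral>x. indicat_real (box a b) x *\<^sub>R f x \<partial>lborel)"
  proof (rule integral_dominated_convergence)
    show "integrable lborel (\<lambda>x. norm (indicat_real (ball 0 (R + norm z)) x *\<^sub>R f x))"
      using f emeasure_lborel_ball_finite by (intro integrable_norm integrable_indicator_scaleR_L2) auto
    show "AE x in lborel. norm (indicat_real (box a b) (x - v n) *\<^sub>R f x)
        \<le> norm (indicat_real (ball 0 (R + norm z)) x *\<^sub>R f x)" for n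
    proof (rule AE_I2)
      fix x
      have "x \<in> ball 0 (R + norm z)" if "x - v n \<in> box a b"
      proof -
        have "norm (x - v n) < R" using that R by auto
        then show ?thesis using norm_triangle_ineq[of "x - v n" "v n"] v_le[of n] by simp
      qed
      then show "norm (indicat_real (box a b) (x - v n) *\<^sub>R f x)
        \<le> norm (indicat_real (ball 0 (R + norm z)) x *\<^sub>R f x)" by (auto simp: indicator_def)
    qed
    have "AE x in lborel. x \<notin> cbox a b - box a b"
    proof (rule AE_not_in)
      have "negligible (cbox a b - box a b)" by (rule negligible_frontier_interval)
      then have "cbox a b - box a b \<in> null_sets lebesgue" by (simp add: negligible_iff_null_sets)
      then show "cbox a b - box a b \<in> null_sets lborel" by (simp add: null_sets_completion_iff)
    qed
    then show "AE x in lborel. (\<lambda>n. indicat_real (box a b) (x - v n) *\<^sub>R f x) \<longlonglongrightarrow> indicat_real (box a b) x *\<^sub>R f x"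
    proof eventually_elim
      case (elim x)
      have lim: "(\<lambda>n. x - v n) \<longlonglongrightarrow> x" using tendsto_diff[OF tendsto_const v_lim, of x] by simp
      have "\<forall>\<^sub>F n in sequentially. indicat_real (box a b) (x - v n) = indicat_real (box a b) x"
      proof (cases "x \<in> box a b")
        case True
        then have "\<forall>\<^sub>F n in sequentially. x - v n \<in> box a b"
          using topological_tendstoD[OF lim open_box] by simp
        then show ?thesis by eventually_elim (simp add: True)
      next
        case False
        with elim have "x \<in> - cbox a b" by simp
        then have "\<forall>\<^sub>F n in sequentially. x - v n \<in> - cbox a b"
          by (rule topological_tendstoD[OF lim open_Compl[OF closed_cbox]])
        then show ?thesis
          using box_subset_cbox[of a b] False by (elim eventually_mono) (auto simp: indicator_def)
      qed
      then have "\<forall>\<^sub>F n in sequentially. indicat_real (box a b) x *\<^sub>R f x = indicat_real (box a b) (x - v n) *\<^sub>R f x"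
        by eventually_elim simp
      then show ?case by (rule Lim_transform_eventually[OF tendsto_const])
    qed
  qed simp_all
  then show ?thesis unfolding v_def[symmetric] eq .
qed

text \<open>The substitution \<open>y = x + \<epsilon> z\<close> fixes the profile at scale 1 and
  moves \<epsilon> into a translation of \<open>f\<close>. Fubini then integrates over the box first
  and produces the averages \<open>G (\<epsilon> z)\<close>; these are bounded by \<open>K\<close>
  and tend to \<open>G 0\<close>, so the limit passes under the integrable profile.\<close>

lemma approx_identity_box_limit:
  fixes f :: "real^3 \<Rightarrow> 'b::euclidean_space"
  assumes meas [measurable]: "f \<in> borel_measurable borel"
    and f: "integrable lborel (\<lambda>x. (norm (f x))\<^sup>2)"
  shows "(\<lambda>n. \<integral>x. indicat_real (box a b) x *\<^sub>R (\<integral>y. approx_identity (1 / real (Suc n)) (y - x) *\<^sub>R f y \<partial>lborel) \<partial>lborel)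
    \<longlonglongrightarrow> (\<integral>z. approx_identity 1 z \<partial>lborel) *\<^sub>R (\<integral>x. indicat_real (box a b) x *\<^sub>R f x \<partial>lborel)"
proof -
  let ?B = "box a b"
  define G where "G v = (\<integral>x. indicat_real ?B x *\<^sub>R f (x + v) \<partial>lborel)" for v
  define K where "K = measure lborel ?B + (\<integral>x. (norm (f x))\<^sup>2 \<partial>lborel)"
  have K: "0 \<le> K" by (simp add: K_def)
  have B_fin: "emeasure lborel ?B < \<infinity>" using emeasure_lborel_box_finite by simp
  have nn_le: "(\<integral>\<^sup>+x. ennreal (norm (indicat_real ?B x *\<^sub>R f (x + v))) \<partial>lborel) \<le> ennreal K" for v
    unfolding K_def using f B_fin by (intro nn_integral_indicator_translate_le) auto
  have G_int: "integrable lborel (\<lambda>x. indicat_real ?B x *\<^sub>R f (x + v))" for v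
    using nn_le[of v] by (intro integrableI_bounded) (auto intro: le_less_trans)
  have G_le: "norm (G v) \<le> K" for v
  proof -
    have "ennreal (norm (G v)) \<le> ennreal K"
      unfolding G_def using integral_norm_bound_ennreal[OF G_int] nn_le by (rule order_trans)
    then show ?thesis using K by simp
  qed
  have G_meas [measurable]: "G \<in> borel_measurable borel"
    unfolding G_def[abs_def] by measurable
  have eq: "(\<integral>x. indicat_real ?B x *\<^sub>R (\<integral>y. approx_identity \<epsilon> (y - x) *\<^sub>R f y \<partial>lborel) \<partial>lborel)
    = (\<integral>z. approx_identity 1 z *\<^sub>R G (\<epsilon> *\<^sub>R z) \<partial>lborel)" if \<epsilon>: "0 < \<epsilon>" for \<epsilon>
  proof -
    define H where "H z x = approx_identity 1 z *\<^sub>R (indicat_real ?B x *\<^sub>R f (x + \<epsilon> *\<^sub>R z))" for z x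
    have H_meas [measurable]: "case_prod H \<in> borel_measurable (lborel \<Otimes>\<^sub>M lborel)"
      unfolding H_def[abs_def] by measurable
    have inner: "(\<integral>y. approx_identity \<epsilon> (y - x) *\<^sub>R f y \<partial>lborel) = (\<integral>z. approx_identity 1 z *\<^sub>R f (x + \<epsilon> *\<^sub>R z) \<partial>lborel)" for x
    proof -
      have "(\<integral>y. approx_identity \<epsilon> (y - x) *\<^sub>R f y \<partial>lborel)
        = \<epsilon> ^ 3 *\<^sub>R (\<integral>z. approx_identity \<epsilon> (\<epsilon> *\<^sub>R z) *\<^sub>R f (x + \<epsilon> *\<^sub>R z) \<partial>lborel)"
        using integral_lborel_affine[of "\<lambda>y. approx_identity \<epsilon> (y - x) *\<^sub>R f y" \<epsilon> x] \<epsilon> by simp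
      also have "\<dots> = (\<integral>z. (\<epsilon> ^ 3 * approx_identity \<epsilon> (\<epsilon> *\<^sub>R z)) *\<^sub>R f (x + \<epsilon> *\<^sub>R z) \<partial>lborel)"
        by (simp only: integral_scaleR_right[symmetric] scaleR_scaleR)
      finally show ?thesis by (simp only: approx_identity_scale[OF \<epsilon>])
    qed
    have H_int: "integrable (lborel \<Otimes>\<^sub>M lborel) (case_prod H)"
    proof (rule integrableI_bounded)
      have "(\<integral>\<^sup>+p. ennreal (norm (case_prod H p)) \<partial>(lborel \<Otimes>\<^sub>M lborel))
        = (\<integral>\<^sup>+z. \<integral>\<^sup>+x. ennreal (norm (H z x)) \<partial>lborel \<partial>lborel)"
        by (subst lborel.nn_integral_fst[symmetric]) simp_all
      also have "\<dots> = (\<integral>\<^sup>+z. ennreal (approx_identity 1 z) * (\<integral>\<^sup>+x. ennreal (norm (indicat_real ?B x *\<^sub>R f (x + \<epsilon> *\<^sub>R z))) \<partial>lborel) \<partial>lborel)"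
        by (subst nn_integral_cmult[symmetric]) (simp_all add: H_def ennreal_mult' approx_identity_nonneg mult.assoc)
      also have "\<dots> \<le> (\<integral>\<^sup>+z. ennreal (approx_identity 1 z) * ennreal K \<partial>lborel)"
        by (intro nn_integral_mono mult_left_mono nn_le) simp
      also have "\<dots> = (\<integral>\<^sup>+z. ennreal (approx_identity 1 z) \<partial>lborel) * ennreal K"
        by (rule nn_integral_multc) simp
      also have "\<dots> < \<infinity>"
        using integrable_approx_identity
        by (simp add: nn_integral_eq_integral approx_identity_nonneg ennreal_mult_less_top)
      finally show "(\<integral>\<^sup>+p. ennreal (norm (case_prod H p)) \<partial>(lborel \<Otimes>\<^sub>M lborel)) < \<infinity>" .
    qed simp
    have "(\<integral>x. indicat_real ?B x *\<^sub>R (\<integral>y. approx_identity \<epsilon> (y - x) *\<^sub>R f y \<partial>lborel) \<partial>lborel) = (\<integral>x. (\<integral>z. H z x \<partial>lborel) \<partial>lborel)"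
      unfolding inner H_def by (subst integral_scaleR_right[symmetric]) (simp only: scaleR_left_commute)
    also have "\<dots> = (\<integral>z. (\<integral>x. H z x \<partial>lborel) \<partial>lborel)"
      using H_int by (rule lborel_pair.Fubini_integral)
    also have "\<dots> = (\<integral>z. approx_identity 1 z *\<^sub>R G (\<epsilon> *\<^sub>R z) \<partial>lborel)"
      unfolding H_def G_def by (simp only: integral_scaleR_right)
    finally show ?thesis .
  qed
  have "(\<lambda>n. \<integral>z. approx_identity 1 z *\<^sub>R G ((1 / real (Suc n)) *\<^sub>R z) \<partial>lborel)
    \<longlonglongrightarrow> (\<integral>z. approx_identity 1 z *\<^sub>R G 0 \<partial>lborel)"
  proof (rule integral_dominated_convergence)
    show "integrable lborel (\<lambda>z. approx_identity 1 z * K)"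
      using integrable_approx_identity by simp
    show "AE z in lborel. (\<lambda>n. approx_identity 1 z *\<^sub>R G ((1 / real (Suc n)) *\<^sub>R z)) \<longlonglongrightarrow> approx_identity 1 z *\<^sub>R G 0"
      unfolding G_def using box_average_tendsto[OF meas f] by (intro AE_I2 tendsto_scaleR tendsto_const) simp
    show "AE z in lborel. norm (approx_identity 1 z *\<^sub>R G ((1 / real (Suc n)) *\<^sub>R z)) \<le> approx_identity 1 z * K" for n
      using G_le by (intro AE_I2) (simp add: approx_identity_nonneg mult_left_mono)
  qed simp_all
  moreover have "(\<integral>z. approx_identity 1 z *\<^sub>R G 0 \<partial>lborel) = (\<integral>z. approx_identity 1 z \<partial>lborel) *\<^sub>R G 0"
    using integrable_approx_identity by (intro integral_scaleR_left)
  moreover have "G 0 = (\<integral>x. indicat_real ?B x *\<^sub>R f x \<partial>lborel)" by (simp add: G_def)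
  moreover have "(\<integral>x. indicat_real ?B x *\<^sub>R (\<integral>y. approx_identity (1 / real (Suc n)) (y - x) *\<^sub>R f y \<partial>lborel) \<partial>lborel)
    = (\<integral>z. approx_identity 1 z *\<^sub>R G ((1 / real (Suc n)) *\<^sub>R z) \<partial>lborel)" for n
    by (rule eq) simp
  ultimately show ?thesis by (simp only:)
qed

section \<open>Integrability of the singular kernel over boxes, and the limit \<epsilon> ->
  0\<close>

text \<open>On a bounded box the indicator is at most a constant times the bracket to the power -4,
  and 4 > 3 puts the potential of this weight in the fast regime.\<close>

lemma riesz_kernel_box_bound:
  "\<exists>K\<ge>0. \<forall>y::real^3. (\<integral>\<^sup>+x. indicator (box a b) x * ennreal (norm (y - x) powr - 2) \<partial>lborel)
    \<le> ennreal (K * japanese_bracket y powr - 2)"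
proof -
  obtain R where R: "R > 0" "box a b \<subseteq> ball 0 R"
    using bounded_box[of a b] bounded_subset_ballD by metis
  obtain C where C: "C > 0" "\<And>y::real^3.
    (\<integral>\<^sup>+x. ennreal (norm (y - x) powr - 2 * japanese_bracket x powr - 4) \<partial>lborel)
      \<le> ennreal (C * japanese_bracket y powr - 2)"
    using riesz_potential_decay_fast[of 4] by auto
  have "(\<integral>\<^sup>+x. indicator (box a b) x * ennreal (norm (y - x) powr - 2) \<partial>lborel)
    \<le> ennreal ((1 + R) powr 4 * C * japanese_bracket y powr - 2)" for y :: "real^3"
  proof -
    have "(\<integral>\<^sup>+x. indicator (box a b) x * ennreal (norm (y - x) powr - 2) \<partial>lborel)
      \<le> (\<integral>\<^sup>+x. ennreal ((1 + R) powr 4) * ennreal (norm (y - x) powr - 2 * japanese_bracket x powr - 4) \<partial>lborel)"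
    proof (rule nn_integral_mono)
      fix x :: "real^3"
      have "norm (y - x) powr - 2 \<le> (1 + R) powr 4 * (norm (y - x) powr - 2 * japanese_bracket x powr - 4)" if "x \<in> box a b"
      proof -
        have "japanese_bracket x \<le> 1 + R"
          using japanese_bracket_triangle[of x 0] R(2) that by (force simp: japanese_bracket_def[of 0])
        then have "japanese_bracket x powr 4 \<le> (1 + R) powr 4" by (intro powr_mono2) (auto simp: less_imp_le)
        then have "1 \<le> (1 + R) powr 4 * japanese_bracket x powr - 4"
        proof -
          have "japanese_bracket x \<noteq> 0" using japanese_bracket_pos[of x] by linarith
          then have pos: "0 < japanese_bracket x powr 4" by simp
          assume "japanese_bracket x powr 4 \<le> (1 + R) powr 4"
          then show ?thesis
            by (simp only: powr_minus_divide times_divide_eq_right mult_1_right pos_le_divide_eq[OF pos] mult_1_left)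
        qed
        then have "norm (y - x) powr - 2 * 1 \<le> norm (y - x) powr - 2 * ((1 + R) powr 4 * japanese_bracket x powr - 4)"
          by (rule mult_left_mono) simp
        then show ?thesis by (simp only: mult_ac mult_1_right)
      qed
      then show "indicator (box a b) x * ennreal (norm (y - x) powr - 2)
        \<le> ennreal ((1 + R) powr 4) * ennreal (norm (y - x) powr - 2 * japanese_bracket x powr - 4)"
        by (auto simp: indicator_def ennreal_mult'[symmetric] intro!: ennreal_leI)
    qed
    also have "\<dots> = ennreal ((1 + R) powr 4) * (\<integral>\<^sup>+x. ennreal (norm (y - x) powr - 2 * japanese_bracket x powr - 4) \<partial>lborel)"
      by (rule nn_integral_cmult) simp
    also have "\<dots> \<le> ennreal ((1 + R) powr 4) * ennreal (C * japanese_bracket y powr - 2)"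
      by (intro mult_left_mono C(2)) simp
    also have "\<dots> = ennreal ((1 + R) powr 4 * C * japanese_bracket y powr - 2)"
      using C(1) by (subst ennreal_mult[symmetric]) (simp_all add: mult.assoc)
    finally show ?thesis .
  qed
  moreover have "0 \<le> (1 + R) powr 4 * C" using C(1) by simp
  ultimately show ?thesis by blast
qed

text \<open>Integrating over the box first leaves the bracket weight to the power -2, which is
  square integrable because 4 > 3, and so pairs with \<open>w\<close>. This gives the common
  majorant on the product space for all regularized kernels.\<close>

lemma integrable_box_riesz_kernel:
  fixes w :: "real^3 \<Rightarrow> 'b::euclidean_space"
  assumes [measurable]: "w \<in> borel_measurable borel"
    and w: "integrable lborel (\<lambda>x. (norm (w x))\<^sup>2)"
  shows "integrable (lborel \<Otimes>\<^sub>M lborel) (\<lambda>(x, y). indicat_real (box a b) x * (norm (y - x) powr - 2 * norm (w y)))"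
proof (rule integrableI_bounded)
  obtain K where K: "K \<ge> 0" "\<And>y::real^3. (\<integral>\<^sup>+x. indicator (box a b) x * ennreal (norm (y - x) powr - 2) \<partial>lborel)
    \<le> ennreal (K * japanese_bracket y powr - 2)"
    using riesz_kernel_box_bound by blast
  have int: "integrable lborel (\<lambda>y. japanese_bracket y powr - 2 * norm (w y))"
    using w integrable_japanese_bracket_powr[of 4]
    by (intro integrable_mult_L2) (simp_all add: power2_eq_square powr_add[symmetric])
  have "(\<integral>\<^sup>+p. ennreal (norm (case p of (x, y) \<Rightarrow> indicat_real (box a b) x * (norm (y - x) powr - 2 * norm (w y)))) \<partial>(lborel \<Otimes>\<^sub>M lborel))
    = (\<integral>\<^sup>+y. \<integral>\<^sup>+x. ennreal (norm (w y)) * (indicator (box a b) x * ennreal (norm (y - x) powr - 2)) \<partial>lborel \<partial>lborel)"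
    by (subst lborel_pair.nn_integral_snd[symmetric])
      (auto simp: ennreal_mult' ennreal_indicator[symmetric] abs_mult mult_ac intro!: nn_integral_cong)
  also have "\<dots> = (\<integral>\<^sup>+y. ennreal (norm (w y)) * (\<integral>\<^sup>+x. indicator (box a b) x * ennreal (norm (y - x) powr - 2) \<partial>lborel) \<partial>lborel)"
    by (intro nn_integral_cong nn_integral_cmult) simp
  also have "\<dots> \<le> (\<integral>\<^sup>+y. ennreal (norm (w y)) * ennreal (K * japanese_bracket y powr - 2) \<partial>lborel)"
    by (intro nn_integral_mono mult_left_mono K) simp
  also have "\<dots> = (\<integral>\<^sup>+y. ennreal (K * (japanese_bracket y powr - 2 * norm (w y))) \<partial>lborel)"
    using K(1) by (intro nn_integral_cong) (simp add: ennreal_mult'[symmetric] mult_ac)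
  also have "\<dots> < \<infinity>"
    using int K(1) by (subst nn_integral_eq_integral) auto
  finally show "(\<integral>\<^sup>+p. ennreal (norm (case p of (x, y) \<Rightarrow> indicat_real (box a b) x * (norm (y - x) powr - 2 * norm (w y)))) \<partial>(lborel \<Otimes>\<^sub>M lborel)) < \<infinity>" .
qed simp

lemma sum_component_bounded_linear_bound:
  fixes A :: "3 \<Rightarrow> 'b::euclidean_space \<Rightarrow> 'b"
  assumes "\<And>j. bounded_linear (A j)"
  shows "\<exists>L>0. \<forall>z v. norm (\<Sum>m\<in>UNIV. (z::real^3) $ m *\<^sub>R A m v) \<le> L * norm z * norm v"
proof -
  \<comment> \<open>The summand 1 keeps \<open>L\<close> strictly positive even when all operators
    vanish.\<close>
  define L where "L = 1 + (\<Sum>m\<in>UNIV. onorm (A m))"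
  have "norm (\<Sum>m\<in>UNIV. z $ m *\<^sub>R A m v) \<le> L * norm z * norm v" for z :: "real^3" and v
  proof -
    have "norm (\<Sum>m\<in>UNIV. z $ m *\<^sub>R A m v) \<le> (\<Sum>m\<in>UNIV. norm z * (onorm (A m) * norm v))"
      using component_le_norm_cart[of z] onorm[OF assms]
      by (intro sum_norm_le) (auto intro!: mult_mono)
    also have "\<dots> = (\<Sum>m\<in>UNIV. onorm (A m)) * (norm z * norm v)"
      by (simp add: sum_distrib_left sum_distrib_right mult_ac)
    also have "\<dots> \<le> L * (norm z * norm v)"
      unfolding L_def by (intro mult_right_mono) auto
    finally show ?thesis by (simp add: mult.assoc)
  qed
  moreover have "L > 0" unfolding L_def using onorm_pos_le[OF assms] by (intro add_pos_nonneg sum_nonneg) auto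
  ultimately show ?thesis by blast
qed

lemma soft_powr_tendsto:
  assumes "z \<noteq> (0::real^3)"
  shows "(\<lambda>n. ((norm z)\<^sup>2 + (1 / real (Suc n))\<^sup>2) powr (- 3 / 2)) \<longlonglongrightarrow> norm z powr - 3"
proof -
  have "(\<lambda>n. (norm z)\<^sup>2 + (inverse (real (Suc n)))\<^sup>2) \<longlonglongrightarrow> (norm z)\<^sup>2 + 0\<^sup>2"
    by (intro tendsto_intros LIMSEQ_inverse_real_of_nat)
  then have "(\<lambda>n. ((norm z)\<^sup>2 + (inverse (real (Suc n)))\<^sup>2) powr (- 3 / 2)) \<longlonglongrightarrow> ((norm z)\<^sup>2 + 0\<^sup>2) powr (- 3 / 2)"
    using assms by (intro tendsto_powr tendsto_const) auto
  moreover have "((norm z)\<^sup>2 + 0\<^sup>2) powr (- 3 / 2) = norm z powr - 3"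
    using powr_powr[of "norm z" 2 "- 3 / 2"] assms by simp
  ultimately show ?thesis by (simp add: inverse_eq_divide)
qed

lemma soft_powr_le:
  assumes "z \<noteq> (0::real^3)"
  shows "((norm z)\<^sup>2 + \<epsilon>\<^sup>2) powr (- 3 / 2) \<le> norm z powr - 3"
proof -
  have "((norm z)\<^sup>2 + \<epsilon>\<^sup>2) powr (- 3 / 2) \<le> ((norm z)\<^sup>2) powr (- 3 / 2)"
    using assms by (intro powr_mono2') auto
  also have "\<dots> = norm z powr - 3"
    using powr_powr[of "norm z" 2 "- 3 / 2"] assms by simp
  finally show ?thesis .
qed

text \<open>Both sides of the regularized identity are integrated over a box. The left side
  converges by the approximate identity, the right side by dominated convergence on the product
  space; equality of the limits on every box gives equality almost everywhere.\<close>

lemma integral_representation: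
  fixes f w :: "real^3 \<Rightarrow> 'b::euclidean_space"
  assumes A: "\<And>j. bounded_linear (A j)"
    and clifford: "\<And>i j v. A i (A j v) + A j (A i v) = (if i = j then 2 else 0) *\<^sub>R v"
    and weak: "\<And>\<phi>. test_function \<phi> \<Longrightarrow>
      (\<Sum>j\<in>UNIV. A j (\<integral>x. partial_derivative j \<phi> x *\<^sub>R f x \<partial>lborel)) = (\<integral>x. \<phi> x *\<^sub>R w x \<partial>lborel)"
    and meas [measurable]: "f \<in> borel_measurable borel" "w \<in> borel_measurable borel"
    and f: "integrable lborel (\<lambda>x. (norm (f x))\<^sup>2)" and w: "integrable lborel (\<lambda>x. (norm (w x))\<^sup>2)"
  shows "AE x in lborel. (\<integral>z. approx_identity 1 z \<partial>lborel) *\<^sub>R f x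
    = (\<integral>y. norm (y - x) powr - 3 *\<^sub>R (\<Sum>m\<in>UNIV. (y - x) $ m *\<^sub>R A m (w y)) \<partial>lborel)"
proof -
  define c where "c = (\<integral>z. approx_identity 1 z \<partial>lborel)"
  define N where "N z v = (\<Sum>m\<in>UNIV. z $ m *\<^sub>R A m v)" for z :: "real^3" and v
  define g where "g x = (\<integral>y. norm (y - x) powr - 3 *\<^sub>R N (y - x) (w y) \<partial>lborel)" for x
  obtain L where L: "L > 0" "\<And>z v. norm (N z v) \<le> L * norm z * norm v"
    using sum_component_bounded_linear_bound[of A, OF A] unfolding N_def by blast
  have [measurable]: "A m \<in> borel_measurable borel" for m
    using A by (intro borel_measurable_continuous_onI linear_continuous_on)
  have [measurable]: "(\<lambda>z. z $ m) \<in> borel_measurable borel" for m :: 3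
    by (intro borel_measurable_continuous_onI continuous_intros)
  have N_meas [measurable]: "(\<lambda>p. N (snd p - fst p) (w (snd p))) \<in> borel_measurable (lborel \<Otimes>\<^sub>M lborel)"
    unfolding N_def by measurable
  define \<Phi> where "\<Phi> a b n p = indicat_real (box a b) (fst p) *\<^sub>R
      (((norm (snd p - fst p))\<^sup>2 + (1 / real (Suc n))\<^sup>2) powr (- 3 / 2) *\<^sub>R N (snd p - fst p) (w (snd p)))" for a b n p
  define \<Psi> where "\<Psi> a b p = indicat_real (box a b) (fst p) *\<^sub>R
      (norm (snd p - fst p) powr - 3 *\<^sub>R N (snd p - fst p) (w (snd p)))" for a b p
  have bound_int: "integrable (lborel \<Otimes>\<^sub>M lborel) (\<lambda>p. L * (indicat_real (box a b) (fst p) * (norm (snd p - fst p) powr - 2 * norm (w (snd p)))))" for a b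
    using integrable_box_riesz_kernel[OF meas(2) w, of a b] by (intro integrable_mult_right) (simp add: case_prod_unfold)
  \<comment> \<open>One estimate serves the singular and the regularized kernels. The condition on
    \<open>r\<close> is imposed only off the diagonal because \<open>N (y - x) (w y)\<close>
    vanishes at \<open>y = x\<close>.\<close>
  have le: "norm (indicat_real S x *\<^sub>R (r *\<^sub>R N (y - x) (w y))) \<le> L * (indicat_real S x * (norm (y - x) powr - 2 * norm (w y)))"
    if r: "0 \<le> r" "y \<noteq> x \<Longrightarrow> r \<le> norm (y - x) powr - 3" for S x y r
  proof (cases "y = x")
    case False
    have "r * norm (N (y - x) (w y)) \<le> norm (y - x) powr - 3 * (L * norm (y - x) * norm (w y))"
      using r False by (intro mult_mono L) auto
    also have "\<dots> = L * (norm (y - x) powr - 3 * norm (y - x) powr 1 * norm (w y))" by simp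
    also have "norm (y - x) powr - 3 * norm (y - x) powr 1 = norm (y - x) powr - 2"
      by (simp only: powr_add[symmetric]) simp
    finally show ?thesis using r by (auto simp: indicator_def)
  qed (simp add: N_def)
  have \<Psi>_int: "integrable (lborel \<Otimes>\<^sub>M lborel) (\<Psi> a b)" for a b
  proof (rule Bochner_Integration.integrable_bound[OF bound_int])
    show "\<Psi> a b \<in> borel_measurable (lborel \<Otimes>\<^sub>M lborel)"
      unfolding \<Psi>_def[abs_def] by measurable
    show "AE p in lborel \<Otimes>\<^sub>M lborel. norm (\<Psi> a b p)
        \<le> norm (L * (indicat_real (box a b) (fst p) * (norm (snd p - fst p) powr - 2 * norm (w (snd p)))))"
      unfolding \<Psi>_def real_norm_def by (intro AE_I2 order_trans[OF le abs_ge_self]) simp_all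
  qed
  have \<Phi>_int: "integrable (lborel \<Otimes>\<^sub>M lborel) (\<Phi> a b n)" for a b n
  proof (rule Bochner_Integration.integrable_bound[OF bound_int])
    show "\<Phi> a b n \<in> borel_measurable (lborel \<Otimes>\<^sub>M lborel)"
      unfolding \<Phi>_def[abs_def] by measurable
    show "AE p in lborel \<Otimes>\<^sub>M lborel. norm (\<Phi> a b n p)
        \<le> norm (L * (indicat_real (box a b) (fst p) * (norm (snd p - fst p) powr - 2 * norm (w (snd p)))))"
      unfolding \<Phi>_def real_norm_def by (intro AE_I2 order_trans[OF le abs_ge_self] soft_powr_le) simp_all
  qed
  have lim: "(\<lambda>n. integral\<^sup>L (lborel \<Otimes>\<^sub>M lborel) (\<Phi> a b n)) \<longlonglongrightarrow> integral\<^sup>L (lborel \<Otimes>\<^sub>M lborel) (\<Psi> a b)" for a b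
  proof (rule integral_dominated_convergence[OF _ _ bound_int])
    show "\<Psi> a b \<in> borel_measurable (lborel \<Otimes>\<^sub>M lborel)" "\<Phi> a b n \<in> borel_measurable (lborel \<Otimes>\<^sub>M lborel)" for n
      using \<Psi>_int \<Phi>_int by auto
    show "AE p in lborel \<Otimes>\<^sub>M lborel. (\<lambda>n. \<Phi> a b n p) \<longlonglongrightarrow> \<Psi> a b p"
    proof (rule AE_I2)
      fix p :: "(real^3) \<times> (real^3)"
      show "(\<lambda>n. \<Phi> a b n p) \<longlonglongrightarrow> \<Psi> a b p"
      proof (cases "snd p = fst p")
        case False
        then show ?thesis unfolding \<Phi>_def \<Psi>_def
          by (intro tendsto_scaleR tendsto_const soft_powr_tendsto) simp
      qed (simp add: \<Phi>_def \<Psi>_def N_def)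
    qed
    show "AE p in lborel \<Otimes>\<^sub>M lborel. norm (\<Phi> a b n p) \<le> L * (indicat_real (box a b) (fst p) * (norm (snd p - fst p) powr - 2 * norm (w (snd p))))" for n
      unfolding \<Phi>_def by (intro AE_I2 le soft_powr_le) auto
  qed
  have \<Phi>_eq: "integral\<^sup>L (lborel \<Otimes>\<^sub>M lborel) (\<Phi> a b n)
    = (\<integral>x. indicat_real (box a b) x *\<^sub>R (\<integral>y. approx_identity (1 / real (Suc n)) (y - x) *\<^sub>R f y \<partial>lborel) \<partial>lborel)" for a b n
  proof -
    have inner: "(\<integral>y. \<Phi> a b n (x, y) \<partial>lborel)
      = indicat_real (box a b) x *\<^sub>R (\<integral>y. approx_identity (1 / real (Suc n)) (y - x) *\<^sub>R f y \<partial>lborel)" for x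
      unfolding \<Phi>_def fst_conv snd_conv integral_scaleR_right N_def
      by (subst regularized_representation[OF _ A clifford weak meas f w]) simp_all
    have "integral\<^sup>L (lborel \<Otimes>\<^sub>M lborel) (\<Phi> a b n) = (\<integral>x. (\<integral>y. \<Phi> a b n (x, y) \<partial>lborel) \<partial>lborel)"
      using \<Phi>_int by (rule lborel_pair.integral_fst'[symmetric])
    then show ?thesis unfolding inner .
  qed
  have \<Psi>_eq: "integral\<^sup>L (lborel \<Otimes>\<^sub>M lborel) (\<Psi> a b) = (\<integral>x. indicat_real (box a b) x *\<^sub>R g x \<partial>lborel)" for a b
  proof -
    have "integral\<^sup>L (lborel \<Otimes>\<^sub>M lborel) (\<Psi> a b) = (\<integral>x. (\<integral>y. \<Psi> a b (x, y) \<partial>lborel) \<partial>lborel)"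
      using \<Psi>_int by (rule lborel_pair.integral_fst'[symmetric])
    then show ?thesis unfolding \<Psi>_def fst_conv snd_conv integral_scaleR_right g_def .
  qed
  have g_int: "integrable lborel (\<lambda>x. indicat_real (box a b) x *\<^sub>R g x)" for a b
  proof -
    have "integrable lborel (\<lambda>x. \<integral>y. \<Psi> a b (x, y) \<partial>lborel)"
      using \<Psi>_int by (rule lborel_pair.integrable_fst')
    then show ?thesis unfolding \<Psi>_def fst_conv snd_conv integral_scaleR_right g_def .
  qed
  have f_int: "integrable lborel (\<lambda>x. indicat_real (box a b) x *\<^sub>R f x)" for a b
    using f emeasure_lborel_box_finite by (intro integrable_indicator_scaleR_L2) auto
  have "AE x in lborel. c *\<^sub>R f x - g x = 0"
  proof (rule AE_eq_0_if_box_integrals_0)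
    fix a b :: "real^3"
    have scale: "indicat_real (box a b) x *\<^sub>R (c *\<^sub>R f x - g x) = c *\<^sub>R (indicat_real (box a b) x *\<^sub>R f x) - indicat_real (box a b) x *\<^sub>R g x" for x
      by (simp add: scaleR_right_diff_distrib)
    show "set_integrable lborel (box a b) (\<lambda>x. c *\<^sub>R f x - g x)"
      unfolding set_integrable_def scale using f_int g_int by (intro Bochner_Integration.integrable_diff integrable_scaleR_right) 
    have "c *\<^sub>R (\<integral>x. indicat_real (box a b) x *\<^sub>R f x \<partial>lborel) = (\<integral>x. indicat_real (box a b) x *\<^sub>R g x \<partial>lborel)"
      unfolding c_def using approx_identity_box_limit[OF meas(1) f] lim[of a b, unfolded \<Phi>_eq \<Psi>_eq]
      by (rule LIMSEQ_unique)
    then show "set_lebesgue_integral lborel (box a b) (\<lambda>x. c *\<^sub>R f x - g x) = 0"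
      unfolding set_lebesgue_integral_def scale
      by (simp only: Bochner_Integration.integral_diff[OF integrable_scaleR_right[OF f_int] g_int] integral_scaleR_right) simp
  qed
  then show ?thesis by (simp add: c_def g_def N_def)
qed

section \<open>Decay\<close>

lemma japanese_bracket_powr_mono:
  "a \<le> b \<Longrightarrow> japanese_bracket x powr a \<le> japanese_bracket x powr b"
  by (rule powr_mono[OF _ japanese_bracket_ge_1])

lemma japanese_bracket_powr_le_1: "a \<le> 0 \<Longrightarrow> japanese_bracket x powr a \<le> 1"
  using japanese_bracket_powr_mono[of a 0 x] by simp

text \<open>Inserting the known decay into the potential adds \<open>s\<close> to the weight
  exponent, and the assumed bound on the potential turns this into decay of order \<open>t\<close>.
  Keeping \<open>s\<close> and \<open>t\<close> free lets the same step serve the slow and the fast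
  regime.\<close>

lemma riesz_iteration_step:
  fixes u :: "real^3 \<Rightarrow> real"
  assumes [measurable]: "u \<in> borel_measurable borel" and C: "0 \<le> C"
    and ineq: "AE x in lborel. ennreal (u x) \<le>
      ennreal C * (\<integral>\<^sup>+y. ennreal (norm (x - y) powr - 2 * japanese_bracket y powr - \<rho>) * ennreal (u y) \<partial>lborel)"
    and M: "0 \<le> M" "AE x in lborel. u x \<le> M * japanese_bracket x powr - s"
    and K: "0 \<le> K" "\<And>x::real^3. (\<integral>\<^sup>+y. ennreal (norm (x - y) powr - 2 * japanese_bracket y powr - (\<rho> + s)) \<partial>lborel)
      \<le> ennreal (K * japanese_bracket x powr - t)"
  shows "AE x in lborel. u x \<le> C * M * K * japanese_bracket x powr - t"
  using ineq
proof eventually_elim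
  case (elim x)
  have "(\<integral>\<^sup>+y. ennreal (norm (x - y) powr - 2 * japanese_bracket y powr - \<rho>) * ennreal (u y) \<partial>lborel)
    \<le> (\<integral>\<^sup>+y. ennreal M * ennreal (norm (x - y) powr - 2 * japanese_bracket y powr - (\<rho> + s)) \<partial>lborel)"
    using M(2)
  proof (intro nn_integral_mono_AE, eventually_elim)
    case (elim y)
    have "ennreal (norm (x - y) powr - 2 * japanese_bracket y powr - \<rho>) * ennreal (u y)
      \<le> ennreal (norm (x - y) powr - 2 * japanese_bracket y powr - \<rho>) * ennreal (M * japanese_bracket y powr - s)"
      using elim by (intro mult_left_mono ennreal_leI) auto
    also have "\<dots> = ennreal (norm (x - y) powr - 2 * japanese_bracket y powr - \<rho> * (M * japanese_bracket y powr - s))"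
      using M(1) by (intro ennreal_mult[symmetric]) auto
    also have "norm (x - y) powr - 2 * japanese_bracket y powr - \<rho> * (M * japanese_bracket y powr - s)
      = M * (norm (x - y) powr - 2 * (japanese_bracket y powr - \<rho> * japanese_bracket y powr - s))"
      by (simp only: mult_ac)
    also have "japanese_bracket y powr - \<rho> * japanese_bracket y powr - s = japanese_bracket y powr - (\<rho> + s)"
      by (simp add: powr_add[symmetric])
    also have "ennreal (M * (norm (x - y) powr - 2 * japanese_bracket y powr - (\<rho> + s)))
      = ennreal M * ennreal (norm (x - y) powr - 2 * japanese_bracket y powr - (\<rho> + s))"
      using M(1) by (intro ennreal_mult) auto
    finally show ?case .
  qed
  also have "\<dots> = ennreal M * (\<integral>\<^sup>+y. ennreal (norm (x - y) powr - 2 * japanese_bracket y powr - (\<rho> + s)) \<partial>lborel)"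
    by (rule nn_integral_cmult) simp
  also have "\<dots> \<le> ennreal M * ennreal (K * japanese_bracket x powr - t)"
    by (intro mult_left_mono K) simp
  finally have "ennreal C * (\<integral>\<^sup>+y. ennreal (norm (x - y) powr - 2 * japanese_bracket y powr - \<rho>) * ennreal (u y) \<partial>lborel)
    \<le> ennreal C * (ennreal M * ennreal (K * japanese_bracket x powr - t))"
    by (rule mult_left_mono) simp
  with elim have "ennreal (u x) \<le> ennreal C * (ennreal M * ennreal (K * japanese_bracket x powr - t))"
    by (rule order_trans)
  also have "\<dots> = ennreal (C * M * K * japanese_bracket x powr - t)"
    using C M K by (simp add: ennreal_mult mult.assoc)
  finally show ?case using C M K by (subst (asm) ennreal_le_iff) auto
qed

section \<open>From square integrability to boundedness\<close>

text \<open>Tonelli brings the intermediate point inside, where its weight is bounded by 1; what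
  remains is the composition of two kernels of exponent 2, which has exponent 1. The weight at the
  outer point \<open>z\<close> is kept, since it provides the integrability at infinity
  later.\<close>

lemma riesz_iterated_twice_bound:
  fixes U :: "real^3 \<Rightarrow> ennreal"
  assumes [measurable]: "U \<in> borel_measurable borel" and \<rho>: "0 \<le> \<rho>"
  shows "\<exists>K>0. \<forall>x. (\<integral>\<^sup>+y. ennreal (norm (x - y) powr - 2 * japanese_bracket y powr - \<rho>) *
      (\<integral>\<^sup>+z. ennreal (norm (y - z) powr - 2 * japanese_bracket z powr - \<rho>) * U z \<partial>lborel) \<partial>lborel)
    \<le> ennreal K * (\<integral>\<^sup>+z. ennreal (norm (x - z) powr - 1 * japanese_bracket z powr - \<rho>) * U z \<partial>lborel)"
proof -
  obtain K where K: "K > 0" "\<And>x z::real^3. x \<noteq> z \<Longrightarrow>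
    (\<integral>\<^sup>+y. ennreal (norm (x - y) powr - 2 * norm (z - y) powr - 2) \<partial>lborel)
      \<le> ennreal (K * norm (x - z) powr - 1)"
    using riesz_kernel_convolution by blast
  have "(\<integral>\<^sup>+y. ennreal (norm (x - y) powr - 2 * japanese_bracket y powr - \<rho>) *
      (\<integral>\<^sup>+z. ennreal (norm (y - z) powr - 2 * japanese_bracket z powr - \<rho>) * U z \<partial>lborel) \<partial>lborel)
    \<le> ennreal K * (\<integral>\<^sup>+z. ennreal (norm (x - z) powr - 1 * japanese_bracket z powr - \<rho>) * U z \<partial>lborel)" for x
  proof -
    have "(\<integral>\<^sup>+y. ennreal (norm (x - y) powr - 2 * japanese_bracket y powr - \<rho>) *
        (\<integral>\<^sup>+z. ennreal (norm (y - z) powr - 2 * japanese_bracket z powr - \<rho>) * U z \<partial>lborel) \<partial>lborel)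
      = (\<integral>\<^sup>+y. \<integral>\<^sup>+z. ennreal (norm (x - y) powr - 2 * japanese_bracket y powr - \<rho>) *
        (ennreal (norm (y - z) powr - 2 * japanese_bracket z powr - \<rho>) * U z) \<partial>lborel \<partial>lborel)"
      by (intro nn_integral_cong nn_integral_cmult[symmetric]) simp
    also have "\<dots> = (\<integral>\<^sup>+z. \<integral>\<^sup>+y. ennreal (norm (x - y) powr - 2 * japanese_bracket y powr - \<rho>) *
        (ennreal (norm (y - z) powr - 2 * japanese_bracket z powr - \<rho>) * U z) \<partial>lborel \<partial>lborel)"
      by (rule lborel_pair.Fubini') simp
    also have "\<dots> \<le> (\<integral>\<^sup>+z. ennreal K * (ennreal (norm (x - z) powr - 1 * japanese_bracket z powr - \<rho>) * U z) \<partial>lborel)"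
      \<comment> \<open>The composition estimate requires distinct poles, and the single point
        \<open>z = x\<close> is negligible.\<close>
      using AE_lborel_singleton[of x]
    proof (intro nn_integral_mono_AE, eventually_elim)
      case (elim z)
      have "(\<integral>\<^sup>+y. ennreal (norm (x - y) powr - 2 * japanese_bracket y powr - \<rho>) *
          (ennreal (norm (y - z) powr - 2 * japanese_bracket z powr - \<rho>) * U z) \<partial>lborel)
        \<le> (\<integral>\<^sup>+y. (ennreal (japanese_bracket z powr - \<rho>) * U z) * ennreal (norm (x - y) powr - 2 * norm (z - y) powr - 2) \<partial>lborel)"
      proof (rule nn_integral_mono)
        fix y :: "real^3"
        have "japanese_bracket y powr - \<rho> \<le> 1"
          using \<rho> by (intro japanese_bracket_powr_le_1) simp
        then have "norm (x - y) powr - 2 * japanese_bracket y powr - \<rho> \<le> norm (x - y) powr - 2"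
          by (intro mult_left_le) auto
        then have "ennreal (norm (x - y) powr - 2 * japanese_bracket y powr - \<rho>) *
            (ennreal (norm (y - z) powr - 2 * japanese_bracket z powr - \<rho>) * U z)
          \<le> ennreal (norm (x - y) powr - 2) * (ennreal (norm (y - z) powr - 2 * japanese_bracket z powr - \<rho>) * U z)"
          by (intro mult_right_mono ennreal_leI) auto
        also have "\<dots> = (ennreal (japanese_bracket z powr - \<rho>) * U z) * ennreal (norm (x - y) powr - 2 * norm (z - y) powr - 2)"
          by (simp only: ennreal_mult powr_ge_zero mult_ac norm_minus_commute[of y z])
        finally show "ennreal (norm (x - y) powr - 2 * japanese_bracket y powr - \<rho>) *
            (ennreal (norm (y - z) powr - 2 * japanese_bracket z powr - \<rho>) * U z)
          \<le> (ennreal (japanese_bracket z powr - \<rho>) * U z) * ennreal (norm (x - y) powr - 2 * norm (z - y) powr - 2)" .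
      qed
      also have "\<dots> = (ennreal (japanese_bracket z powr - \<rho>) * U z) * (\<integral>\<^sup>+y. ennreal (norm (x - y) powr - 2 * norm (z - y) powr - 2) \<partial>lborel)"
        by (rule nn_integral_cmult) simp
      also have "\<dots> \<le> (ennreal (japanese_bracket z powr - \<rho>) * U z) * ennreal (K * norm (x - z) powr - 1)"
        using elim by (intro mult_left_mono K) auto
      also have "\<dots> = ennreal K * (ennreal (norm (x - z) powr - 1 * japanese_bracket z powr - \<rho>) * U z)"
        using K(1) by (simp only: ennreal_mult powr_ge_zero less_imp_le mult_ac)
      finally show ?case .
    qed
    also have "\<dots> = ennreal K * (\<integral>\<^sup>+z. ennreal (norm (x - z) powr - 1 * japanese_bracket z powr - \<rho>) * U z \<partial>lborel)"
      by (rule nn_integral_cmult) simp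
    finally show ?thesis .
  qed
  then show ?thesis using K(1) by blast
qed

text \<open>Substituting the inequality into itself produces the kernel of exponent 1. Its square
  together with the weight has a bounded potential, so the elementary bound
  \<open>p * u \<le> p\<^sup>2 + u\<^sup>2\<close> separates it from the square integrable
  \<open>u\<close>.\<close>

lemma riesz_L2_imp_bounded:
  fixes u :: "real^3 \<Rightarrow> real"
  assumes [measurable]: "u \<in> borel_measurable borel" and u: "\<And>x. 0 \<le> u x" "integrable lborel (\<lambda>x. (u x)\<^sup>2)"
    and C: "0 \<le> C" and \<rho>: "1 < \<rho>" "\<rho> < 3"
    and ineq: "AE x in lborel. ennreal (u x) \<le>
      ennreal C * (\<integral>\<^sup>+y. ennreal (norm (x - y) powr - 2 * japanese_bracket y powr - \<rho>) * ennreal (u y) \<partial>lborel)"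
  shows "\<exists>M\<ge>0. AE x in lborel. u x \<le> M"
proof -
  obtain J where J: "J > 0" "\<And>x::real^3.
    (\<integral>\<^sup>+y. ennreal (norm (x - y) powr - 2 * japanese_bracket y powr - \<rho>) \<partial>lborel) \<le> ennreal (J * japanese_bracket x powr (1 - \<rho>))"
    using riesz_potential_decay_slow[OF \<rho>] by blast
  have J1: "(\<integral>\<^sup>+y. ennreal (norm (x - y) powr - 2 * japanese_bracket y powr - \<rho>) \<partial>lborel) \<le> ennreal J" for x :: "real^3"
    using J(1) \<rho> by (intro order_trans[OF J(2)] ennreal_leI mult_left_le japanese_bracket_powr_le_1) auto
  obtain K where K: "K > 0" "\<And>x. (\<integral>\<^sup>+y. ennreal (norm (x - y) powr - 2 * japanese_bracket y powr - \<rho>) *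
      (\<integral>\<^sup>+z. ennreal (norm (y - z) powr - 2 * japanese_bracket z powr - \<rho>) * ennreal (u z) \<partial>lborel) \<partial>lborel)
    \<le> ennreal K * (\<integral>\<^sup>+z. ennreal (norm (x - z) powr - 1 * japanese_bracket z powr - \<rho>) * ennreal (u z) \<partial>lborel)"
    using riesz_iterated_twice_bound[of "\<lambda>x. ennreal (u x)" \<rho>] \<rho> by auto
  define S where "S = (\<integral>x. (u x)\<^sup>2 \<partial>lborel)"
  have S: "0 \<le> S" by (simp add: S_def)
  define M where "M = C * (C * (K * (J + S)))"
  have M: "0 \<le> M" using C K J S by (simp add: M_def)
  have last: "(\<integral>\<^sup>+z. ennreal (norm (x - z) powr - 1 * japanese_bracket z powr - \<rho>) * ennreal (u z) \<partial>lborel) \<le> ennreal (J + S)" for x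
  proof -
    have "(\<integral>\<^sup>+z. ennreal (norm (x - z) powr - 1 * japanese_bracket z powr - \<rho>) * ennreal (u z) \<partial>lborel)
      \<le> (\<integral>\<^sup>+z. ennreal (norm (x - z) powr - 2 * japanese_bracket z powr - \<rho>) + ennreal ((u z)\<^sup>2) \<partial>lborel)"
    proof (rule nn_integral_mono)
      fix z
      define p where "p = norm (x - z) powr - 1 * japanese_bracket z powr - \<rho>"
      have p: "0 \<le> p" by (simp add: p_def)
      have "2 * (p * u z) \<le> p\<^sup>2 + (u z)\<^sup>2" using sum_squares_bound[of p "u z"] by simp
      moreover have "0 \<le> p * u z" using p u by simp
      ultimately have "p * u z \<le> p\<^sup>2 + (u z)\<^sup>2" by linarith
      also have "p\<^sup>2 = norm (x - z) powr - 2 * japanese_bracket z powr - (\<rho> + \<rho>)"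
      proof -
        have "norm (x - z) powr - 1 * norm (x - z) powr - 1 = norm (x - z) powr - 2"
          "japanese_bracket z powr - \<rho> * japanese_bracket z powr - \<rho> = japanese_bracket z powr - (\<rho> + \<rho>)"
          by (simp_all only: powr_add[symmetric]) simp_all
        then show ?thesis unfolding p_def power_mult_distrib unfolding power2_eq_square by (simp only:)
      qed
      \<comment> \<open>Lowering the weight exponent from \<open>\<rho> + \<rho>\<close> to \<rho>
        returns it to the interval between 1 and 3, where the slow decay estimate applies.\<close>
      also have "\<dots> \<le> norm (x - z) powr - 2 * japanese_bracket z powr - \<rho>"
        using \<rho> by (intro mult_left_mono japanese_bracket_powr_mono) auto
      finally have "ennreal (p * u z) \<le> ennreal (norm (x - z) powr - 2 * japanese_bracket z powr - \<rho> + (u z)\<^sup>2)"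
        by (intro ennreal_leI) simp
      then show "ennreal (norm (x - z) powr - 1 * japanese_bracket z powr - \<rho>) * ennreal (u z)
        \<le> ennreal (norm (x - z) powr - 2 * japanese_bracket z powr - \<rho>) + ennreal ((u z)\<^sup>2)"
        unfolding p_def[symmetric] using p u(1)[of z] by (subst (asm) ennreal_mult ennreal_plus; simp)+
    qed
    also have "\<dots> = (\<integral>\<^sup>+z. ennreal (norm (x - z) powr - 2 * japanese_bracket z powr - \<rho>) \<partial>lborel) + (\<integral>\<^sup>+z. ennreal ((u z)\<^sup>2) \<partial>lborel)"
      by (rule nn_integral_add) simp_all
    also have "(\<integral>\<^sup>+z. ennreal ((u z)\<^sup>2) \<partial>lborel) = ennreal S"
      unfolding S_def using u(2) by (intro nn_integral_eq_integral) auto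
    also have "(\<integral>\<^sup>+z. ennreal (norm (x - z) powr - 2 * japanese_bracket z powr - \<rho>) \<partial>lborel) + ennreal S \<le> ennreal J + ennreal S"
      by (intro add_right_mono J1)
    finally show ?thesis using J S by (simp add: ennreal_plus)
  qed
  have "AE x in lborel. u x \<le> M"
    using ineq
  proof eventually_elim
    case (elim x)
    note elim
    also have "ennreal C * (\<integral>\<^sup>+y. ennreal (norm (x - y) powr - 2 * japanese_bracket y powr - \<rho>) * ennreal (u y) \<partial>lborel)
      \<le> ennreal C * (\<integral>\<^sup>+y. ennreal C * (ennreal (norm (x - y) powr - 2 * japanese_bracket y powr - \<rho>) *
      (\<integral>\<^sup>+z. ennreal (norm (y - z) powr - 2 * japanese_bracket z powr - \<rho>) * ennreal (u z) \<partial>lborel)) \<partial>lborel)"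
      using ineq
    proof (intro mult_left_mono nn_integral_mono_AE, eventually_elim)
      case (elim y)
      then have "ennreal (norm (x - y) powr - 2 * japanese_bracket y powr - \<rho>) * ennreal (u y)
        \<le> ennreal (norm (x - y) powr - 2 * japanese_bracket y powr - \<rho>) * (ennreal C *
          (\<integral>\<^sup>+z. ennreal (norm (y - z) powr - 2 * japanese_bracket z powr - \<rho>) * ennreal (u z) \<partial>lborel))"
        by (intro mult_left_mono) auto
      then show ?case by (simp only: mult.left_commute)
    qed simp
    also have "\<dots> = ennreal C * (ennreal C * (\<integral>\<^sup>+y. ennreal (norm (x - y) powr - 2 * japanese_bracket y powr - \<rho>) *
      (\<integral>\<^sup>+z. ennreal (norm (y - z) powr - 2 * japanese_bracket z powr - \<rho>) * ennreal (u z) \<partial>lborel) \<partial>lborel))"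
      by (subst nn_integral_cmult) simp_all
    also have "\<dots> \<le> ennreal C * (ennreal C * (ennreal K * ennreal (J + S)))"
      by (intro mult_left_mono order_trans[OF K(2)] last) auto
    also have "\<dots> = ennreal M"
      using C K J S by (simp add: M_def ennreal_mult)
    finally show ?case using M by simp
  qed
  then show ?thesis using M by blast
qed

text \<open>Each application of the potential gains a factor \<open>\<langle>x\<rangle>\<^sup>-\<^sup>\<theta>\<close>. The choice \<open>\<theta> = 4 / (2 N + 1)\<close> makes the exponents
  \<open>1 + n \<theta>\<close> avoid the critical value 3, where the decay estimate would pick up a logarithm.\<close>
lemma riesz_bootstrap_decay:
  fixes u :: "real^3 \<Rightarrow> real"
  assumes meas [measurable]: "u \<in> borel_measurable borel" and u: "\<And>x. 0 \<le> u x" "integrable lborel (\<lambda>x. (u x)\<^sup>2)"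
    and C: "0 \<le> C" and \<rho>: "1 < \<rho>"
    and ineq: "AE x in lborel. ennreal (u x) \<le>
      ennreal C * (\<integral>\<^sup>+y. ennreal (norm (x - y) powr - 2 * japanese_bracket y powr - \<rho>) * ennreal (u y) \<partial>lborel)"
  shows "\<exists>M\<ge>0. AE x in lborel. u x \<le> M * japanese_bracket x powr - 2"
proof -
  obtain N :: nat where N: "4 / (\<rho> - 1) < real N" using reals_Archimedean2 by blast
  \<comment> \<open>Since \<open>(N + 1 / 2) * \<theta> = 2\<close>, one has
    \<open>N * \<theta> < 2 < (N + 1) * \<theta>\<close>: the exponents
    \<open>1 + n * \<theta>\<close> with \<open>n \<le> N\<close> stay below 3 and the next one
    exceeds it. The choice of \<open>N\<close> ensures
    \<open>\<theta> \<le> \<rho> - 1\<close>.\<close>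
  define \<theta> where "\<theta> = 4 / (2 * real N + 1)"
  have N0: "0 < N" using N \<rho> by (cases N) (auto simp: field_simps)
  have \<theta>: "0 < \<theta>" "\<theta> < 2" "1 + \<theta> \<le> \<rho>"
  proof -
    show "0 < \<theta>" by (simp add: \<theta>_def)
    show "\<theta> < 2" using N0 by (simp add: \<theta>_def field_simps)
    have "4 < real N * (\<rho> - 1)" using N \<rho> by (simp add: field_simps)
    also have "\<dots> \<le> (2 * real N + 1) * (\<rho> - 1)" using \<rho> by (intro mult_right_mono) auto
    finally show "1 + \<theta> \<le> \<rho>" by (simp add: \<theta>_def field_simps)
  qed
  \<comment> \<open>Lowering the exponent from \<rho> to \<open>1 + \<theta>\<close> only enlarges
    the weight because the bracket is at least 1. Every step then gains exactly \<theta>, whatever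
    the value of \<rho>.\<close>
  have ineq': "AE x in lborel. ennreal (u x) \<le>
      ennreal C * (\<integral>\<^sup>+y. ennreal (norm (x - y) powr - 2 * japanese_bracket y powr - (1 + \<theta>)) * ennreal (u y) \<partial>lborel)"
    using ineq
  proof eventually_elim
    case (elim x)
    note elim
    also have "ennreal C * (\<integral>\<^sup>+y. ennreal (norm (x - y) powr - 2 * japanese_bracket y powr - \<rho>) * ennreal (u y) \<partial>lborel)
      \<le> ennreal C * (\<integral>\<^sup>+y. ennreal (norm (x - y) powr - 2 * japanese_bracket y powr - (1 + \<theta>)) * ennreal (u y) \<partial>lborel)"
      using \<theta>(3) by (intro mult_left_mono mult_right_mono nn_integral_mono ennreal_leI japanese_bracket_powr_mono) auto
    finally show ?case .
  qed
  have iter: "n \<le> N \<Longrightarrow> \<exists>M\<ge>0. AE x in lborel. u x \<le> M * japanese_bracket x powr - (real n * \<theta>)" for n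
  proof (induction n)
    case 0
    then show ?case using riesz_L2_imp_bounded[OF meas u C _ _ ineq'] \<theta> by simp
  next
    case (Suc n)
    then obtain M where M: "M \<ge> 0" "AE x in lborel. u x \<le> M * japanese_bracket x powr - (real n * \<theta>)" by auto
    define a where "a = 1 + \<theta> + real n * \<theta>"
    have "real (Suc n) * \<theta> \<le> real N * \<theta>" using Suc.prems \<theta> by (intro mult_right_mono) auto
    also have "\<dots> < 2" by (simp add: \<theta>_def field_simps)
    finally have a: "1 < a" "a < 3" using \<theta> by (auto simp: a_def algebra_simps add_pos_nonneg)
    obtain K where K: "K > 0" "\<And>x::real^3. (\<integral>\<^sup>+y. ennreal (norm (x - y) powr - 2 * japanese_bracket y powr - a) \<partial>lborel)
      \<le> ennreal (K * japanese_bracket x powr (1 - a))"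
      using riesz_potential_decay_slow[OF a] by blast
    have "1 - a = - (real (Suc n) * \<theta>)" by (simp add: a_def algebra_simps)
    then have "AE x in lborel. u x \<le> C * M * K * japanese_bracket x powr - (real (Suc n) * \<theta>)"
      using K by (intro riesz_iteration_step[OF meas C ineq' M]) (auto simp: a_def less_imp_le)
    then show ?case using C M K by (intro exI[of _ "C * M * K"]) auto
  qed
  from iter[of N] obtain M where M: "M \<ge> 0" "AE x in lborel. u x \<le> M * japanese_bracket x powr - (real N * \<theta>)" by auto
  \<comment> \<open>From decay of order \<open>N * \<theta>\<close> one more application crosses
    into the fast regime and reaches order 2 at once.\<close>
  have "2 < (real N + 1) * \<theta>" by (simp add: \<theta>_def field_simps)
  then have "3 < 1 + \<theta> + real N * \<theta>" by (simp add: algebra_simps)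
  from riesz_potential_decay_fast[OF this] obtain K where K: "K > 0"
    "\<And>x::real^3. (\<integral>\<^sup>+y. ennreal (norm (x - y) powr - 2 * japanese_bracket y powr - (1 + \<theta> + real N * \<theta>)) \<partial>lborel)
      \<le> ennreal (K * japanese_bracket x powr - 2)"
    by blast
  have "AE x in lborel. u x \<le> C * M * K * japanese_bracket x powr - 2"
    using K by (intro riesz_iteration_step[OF meas C ineq' M]) auto
  then show ?thesis using C M K by (intro exI[of _ "C * M * K"]) auto
qed

section \<open>Continuity\<close>

text \<open>Since \<open>t\<^sup>2 + \<epsilon>\<^sup>2 \<le> (t + \<epsilon>)\<^sup>2\<close>, the
  error is at most \<open>t powr - 3 * (1 - r ^ 3)\<close> with
  \<open>r = t / (t + \<epsilon>)\<close>. Bounding \<open>1 - r\<close> by its square root trades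
  only half a power of the distance for \<open>sqrt \<epsilon>\<close>: a full power would leave the
  exponent 3, not locally integrable, whereas 5/2 is still below the dimension.\<close>

lemma soft_kernel_error:
  fixes z :: "real^3"
  assumes \<epsilon>: "0 < \<epsilon>" and z: "z \<noteq> 0"
  shows "(norm z powr - 3 - ((norm z)\<^sup>2 + \<epsilon>\<^sup>2) powr (- 3 / 2)) * norm z \<le> 3 * sqrt \<epsilon> * norm z powr (- 5 / 2)"
proof -
  define t where "t = norm z"
  have t: "0 < t" using z by (simp add: t_def)
  define r where "r = t / (t + \<epsilon>)"
  have r: "0 < r" "r < 1" using t \<epsilon> by (simp_all add: r_def)
  have q: "1 - r = \<epsilon> / (t + \<epsilon>)" using t \<epsilon> by (simp add: r_def field_simps)
  have "(t + \<epsilon>) powr - 3 = ((t + \<epsilon>)\<^sup>2) powr (- 3 / 2)"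
    using powr_powr[of "t + \<epsilon>" 2 "- 3 / 2"] t \<epsilon> by simp
  also have "\<dots> \<le> (t\<^sup>2 + \<epsilon>\<^sup>2) powr (- 3 / 2)"
    using t \<epsilon> by (intro powr_mono2') (auto simp: power2_sum add_pos_pos)
  finally have 1: "(t + \<epsilon>) powr - 3 \<le> (t\<^sup>2 + \<epsilon>\<^sup>2) powr (- 3 / 2)" .
  have "(t + \<epsilon>) powr - 3 = t powr - 3 * r ^ 3"
    using t \<epsilon> by (simp add: r_def powr_minus powr_numeral power_divide field_simps)
  then have "t powr - 3 - (t\<^sup>2 + \<epsilon>\<^sup>2) powr (- 3 / 2) \<le> t powr - 3 * (1 - r ^ 3)"
    using 1 by (simp add: right_diff_distrib)
  also have "1 - r ^ 3 \<le> 3 * (1 - r)"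
  proof -
    have "1 - r ^ 3 = (1 - r) * (1 + r + r\<^sup>2)" by (simp add: algebra_simps power2_eq_square power3_eq_cube)
    also have "\<dots> \<le> (1 - r) * 3" using r power_le_one[of r 2] by (intro mult_left_mono) auto
    finally show ?thesis by simp
  qed
  also have "1 - r \<le> sqrt (1 - r)" using r by (intro real_le_rsqrt) (auto simp: power2_eq_square mult_left_le)
  also have "sqrt (1 - r) \<le> sqrt (\<epsilon> / t)" unfolding q using t \<epsilon> by (intro real_sqrt_le_mono divide_left_mono) auto
  also have "sqrt (\<epsilon> / t) = sqrt \<epsilon> * t powr (- 1 / 2)"
    using t by (simp add: real_sqrt_divide powr_minus_divide powr_half_sqrt)
  finally have "t powr - 3 - (t\<^sup>2 + \<epsilon>\<^sup>2) powr (- 3 / 2) \<le> t powr - 3 * (3 * (sqrt \<epsilon> * t powr (- 1 / 2)))"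
    by (simp add: mult_left_mono)
  then have "(t powr - 3 - (t\<^sup>2 + \<epsilon>\<^sup>2) powr (- 3 / 2)) * t \<le> t powr - 3 * (3 * (sqrt \<epsilon> * t powr (- 1 / 2))) * t powr 1"
    using t by simp
  also have "\<dots> = 3 * sqrt \<epsilon> * (t powr - 3 * t powr (- 1 / 2) * t powr 1)" by (simp only: mult_ac)
  also have "t powr - 3 * t powr (- 1 / 2) * t powr 1 = t powr (- 5 / 2)"
    by (simp only: powr_add[symmetric]) simp
  finally show ?thesis unfolding t_def .
qed

text \<open>Within distance 1 of \<open>x\<close> the weight is at most 1 and 5/2 < 3 makes the
  kernel integrable; beyond it the kernel is at most 1 and the weight is integrable. Neither bound
  depends on \<open>x\<close>, which is what uniform convergence requires.\<close>

lemma nn_integral_kernel_japanese_bracket_bounded: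
  assumes a: "3 < a"
  shows "\<exists>K\<ge>0. \<forall>x::real^3. (\<integral>\<^sup>+y. ennreal (norm (x - y) powr (- 5 / 2) * japanese_bracket y powr - a) \<partial>lborel) \<le> ennreal K"
proof -
  obtain C where C: "C > 0" "\<And>(x::real^3) r. 0 < r \<Longrightarrow>
    (\<integral>\<^sup>+y. ennreal (norm (x - y) powr - (5 / 2)) * indicator {y. norm (x - y) < r} y \<partial>lborel) \<le> ennreal (C * r powr (1 / 2))"
    using nn_integral_ball_norm_powr[of "5 / 2", where 'a="real^3"] by auto
  define J where "J = (\<integral>y. japanese_bracket (y::real^3) powr - a \<partial>lborel)"
  have J: "0 \<le> J" by (simp add: J_def)
  have J_eq: "(\<integral>\<^sup>+y. ennreal (japanese_bracket (y::real^3) powr - a) \<partial>lborel) = ennreal J"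
    unfolding J_def using integrable_japanese_bracket_powr[OF a] by (intro nn_integral_eq_integral) auto
  have "(\<integral>\<^sup>+y. ennreal (norm (x - y) powr (- 5 / 2) * japanese_bracket y powr - a) \<partial>lborel) \<le> ennreal (C + J)" for x :: "real^3"
  proof -
    have "(\<integral>\<^sup>+y. ennreal (norm (x - y) powr (- 5 / 2) * japanese_bracket y powr - a) \<partial>lborel)
      \<le> (\<integral>\<^sup>+y. ennreal (norm (x - y) powr - (5 / 2)) * indicator {y. norm (x - y) < 1} y + ennreal (japanese_bracket y powr - a) \<partial>lborel)"
    proof (rule nn_integral_mono)
      fix y
      have 1: "norm (x - y) powr (- 5 / 2) * japanese_bracket y powr - a \<le> norm (x - y) powr - (5 / 2)"
        using a by (simp add: mult_left_le japanese_bracket_powr_le_1)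
      have 2: "norm (x - y) powr (- 5 / 2) * japanese_bracket y powr - a \<le> japanese_bracket y powr - a" if "1 \<le> norm (x - y)"
        using that powr_mono[of "- 5 / 2" 0 "norm (x - y)"] by (intro mult_left_le_one_le) (auto split: if_splits)
      show "ennreal (norm (x - y) powr (- 5 / 2) * japanese_bracket y powr - a)
        \<le> ennreal (norm (x - y) powr - (5 / 2)) * indicator {y. norm (x - y) < 1} y + ennreal (japanese_bracket y powr - a)"
        using ennreal_leI[OF 1] ennreal_leI[OF 2]
        by (cases "norm (x - y) < 1") (simp_all add: add_increasing2)
    qed
    also have "\<dots> = (\<integral>\<^sup>+y. ennreal (norm (x - y) powr - (5 / 2)) * indicator {y. norm (x - y) < 1} y \<partial>lborel) + ennreal J"
      unfolding J_eq[symmetric] by (rule nn_integral_add) simp_all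
    also have "\<dots> \<le> ennreal (C * 1 powr (1 / 2)) + ennreal J" by (intro add_right_mono C) simp
    finally show ?thesis using C J by (simp add: ennreal_plus)
  qed
  then show ?thesis using C J by (intro exI[of _ "C + J"]) auto
qed

context
  fixes A :: "3 \<Rightarrow> 'b::euclidean_space \<Rightarrow> 'b" and w :: "real^3 \<Rightarrow> 'b" and M a :: real
  assumes A: "\<And>j. bounded_linear (A j)"
    and w_meas: "w \<in> borel_measurable borel"
    and M: "0 \<le> M" and w_bound: "AE y in lborel. norm (w y) \<le> M * japanese_bracket y powr - a"
    and a: "3 < a"
begin

private definition N :: "real^3 \<Rightarrow> 'b \<Rightarrow> 'b" where
  "N z v = (\<Sum>m\<in>UNIV. z $ m *\<^sub>R A m v)"

private lemma N_measurable: "(\<lambda>y. N (y - x) (w y)) \<in> borel_measurable borel"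
proof -
  have [measurable]: "A m \<in> borel_measurable borel" for m
    using A by (intro borel_measurable_continuous_onI linear_continuous_on)
  have [measurable]: "(\<lambda>z. z $ m) \<in> borel_measurable borel" for m :: 3
    by (intro borel_measurable_continuous_onI continuous_intros)
  note [measurable] = w_meas
  show ?thesis unfolding N_def by measurable
qed

text \<open>Leaving the scalar kernel \<open>r\<close> abstract covers three uses: the singular and
  the regularized kernel with \<open>b = 2\<close>, and their difference with
  \<open>b = 5 / 2\<close> and \<open>c\<close> proportional to \<open>sqrt \<epsilon>\<close>. On
  the diagonal the factor \<open>norm (y - x)\<close> vanishes, so \<open>r\<close> is unrestricted
  there.\<close>

private lemma potential_bound:
  assumes L: "\<And>z v. norm (N z v) \<le> L * norm z * norm v" "0 < L"
    and r: "\<And>y. y \<noteq> x \<Longrightarrow> \<bar>r y\<bar> * norm (y - x) \<le> c * norm (x - y) powr - b" "0 \<le> c"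
    and r_meas: "r \<in> borel_measurable borel"
    and K: "(\<integral>\<^sup>+y. ennreal (norm (x - y) powr - b * japanese_bracket y powr - a) \<partial>lborel) \<le> ennreal K" "0 \<le> K"
  shows "integrable lborel (\<lambda>y. r y *\<^sub>R N (y - x) (w y))"
    and "norm (\<integral>y. r y *\<^sub>R N (y - x) (w y) \<partial>lborel) \<le> L * c * M * K"
proof -
  have "(\<integral>\<^sup>+y. ennreal (norm (r y *\<^sub>R N (y - x) (w y))) \<partial>lborel)
    \<le> (\<integral>\<^sup>+y. ennreal (L * c * M) * ennreal (norm (x - y) powr - b * japanese_bracket y powr - a) \<partial>lborel)"
    using w_bound
  proof (intro nn_integral_mono_AE, eventually_elim)
    case (elim y)
    have "norm (r y *\<^sub>R N (y - x) (w y)) \<le> \<bar>r y\<bar> * (L * norm (y - x) * norm (w y))"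
      by (simp add: mult_left_mono L(1))
    also have "\<dots> = L * (\<bar>r y\<bar> * norm (y - x)) * norm (w y)" by (simp only: mult_ac)
    also have "\<dots> \<le> L * (c * norm (x - y) powr - b) * (M * japanese_bracket y powr - a)"
    proof (cases "y = x")
      case True
      then show ?thesis using L(2) r(2) M by simp
    next
      case False
      then show ?thesis using L(2) r(2) elim by (intro mult_mono mult_left_mono[OF r(1)]) auto
    qed
    also have "\<dots> = (L * c * M) * (norm (x - y) powr - b * japanese_bracket y powr - a)" by (simp only: mult_ac)
    finally have "ennreal (norm (r y *\<^sub>R N (y - x) (w y))) \<le> ennreal ((L * c * M) * (norm (x - y) powr - b * japanese_bracket y powr - a))"
      by (rule ennreal_leI)
    also have "\<dots> = ennreal (L * c * M) * ennreal (norm (x - y) powr - b * japanese_bracket y powr - a)"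
      using L(2) r(2) M by (intro ennreal_mult) auto
    finally show ?case .
  qed
  also have "\<dots> = ennreal (L * c * M) * (\<integral>\<^sup>+y. ennreal (norm (x - y) powr - b * japanese_bracket y powr - a) \<partial>lborel)"
    by (rule nn_integral_cmult) simp
  also have "\<dots> \<le> ennreal (L * c * M) * ennreal K" by (intro mult_left_mono K) simp
  also have "\<dots> = ennreal (L * c * M * K)" using L(2) r(2) M K(2) by (intro ennreal_mult[symmetric]) auto
  finally have le: "(\<integral>\<^sup>+y. ennreal (norm (r y *\<^sub>R N (y - x) (w y))) \<partial>lborel) \<le> ennreal (L * c * M * K)" .
  note [measurable] = N_measurable r_meas
  show int: "integrable lborel (\<lambda>y. r y *\<^sub>R N (y - x) (w y))"
    using le by (intro integrableI_bounded) (auto intro: le_less_trans)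
  have "ennreal (norm (\<integral>y. r y *\<^sub>R N (y - x) (w y) \<partial>lborel)) \<le> ennreal (L * c * M * K)"
    using integral_norm_bound_ennreal[OF int] le by (rule order_trans)
  then show "norm (\<integral>y. r y *\<^sub>R N (y - x) (w y) \<partial>lborel) \<le> L * c * M * K"
    using L(2) r(2) M K(2) by (subst (asm) ennreal_le_iff) auto
qed

text \<open>The exponent 2 kernel against a source decaying faster than the third power gives the
  decay. For continuity, the regularized potentials \<open>G n\<close> are continuous and differ
  from \<open>g\<close> by a constant multiple of \<open>sqrt (\<epsilon> n)\<close>, uniformly in
  \<open>x\<close>.\<close>

lemma potential_decay_continuous:
  defines "g \<equiv> \<lambda>x. \<integral>y. norm (y - x) powr - 3 *\<^sub>R (\<Sum>m\<in>UNIV. (y - x) $ m *\<^sub>R A m (w y)) \<partial>lborel"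
  shows "\<exists>C. \<forall>x. norm (g x) \<le> C * japanese_bracket x powr - 2" "continuous_on UNIV g"
proof -
  obtain L where L: "L > 0" "\<And>z v. norm (N z v) \<le> L * norm z * norm v"
    using sum_component_bounded_linear_bound[of A, OF A] unfolding N_def by blast
  obtain K2 where K2: "K2 > 0" "\<And>x::real^3.
    (\<integral>\<^sup>+y. ennreal (norm (x - y) powr - 2 * japanese_bracket y powr - a) \<partial>lborel) \<le> ennreal (K2 * japanese_bracket x powr - 2)"
    using riesz_potential_decay_fast[OF a] by blast
  obtain K where K: "K \<ge> 0" "\<And>x::real^3.
    (\<integral>\<^sup>+y. ennreal (norm (x - y) powr - (5 / 2) * japanese_bracket y powr - a) \<partial>lborel) \<le> ennreal K"
    using nn_integral_kernel_japanese_bracket_bounded[OF a] by auto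
  have g_eq: "g x = (\<integral>y. norm (y - x) powr - 3 *\<^sub>R N (y - x) (w y) \<partial>lborel)" for x
    by (simp add: g_def N_def)
  have kernel: "\<bar>norm (y - x) powr - 3\<bar> * norm (y - x) \<le> 1 * norm (x - y) powr - 2" for x y :: "real^3"
    using powr_add[of "norm (x - y)" "- 3" 1] by (simp add: norm_minus_commute)
  have g_int: "integrable lborel (\<lambda>y. norm (y - x) powr - 3 *\<^sub>R N (y - x) (w y))"
    and g_bound: "norm (g x) \<le> L * 1 * M * (K2 * japanese_bracket x powr - 2)" for x
    unfolding g_eq
    by (rule potential_bound[where b = 2 and c = 1, OF L(2,1) kernel _ _ K2(2)]; use K2(1) in simp)+
  show "\<exists>C. \<forall>x. norm (g x) \<le> C * japanese_bracket x powr - 2"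
    using g_bound by (intro exI[of _ "L * 1 * M * K2"]) (simp add: mult.assoc)
  define \<epsilon> where "\<epsilon> n = 1 / real (Suc n)" for n
  have \<epsilon>: "0 < \<epsilon> n" for n by (simp add: \<epsilon>_def)
  define s where "s n z = ((norm z)\<^sup>2 + (\<epsilon> n)\<^sup>2) powr (- 3 / 2)" for n and z :: "real^3"
  have s_meas: "(\<lambda>y. s n (y - x)) \<in> borel_measurable borel" for n x
    unfolding s_def by measurable
  define G where "G n x = (\<integral>y. s n (y - x) *\<^sub>R N (y - x) (w y) \<partial>lborel)" for n x
  have s_le: "\<bar>s n (y - x)\<bar> * norm (y - x) \<le> 1 * norm (x - y) powr - 2" if "y \<noteq> x" for n x y
  proof -
    have "\<bar>s n (y - x)\<bar> \<le> \<bar>norm (y - x) powr - 3\<bar>" using soft_powr_le[of "y - x" "\<epsilon> n"] that by (simp add: s_def)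
    then have "\<bar>s n (y - x)\<bar> * norm (y - x) \<le> \<bar>norm (y - x) powr - 3\<bar> * norm (y - x)"
      by (rule mult_right_mono) simp
    then show ?thesis using kernel by (rule order_trans)
  qed
  have G_int: "integrable lborel (\<lambda>y. s n (y - x) *\<^sub>R N (y - x) (w y))" for n x
    by (rule potential_bound(1)[where b = 2 and c = 1, OF L(2,1) s_le _ s_meas K2(2)]; use K2(1) in simp)
  have diff_bound: "norm (g x - G n x) \<le> L * (3 * sqrt (\<epsilon> n)) * M * K" for n x
  proof -
    have "g x - G n x = (\<integral>y. (norm (y - x) powr - 3 - s n (y - x)) *\<^sub>R N (y - x) (w y) \<partial>lborel)"
      unfolding g_eq G_def scaleR_left_diff_distrib using g_int G_int
      by (rule Bochner_Integration.integral_diff[symmetric])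
    also have "norm \<dots> \<le> L * (3 * sqrt (\<epsilon> n)) * M * K"
    proof (rule potential_bound(2)[where b = "5 / 2" and x = x])
      show "\<bar>norm (y - x) powr - 3 - s n (y - x)\<bar> * norm (y - x) \<le> 3 * sqrt (\<epsilon> n) * norm (x - y) powr - (5 / 2)" if "y \<noteq> x" for y
        using soft_kernel_error[OF \<epsilon>[of n], of "y - x"] soft_powr_le[of "y - x" "\<epsilon> n"] that
        by (simp add: s_def norm_minus_commute)
      show "(\<lambda>y. norm (y - x) powr - 3 - s n (y - x)) \<in> borel_measurable borel"
        using s_meas by (intro borel_measurable_diff) simp_all
    qed (use L K \<epsilon>[of n] in auto)
    finally show ?thesis .
  qed
  have G_cont: "continuous_on UNIV (G n)" for n
  proof (rule continuous_at_imp_continuous_on, rule ballI)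
    fix x :: "real^3"
    show "isCont (G n) x"
    proof (rule continuous_at_sequentially[THEN iffD2], intro allI impI)
      fix X :: "nat \<Rightarrow> real^3" assume X: "X \<longlonglongrightarrow> x"
      note [measurable] = N_measurable s_meas
      have cont: "continuous_on UNIV (\<lambda>z. s n z *\<^sub>R N z v)" for v
        unfolding s_def N_def using \<epsilon>[of n]
        by (intro continuous_intros) (auto simp: add_nonneg_eq_0_iff)
      have "(\<lambda>k. \<integral>y. s n (y - X k) *\<^sub>R N (y - X k) (w y) \<partial>lborel) \<longlonglongrightarrow> (\<integral>y. s n (y - x) *\<^sub>R N (y - x) (w y) \<partial>lborel)"
      proof (rule integral_dominated_convergence)
        \<comment> \<open>For fixed \<open>n\<close> the regularization bounds
          \<open>norm z * s n z\<close> by \<open>1 / (\<epsilon> n)\<^sup>2\<close> everywhere, so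
          one integrable majorant serves all the points \<open>X k\<close>.\<close>
        show "integrable lborel (\<lambda>y::real^3. L * (1 / (\<epsilon> n)\<^sup>2) * (M * japanese_bracket y powr - a))"
          using integrable_japanese_bracket_powr[OF a] by (intro integrable_mult_right)
        show "AE y in lborel. (\<lambda>k. s n (y - X k) *\<^sub>R N (y - X k) (w y)) \<longlonglongrightarrow> s n (y - x) *\<^sub>R N (y - x) (w y)"
        proof (rule AE_I2)
          fix y
          have "(\<lambda>k. y - X k) \<longlonglongrightarrow> y - x" by (intro tendsto_intros X)
          then show "(\<lambda>k. s n (y - X k) *\<^sub>R N (y - X k) (w y)) \<longlonglongrightarrow> s n (y - x) *\<^sub>R N (y - x) (w y)"
            using continuous_on_tendsto_compose[OF cont] by simp
        qed
        show "AE y in lborel. norm (s n (y - X k) *\<^sub>R N (y - X k) (w y)) \<le> L * (1 / (\<epsilon> n)\<^sup>2) * (M * japanese_bracket y powr - a)" for k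
          using w_bound
        proof eventually_elim
          case (elim y)
          have "norm (y - X k) * s n (y - X k) \<le> 1 / ((norm (y - X k))\<^sup>2 + (\<epsilon> n)\<^sup>2)"
            unfolding s_def by (rule soft_kernel_bounds(1)[OF \<epsilon>])
          also have "\<dots> \<le> 1 / (\<epsilon> n)\<^sup>2" using \<epsilon>[of n] by (intro divide_left_mono) (auto simp: add_nonneg_pos)
          finally have 1: "norm (y - X k) * s n (y - X k) \<le> 1 / (\<epsilon> n)\<^sup>2" .
          have s_nonneg: "0 \<le> s n (y - X k)" by (simp add: s_def)
          have "norm (s n (y - X k) *\<^sub>R N (y - X k) (w y)) \<le> s n (y - X k) * (L * norm (y - X k) * norm (w y))"
            using s_nonneg by (simp add: mult_left_mono L(2))
          also have "\<dots> = L * (norm (y - X k) * s n (y - X k)) * norm (w y)" by (simp only: mult_ac)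
          also have "\<dots> \<le> L * (1 / (\<epsilon> n)\<^sup>2) * (M * japanese_bracket y powr - a)"
            using 1 elim L(1) s_nonneg by (intro mult_mono) auto
          finally show ?case .
        qed
      qed simp_all
      then show "(G n \<circ> X) \<longlonglongrightarrow> G n x" by (simp add: G_def o_def)
    qed
  qed
  have "uniform_limit UNIV G g sequentially"
  proof (rule uniform_limitI)
    fix e :: real assume e: "0 < e"
    have "(\<lambda>n. L * (3 * sqrt (\<epsilon> n)) * M * K) \<longlonglongrightarrow> L * (3 * sqrt 0) * M * K"
      unfolding \<epsilon>_def inverse_eq_divide[symmetric] by (intro tendsto_intros LIMSEQ_inverse_real_of_nat)
    then have "\<forall>\<^sub>F n in sequentially. L * (3 * sqrt (\<epsilon> n)) * M * K < e"
      using e by (intro order_tendstoD(2)) auto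
    then show "\<forall>\<^sub>F n in sequentially. \<forall>x\<in>UNIV. dist (G n x) (g x) < e"
      by eventually_elim (use diff_bound in \<open>auto simp: dist_norm norm_minus_commute intro: le_less_trans\<close>)
  qed
  then show "continuous_on UNIV g"
    using G_cont by (intro uniform_limit_theorem[OF always_eventually]) auto
qed

end

text \<open>The bound on \<open>w\<close> by \<open>f\<close> makes \<open>w\<close> square
  integrable, so the representation applies and yields the scalar inequality for the bootstrap with
  constant \<open>L * B / c\<close>. The decay of \<open>f\<close> found there improves that of
  \<open>w\<close>, after which the representing integral, divided by \<open>c\<close>, is the
  continuous representative.\<close>

lemma weak_solution_decay:
  fixes f w :: "real^3 \<Rightarrow> 'b::euclidean_space"
  assumes A: "\<And>j. bounded_linear (A j)"
    and clifford: "\<And>i j v. A i (A j v) + A j (A i v) = (if i = j then 2 else 0) *\<^sub>R v"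
    and weak: "\<And>\<phi>. test_function \<phi> \<Longrightarrow>
      (\<Sum>j\<in>UNIV. A j (\<integral>x. partial_derivative j \<phi> x *\<^sub>R f x \<partial>lborel)) = (\<integral>x. \<phi> x *\<^sub>R w x \<partial>lborel)"
    and meas [measurable]: "f \<in> borel_measurable borel" "w \<in> borel_measurable borel"
    and f: "integrable lborel (\<lambda>x. (norm (f x))\<^sup>2)"
    and \<rho>: "1 < \<rho>" and B: "0 \<le> B"
    and w_le: "AE x in lborel. norm (w x) \<le> B * japanese_bracket x powr - \<rho> * norm (f x)"
  shows "\<exists>C g. (AE x in lborel. g x = f x) \<and> (\<forall>x. norm (g x) \<le> C * japanese_bracket x powr - 2) \<and> continuous_on UNIV g"
proof -
  define c where "c = (\<integral>z. approx_identity 1 z \<partial>lborel)"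
  have c: "0 < c" unfolding c_def by (rule integral_approx_identity_pos)
  define g where "g x = (\<integral>y. norm (y - x) powr - 3 *\<^sub>R (\<Sum>m\<in>UNIV. (y - x) $ m *\<^sub>R A m (w y)) \<partial>lborel)" for x
  obtain L where L: "L > 0" "\<And>(z::real^3) v. norm (\<Sum>m\<in>UNIV. z $ m *\<^sub>R A m v) \<le> L * norm z * norm v"
    using sum_component_bounded_linear_bound[of A, OF A] by blast
  have w: "integrable lborel (\<lambda>x. (norm (w x))\<^sup>2)"
  proof (rule Bochner_Integration.integrable_bound)
    show "integrable lborel (\<lambda>x. B\<^sup>2 * (norm (f x))\<^sup>2)" using f by simp
    show "AE x in lborel. norm ((norm (w x))\<^sup>2) \<le> norm (B\<^sup>2 * (norm (f x))\<^sup>2)"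
      using w_le
    proof eventually_elim
      case (elim x)
      note elim
      also have "B * japanese_bracket x powr - \<rho> * norm (f x) \<le> B * 1 * norm (f x)"
        using B \<rho> by (intro mult_right_mono mult_left_mono japanese_bracket_powr_le_1) auto
      finally have "(norm (w x))\<^sup>2 \<le> (B * norm (f x))\<^sup>2" by (intro power_mono) auto
      then show ?case by (simp add: power_mult_distrib)
    qed
  qed simp
  have rep: "AE x in lborel. c *\<^sub>R f x = g x"
    unfolding c_def g_def by (rule integral_representation[OF A clifford weak meas f w])
  have "\<exists>M\<ge>0. AE x in lborel. norm (f x) \<le> M * japanese_bracket x powr - 2"
  proof (rule riesz_bootstrap_decay)
    show "AE x in lborel. ennreal (norm (f x)) \<le> ennreal (L * B / c) *
      (\<integral>\<^sup>+y. ennreal (norm (x - y) powr - 2 * japanese_bracket y powr - \<rho>) * ennreal (norm (f y)) \<partial>lborel)"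
      using rep
    proof eventually_elim
      case (elim x)
      define h where "h y = norm (y - x) powr - 3 *\<^sub>R (\<Sum>m\<in>UNIV. (y - x) $ m *\<^sub>R A m (w y))" for y
      have "ennreal (norm (g x)) \<le> (\<integral>\<^sup>+y. ennreal (norm (h y)) \<partial>lborel)"
      \<comment> \<open>Integrability of \<open>h\<close> is not yet known at this point; otherwise
        the Bochner integral has the default value 0 and the bound is trivial.\<close>
      proof (cases "integrable lborel h")
        case True
        then show ?thesis unfolding g_def h_def[symmetric] by (rule integral_norm_bound_ennreal)
      next
        case False
        then show ?thesis unfolding g_def h_def[symmetric] by (simp add: not_integrable_integral_eq)
      qed
      also have "\<dots> \<le> (\<integral>\<^sup>+y. ennreal (L * B) * (ennreal (norm (x - y) powr - 2 * japanese_bracket y powr - \<rho>) * ennreal (norm (f y))) \<partial>lborel)"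
        using w_le
      proof (intro nn_integral_mono_AE, eventually_elim)
        case (elim y)
        have k: "norm (y - x) powr - 3 * norm (y - x) = norm (x - y) powr - 2"
          using powr_add[of "norm (x - y)" "- 3" 1] by (simp add: norm_minus_commute)
        have "norm (h y) \<le> norm (y - x) powr - 3 * (L * norm (y - x) * norm (w y))"
          unfolding h_def norm_scaleR using L(2)[of "y - x" "w y"]
          by (simp only: abs_of_nonneg powr_ge_zero mult_left_mono)
        also have "\<dots> = L * (norm (y - x) powr - 3 * norm (y - x)) * norm (w y)" by (simp only: mult_ac)
        also have "\<dots> \<le> L * (norm (y - x) powr - 3 * norm (y - x)) * (B * japanese_bracket y powr - \<rho> * norm (f y))"
          using L(1) by (intro mult_left_mono elim) auto
        also have "\<dots> = (L * B) * ((norm (x - y) powr - 2 * japanese_bracket y powr - \<rho>) * norm (f y))"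
          unfolding k by (simp only: mult_ac)
        finally have "ennreal (norm (h y)) \<le> ennreal ((L * B) * ((norm (x - y) powr - 2 * japanese_bracket y powr - \<rho>) * norm (f y)))"
          by (rule ennreal_leI)
        then show ?case
          using L(1) B by (simp only: ennreal_mult mult_nonneg_nonneg powr_ge_zero norm_ge_zero less_imp_le)
      qed
      also have "\<dots> = ennreal (L * B) * (\<integral>\<^sup>+y. ennreal (norm (x - y) powr - 2 * japanese_bracket y powr - \<rho>) * ennreal (norm (f y)) \<partial>lborel)"
        by (rule nn_integral_cmult) simp
      finally have "ennreal (1 / c) * ennreal (norm (g x)) \<le> ennreal (1 / c) * (ennreal (L * B) *
          (\<integral>\<^sup>+y. ennreal (norm (x - y) powr - 2 * japanese_bracket y powr - \<rho>) * ennreal (norm (f y)) \<partial>lborel))"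
        by (rule mult_left_mono) simp
      also have "\<dots> = ennreal (1 / c) * ennreal (L * B) *
          (\<integral>\<^sup>+y. ennreal (norm (x - y) powr - 2 * japanese_bracket y powr - \<rho>) * ennreal (norm (f y)) \<partial>lborel)"
        by (rule mult.assoc[symmetric])
      also have "ennreal (1 / c) * ennreal (L * B) = ennreal (L * B / c)"
        using c L B by (subst ennreal_mult[symmetric]) auto
      also have "ennreal (1 / c) * ennreal (norm (g x)) = ennreal (norm (f x))"
        using c unfolding elim[symmetric] by (subst ennreal_mult[symmetric]) auto
      finally show ?case .
    qed
  qed (use f \<rho> B c L in auto)
  then obtain M where M: "M \<ge> 0" "AE x in lborel. norm (f x) \<le> M * japanese_bracket x powr - 2" by blast
  have w_bound: "AE x in lborel. norm (w x) \<le> B * M * japanese_bracket x powr - (\<rho> + 2)"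
    using w_le M(2)
  proof eventually_elim
    case (elim x)
    note elim(1)
    also have "B * japanese_bracket x powr - \<rho> * norm (f x)
      \<le> B * japanese_bracket x powr - \<rho> * (M * japanese_bracket x powr - 2)"
      using B by (intro mult_left_mono elim) auto
    also have "\<dots> = B * M * (japanese_bracket x powr - \<rho> * japanese_bracket x powr - 2)" by (simp only: mult_ac)
    also have "japanese_bracket x powr - \<rho> * japanese_bracket x powr - 2 = japanese_bracket x powr - (\<rho> + 2)"
      by (simp add: powr_add[symmetric])
    finally show ?case .
  qed
  \<comment> \<open>The inequality \<open>\<rho> > 1\<close>, combined with the two powers just
    gained for \<open>f\<close>, places \<open>w\<close> beyond the critical exponent 3.\<close>
  have "0 \<le> B * M" "3 < \<rho> + 2" using B M \<rho> by auto
  note decay = potential_decay_continuous[of A w "B * M" "\<rho> + 2", OF A meas(2) this(1) w_bound this(2), folded g_def]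
  obtain C where C: "\<And>x. norm (g x) \<le> C * japanese_bracket x powr - 2" using decay(1) by blast
  have "AE x in lborel. (1 / c) *\<^sub>R g x = f x"
    using rep
  proof eventually_elim
    case (elim x)
    then show ?case using c by (simp add: elim[symmetric])
  qed
  moreover have "norm ((1 / c) *\<^sub>R g x) \<le> (C / c) * japanese_bracket x powr - 2" for x
    using C[of x] c by (simp add: divide_right_mono)
  moreover have "continuous_on UNIV (\<lambda>x. (1 / c) *\<^sub>R g x)"
    using decay(2) by (intro continuous_intros)
  ultimately show ?thesis by (intro exI[of _ "C / c"] exI[of _ "\<lambda>x. (1 / c) *\<^sub>R g x"] conjI allI)
qed

section \<open>Borel representatives, Dirac matrices and localization to the support of a test
  function\<close>

text \<open>Each real coordinate has a Borel version, and the finitely many exceptional null sets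
  can be united. This is the passage from the Lebesgue measurable data to the analysis on
  \<open>lborel\<close>.\<close>

lemma ex_borel_representative:
  fixes h :: "'a::euclidean_space \<Rightarrow> 'b::euclidean_space"
  assumes "h \<in> borel_measurable lebesgue"
  shows "\<exists>h'\<in>borel_measurable borel. AE x in lebesgue. h x = h' x"
proof -
  have "\<exists>u\<in>borel_measurable lborel. AE x in lborel. h x \<bullet> b = u x" for b
    using assms by (intro completion_ex_borel_measurable_real) simp
  then obtain u where u: "\<And>b. u b \<in> borel_measurable lborel" "\<And>b. AE x in lborel. h x \<bullet> b = u b x"
    by metis
  have "AE x in lborel. \<forall>b\<in>Basis. h x \<bullet> b = u b x"
    using u(2) by (simp add: AE_finite_all)
  then have "AE x in lborel. h x = (\<Sum>b\<in>Basis. u b x *\<^sub>R b)"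
    by eventually_elim (metis (no_types, lifting) euclidean_representation sum.cong)
  moreover have "(\<lambda>x. \<Sum>b\<in>Basis. u b x *\<^sub>R b) \<in> borel_measurable borel"
    using u(1) by (intro borel_measurable_sum borel_measurable_scaleR) simp_all
  ultimately show ?thesis by (intro bexI[of _ "\<lambda>x. \<Sum>b\<in>Basis. u b x *\<^sub>R b"]) (auto intro: AE_completion)
qed

lemma borel_measurable_vec_complex:
  fixes h :: "'a \<Rightarrow> complex^'n"
  assumes "\<And>k. (\<lambda>x. h x $ k) \<in> borel_measurable M"
  shows "h \<in> borel_measurable M"
  unfolding borel_measurable_euclidean_space[of h]
  using assms by (auto simp: Basis_vec_def inner_axis)

lemma vector_4 [simp]:
  "(vector [a, b, c, d] :: 'a::zero^4) $ 1 = a"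
  "(vector [a, b, c, d] :: 'a::zero^4) $ 2 = b"
  "(vector [a, b, c, d] :: 'a::zero^4) $ 3 = c"
  "(vector [a, b, c, d] :: 'a::zero^4) $ 4 = d"
  by (simp_all add: vector_def)

text \<open>The anticommutation relations are inherited from the Pauli matrices; the nine pairs of
  indices are verified entry by entry.\<close>

lemma dirac_alpha_clifford:
  "dirac_alpha i *v (dirac_alpha j *v v) + dirac_alpha j *v (dirac_alpha i *v v) = (if i = j then 2 else 0) *\<^sub>R v"
  using exhaust_3[of i] exhaust_3[of j]
  by (elim disjE)
    (simp_all add: vec_eq_iff forall_4 matrix_vector_mult_def sum_4 dirac_alpha_def pauli_def Let_def
      scaleR_conv_of_real algebra_simps)

lemma partial_derivative_eq_0_outside_support:
  fixes \<phi> :: "real^'n \<Rightarrow> real"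
  assumes "x \<notin> closure {x. \<phi> x \<noteq> 0}"
  shows "partial_derivative j \<phi> x = 0"
proof -
  have "(\<phi> has_derivative (\<lambda>_. 0)) (at x)"
  proof (rule has_derivative_transform_within_open[where s="- closure {x. \<phi> x \<noteq> 0}"])
    show "((\<lambda>_. 0) has_derivative (\<lambda>_. 0)) (at x)" by simp
    show "0 = \<phi> y" if "y \<in> - closure {x. \<phi> x \<noteq> 0}" for y
      using that closure_subset[of "{x. \<phi> x \<noteq> 0}"] by auto
  qed (use assms in auto)
  then show ?thesis by (simp add: partial_derivative_eq)
qed

lemma locally_integrable_mult_compact_support:
  fixes u :: "real^'n \<Rightarrow> complex" and \<psi> :: "real^'n \<Rightarrow> real"
  assumes u: "locally_integrable u" and \<psi>: "continuous_on UNIV \<psi>" and K: "compact K" "\<And>x. x \<notin> K \<Longrightarrow> \<psi> x = 0"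
  shows "integrable lebesgue (\<lambda>x. of_real (\<psi> x) * u x)"
proof -
  have uK: "integrable lebesgue (\<lambda>x. indicat_real K x *\<^sub>R u x)"
    using u K(1) by (simp add: locally_integrable_def set_integrable_def)
  obtain B where B: "\<And>x. x \<in> K \<Longrightarrow> \<bar>\<psi> x\<bar> \<le> B"
    using compact_imp_bounded[OF compact_continuous_image[OF continuous_on_subset[OF \<psi>] K(1)]]
    by (auto simp: bounded_iff)
  have eq: "of_real (\<psi> x) * u x = of_real (\<psi> x) * (indicat_real K x *\<^sub>R u x)" for x
    using K(2)[of x] by (auto simp: indicator_def)
  have \<psi>_meas: "\<psi> \<in> borel_measurable lebesgue"
    using borel_measurable_continuous_onI[OF \<psi>] by (simp add: measurable_completion)
  show ?thesis
  proof (rule Bochner_Integration.integrable_bound)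
    show "integrable lebesgue (\<lambda>x. B *\<^sub>R norm (indicat_real K x *\<^sub>R u x))"
      using uK by (intro integrable_scaleR_right integrable_norm)
    show "(\<lambda>x. of_real (\<psi> x) * u x) \<in> borel_measurable lebesgue"
      unfolding eq using \<psi>_meas uK by (intro borel_measurable_times borel_measurable_of_real) auto
    show "AE x in lebesgue. norm (of_real (\<psi> x) * u x) \<le> norm (B *\<^sub>R norm (indicat_real K x *\<^sub>R u x))"
    proof (rule AE_I2)
      fix x
      show "norm (of_real (\<psi> x) * u x) \<le> norm (B *\<^sub>R norm (indicat_real K x *\<^sub>R u x))"
      proof (cases "x \<in> K")
        case True
        then show ?thesis using B[of x] by (auto simp: norm_mult intro!: mult_right_mono)
      qed (simp add: K(2))
    qed
  qed
qed

section \<open>Zero modes of the Dirac operator\<close>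

lemma norm_matrix_vector_mult_le:
  fixes M :: "complex^'n^'m"
  assumes "\<And>i j. cmod (M $ i $ j) \<le> b"
  shows "norm (M *v v) \<le> real CARD('m) * (real CARD('n) * (b * norm v))"
proof -
  have "norm ((M *v v) $ i) \<le> real CARD('n) * (b * norm v)" for i
  proof -
    have "norm (\<Sum>j\<in>UNIV. M $ i $ j * v $ j) \<le> (\<Sum>j\<in>(UNIV::'n set). b * norm v)"
      by (intro sum_norm_le)
        (auto simp: norm_mult intro!: mult_mono Finite_Cartesian_Product.norm_nth_le assms order_trans[OF norm_ge_zero assms])
    then have "norm ((M *v v) $ i) \<le> (\<Sum>j\<in>(UNIV::'n set). b * norm v)"
      by (simp add: matrix_vector_mult_def)
    then show ?thesis by simp
  qed
  then have "(\<Sum>i\<in>UNIV. norm ((M *v v) $ i)) \<le> (\<Sum>i\<in>(UNIV::'m set). real CARD('n) * (b * norm v))"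
    by (rule sum_mono)
  moreover have "norm (M *v v) \<le> (\<Sum>i\<in>UNIV. norm ((M *v v) $ i))"
    unfolding norm_vec_def by (rule L2_set_le_sum) simp
  ultimately show ?thesis by simp
qed

text \<open>Two signs meet here. The factor 1/i in \<open>momentum\<close> turns the equation into:
  the sum of \<open>dirac_alpha j\<close> applied to the weak derivatives equals -i Q f. Integration
  by parts contributes another minus sign, so the source is i Q f.\<close>

lemma dirac_weak_identity:
  assumes f: "f \<in> dirac_domain"
    and zero: "AE x in lebesgue. dirac_operator Q f x = 0"
    and meas: "(\<lambda>x. (Q x *v f x) $ i) \<in> borel_measurable lebesgue"
    and \<phi>: "test_function \<phi>"
  shows "(\<Sum>j\<in>UNIV. \<Sum>l\<in>UNIV. dirac_alpha j $ i $ l * (\<integral>x. of_real (partial_derivative j \<phi> x) * f x $ l \<partial>lebesgue))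
    = (\<integral>x. of_real (\<phi> x) * (\<i> * (Q x *v f x) $ i) \<partial>lebesgue)"
proof -
  \<comment> \<open>Since \<open>weak_partial\<close> is a Hilbert choice, the existence contained
    in \<open>H1\<close> is what makes it a genuine weak derivative.\<close>
  have weak: "has_weak_partial j (\<lambda>x. f x $ l) (weak_partial j (\<lambda>x. f x $ l))" for j l
    using f unfolding dirac_domain_def H1_def weak_partial_def
    by (intro someI_ex[where P="has_weak_partial j (\<lambda>x. f x $ l)"]) blast
  define v where "v j l = weak_partial j (\<lambda>x. f x $ l)" for j l
  have cont: "continuous_on UNIV \<phi>" using \<phi> unfolding test_function_def by (metis C_k.simps(1))
  have K: "compact (closure {x. \<phi> x \<noteq> 0})" using \<phi> by (simp add: test_function_def)
  have v_int: "integrable lebesgue (\<lambda>x. of_real (\<phi> x) * v j l x)" for j l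
    using weak[of j l] closure_subset[of "{x. \<phi> x \<noteq> 0}"] unfolding v_def has_weak_partial_def
    by (intro locally_integrable_mult_compact_support[OF _ cont K]) auto
  have "(\<Sum>j\<in>UNIV. \<Sum>l\<in>UNIV. dirac_alpha j $ i $ l * (\<integral>x. of_real (partial_derivative j \<phi> x) * f x $ l \<partial>lebesgue))
    = (\<Sum>j\<in>UNIV. \<Sum>l\<in>UNIV. - (dirac_alpha j $ i $ l * (\<integral>x. of_real (\<phi> x) * v j l x \<partial>lebesgue)))"
    using weak \<phi> unfolding has_weak_partial_def v_def by simp
  also have "\<dots> = (\<Sum>j\<in>UNIV. \<Sum>l\<in>UNIV. (\<integral>x. - (dirac_alpha j $ i $ l * (of_real (\<phi> x) * v j l x)) \<partial>lebesgue))"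
    by simp
  also have "\<dots> = (\<integral>x. (\<Sum>j\<in>UNIV. \<Sum>l\<in>UNIV. - (dirac_alpha j $ i $ l * (of_real (\<phi> x) * v j l x))) \<partial>lebesgue)"
    using v_int by (simp add: Bochner_Integration.integral_sum Bochner_Integration.integrable_sum)
  also have "\<dots> = (\<integral>x. of_real (\<phi> x) * (\<i> * (Q x *v f x) $ i) \<partial>lebesgue)"
  proof (rule integral_cong_AE)
    show "(\<lambda>x. \<Sum>j\<in>UNIV. \<Sum>l\<in>UNIV. - (dirac_alpha j $ i $ l * (of_real (\<phi> x) * v j l x))) \<in> borel_measurable lebesgue"
      by (intro borel_measurable_sum borel_measurable_uminus borel_measurable_times[OF borel_measurable_const]
          borel_measurable_integrable[OF v_int])
    show "AE x in lebesgue. (\<Sum>j\<in>UNIV. \<Sum>l\<in>UNIV. - (dirac_alpha j $ i $ l * (of_real (\<phi> x) * v j l x)))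
        = of_real (\<phi> x) * (\<i> * (Q x *v f x) $ i)"
      using zero
    proof eventually_elim
      case (elim x)
      have "(\<Sum>j\<in>UNIV. \<Sum>l\<in>UNIV. dirac_alpha j $ i $ l * ((1 / \<i>) * v j l x)) + (Q x *v f x) $ i = 0"
        using arg_cong[OF elim, of "\<lambda>v. v $ i"]
        by (simp add: dirac_operator_def momentum_def matrix_vector_mult_def[of "dirac_alpha _"] v_def)
      then have "(Q x *v f x) $ i = \<i> * (\<Sum>j\<in>UNIV. \<Sum>l\<in>UNIV. dirac_alpha j $ i $ l * v j l x)"
        by (simp add: sum_distrib_left mult_ac sum_negf eq_neg_iff_add_eq_0 add.commute)
      then have "\<i> * (Q x *v f x) $ i = - (\<Sum>j\<in>UNIV. \<Sum>l\<in>UNIV. dirac_alpha j $ i $ l * v j l x)"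
        by simp
      then show ?case by (simp add: sum_distrib_left sum_negf mult_ac)
    qed
    show "(\<lambda>x. of_real (\<phi> x) * (\<i> * (Q x *v f x) $ i)) \<in> borel_measurable lebesgue"
    proof -
      have "\<phi> \<in> borel_measurable lborel" using borel_measurable_continuous_onI[OF cont] by simp
      then have "\<phi> \<in> borel_measurable lebesgue" by (rule measurable_completion)
      then show ?thesis using meas by simp
    qed
  qed
  finally show ?thesis .
qed

text \<open>The matrices \<open>dirac_alpha j\<close>, viewed as real-linear maps, are the operators
  of the abstract decay result, and \<open>w = \<i> Q f\<close> is its source. Both \<open>f\<close>
  and \<open>w\<close> are replaced by Borel versions, and the representative found for the former
  is one for \<open>f\<close>.\<close>

lemma zero_mode_decay:
  assumes \<rho>: "1 < \<rho>" and Q_meas: "\<And>j k. (\<lambda>x. Q x $ j $ k) \<in> borel_measurable lebesgue"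
    and C0: "0 < C0" "\<And>x j k. cmod (Q x $ j $ k) \<le> C0 * japanese_bracket x powr (- \<rho>)"
    and zm: "zero_mode Q f"
  shows "\<exists>C g. (AE x in lebesgue. g x = f x) \<and> (\<forall>x. norm (g x) \<le> C * japanese_bracket x powr (- 2)) \<and> continuous_on UNIV g"
proof -
  have dom: "f \<in> dirac_domain" and zero: "AE x in lebesgue. dirac_operator Q f x = 0"
    using zm by (auto simp: zero_mode_def)
  have f_L2: "(\<lambda>x. f x $ k) \<in> L2" for k using dom by (simp add: dirac_domain_def H1_def)
  have f_meas: "f \<in> borel_measurable lebesgue"
    using f_L2 by (intro borel_measurable_vec_complex) (simp add: L2_def)
  obtain f0 where f0 [measurable]: "f0 \<in> borel_measurable borel" and f0_eq: "AE x in lebesgue. f x = f0 x"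
    using ex_borel_representative[OF f_meas] by blast
  define w where "w x = (\<chi> i. \<i> * (Q x *v f x) $ i)" for x
  have "(\<lambda>x. f x $ k) \<in> borel_measurable lebesgue" for k using f_L2[of k] by (simp add: L2_def)
  then have Qf_meas: "(\<lambda>x. (Q x *v f x) $ i) \<in> borel_measurable lebesgue" for i
    unfolding matrix_vector_mult_def using Q_meas by simp
  then have w_meas: "w \<in> borel_measurable lebesgue"
    unfolding w_def by (intro borel_measurable_vec_complex) simp
  obtain w0 where w0 [measurable]: "w0 \<in> borel_measurable borel" and w0_eq: "AE x in lebesgue. w x = w0 x"
    using ex_borel_representative[OF w_meas] by blast
  have norm_w: "norm (w x) = norm (Q x *v f x)" for x
    unfolding w_def norm_vec_def by (simp add: norm_mult)
  have "AE x in lebesgue. norm (w0 x) \<le> 16 * C0 * japanese_bracket x powr - \<rho> * norm (f0 x)"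
    using f0_eq w0_eq
  proof eventually_elim
    case (elim x)
    \<comment> \<open>The entrywise bound costs a factor 4 for the rows and another 4 for the
      columns, the source of the constant 16.\<close>
    have "norm (w x) \<le> real CARD(4) * (real CARD(4) * (C0 * japanese_bracket x powr - \<rho> * norm (f x)))"
      unfolding norm_w using C0(2) by (rule norm_matrix_vector_mult_le)
    then show ?case by (simp add: elim)
  qed
  then have w_le: "AE x in lborel. norm (w0 x) \<le> 16 * C0 * japanese_bracket x powr - \<rho> * norm (f0 x)"
    by (simp add: AE_completion_iff)
  have f0_int: "integrable lborel (\<lambda>x. (norm (f0 x))\<^sup>2)"
  proof -
    have "integrable lebesgue (\<lambda>x. \<Sum>k\<in>UNIV. (cmod (f x $ k))\<^sup>2)"
      using f_L2 by (intro Bochner_Integration.integrable_sum) (simp add: L2_def)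
    moreover have "(\<Sum>k\<in>UNIV. (cmod (f x $ k))\<^sup>2) = (norm (f x))\<^sup>2" for x
      by (simp add: norm_vec_def L2_set_def sum_nonneg)
    ultimately have "integrable lebesgue (\<lambda>x. (norm (f x))\<^sup>2)" by simp
    then have "integrable lebesgue (\<lambda>x. (norm (f0 x))\<^sup>2)"
    proof (rule integrable_cong_AE_imp)
      show "(\<lambda>x. (norm (f0 x))\<^sup>2) \<in> borel_measurable lebesgue" by (rule measurable_completion) simp
      show "AE x in lebesgue. (norm (f x))\<^sup>2 = (norm (f0 x))\<^sup>2" using f0_eq by eventually_elim simp
    qed
    then show ?thesis by (simp add: integrable_completion)
  qed
  have weak: "(\<Sum>j\<in>UNIV. dirac_alpha j *v (\<integral>x. partial_derivative j \<phi> x *\<^sub>R f0 x \<partial>lborel)) = (\<integral>x. \<phi> x *\<^sub>R w0 x \<partial>lborel)"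
    if \<phi>: "test_function \<phi>" for \<phi>
  proof -
    have C: "C_k k \<phi>" for k using \<phi> by (simp add: test_function_def)
    have cont: "continuous_on UNIV \<phi>" "\<And>j. continuous_on UNIV (partial_derivative j \<phi>)"
      using C[of 0] C[of "Suc 0"] by simp_all
    have supp: "compact (closure {x. \<phi> x \<noteq> 0})" using \<phi> by (simp add: test_function_def)
    note [measurable] = borel_measurable_continuous_onI[OF cont(1)] borel_measurable_continuous_onI[OF cont(2)]
    \<comment> \<open>This links the two settings: a component of a vector integral over
      \<open>lborel\<close> equals a scalar integral over \<open>lebesgue\<close> of the original
      function, which differs from its Borel version only on a null set.\<close>
    have component: "(\<integral>x. \<psi> x *\<^sub>R h0 x \<partial>lborel) $ l = (\<integral>x. of_real (\<psi> x) * h x $ l \<partial>lebesgue)"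
      if h: "AE x in lebesgue. h x = h0 x" and [measurable]: "h0 \<in> borel_measurable borel" "\<psi> \<in> borel_measurable borel"
        and int: "integrable lborel (\<lambda>x. \<psi> x *\<^sub>R h0 x)" and h_meas: "h \<in> borel_measurable lebesgue"
      for \<psi> :: "real^3 \<Rightarrow> real" and h h0 :: "real^3 \<Rightarrow> complex^4" and l
    proof -
      have nth [measurable]: "(\<lambda>v::complex^4. v $ l) \<in> borel_measurable borel"
        by (intro borel_measurable_continuous_onI continuous_intros)
      have "(\<integral>x. \<psi> x *\<^sub>R h0 x \<partial>lborel) $ l = (\<integral>x. (\<psi> x *\<^sub>R h0 x) $ l \<partial>lborel)"
        by (rule integral_bounded_linear[OF bounded_linear_vec_nth int, symmetric])
      also have "\<dots> = (\<integral>x. (\<psi> x *\<^sub>R h0 x) $ l \<partial>lebesgue)"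
        by (rule integral_completion[symmetric]) measurable
      also have "\<dots> = (\<integral>x. of_real (\<psi> x) * h x $ l \<partial>lebesgue)"
      proof (rule integral_cong_AE)
        show "(\<lambda>x. (\<psi> x *\<^sub>R h0 x) $ l) \<in> borel_measurable lebesgue" by (rule measurable_completion) measurable
        have "\<psi> \<in> borel_measurable lebesgue" by (rule measurable_completion) measurable
        moreover have "(\<lambda>x. h x $ l) \<in> borel_measurable lebesgue" by (rule measurable_compose[OF h_meas nth])
        ultimately show "(\<lambda>x. of_real (\<psi> x) * h x $ l) \<in> borel_measurable lebesgue" by simp
        show "AE x in lebesgue. (\<psi> x *\<^sub>R h0 x) $ l = of_real (\<psi> x) * h x $ l"
          using h by eventually_elim (simp add: scaleR_conv_of_real[of "\<psi> _" "_ $ l"])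
      qed
      finally show ?thesis .
    qed
    have int: "integrable lborel (\<lambda>x. \<psi> x *\<^sub>R h0 x)"
      if cont: "continuous_on UNIV \<psi>" and "\<And>x. x \<notin> closure {x. \<phi> x \<noteq> 0} \<Longrightarrow> \<psi> x = 0"
        and [measurable]: "h0 \<in> borel_measurable borel" and h0: "integrable lborel (\<lambda>x. (norm (h0 x))\<^sup>2)"
      for \<psi> :: "real^3 \<Rightarrow> real" and h0 :: "real^3 \<Rightarrow> complex^4"
    proof -
      have [measurable]: "\<psi> \<in> borel_measurable borel" by (rule borel_measurable_continuous_onI[OF cont])
      have "integrable lborel (\<lambda>x. indicat_real (closure {x. \<phi> x \<noteq> 0}) x *\<^sub>R (\<psi> x)\<^sup>2)"
        using supp continuous_on_subset[OF cont]
        by (intro borel_integrable_compact continuous_intros) auto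
      moreover have eq: "indicat_real (closure {x. \<phi> x \<noteq> 0}) x *\<^sub>R (\<psi> x)\<^sup>2 = (\<psi> x)\<^sup>2" for x
        using that(2)[of x] by (auto simp: indicator_def)
      ultimately have "integrable lborel (\<lambda>x. (\<psi> x)\<^sup>2)" by (simp only: eq)
      then have "integrable lborel (\<lambda>x. \<psi> x * norm (h0 x))"
        using h0 by (intro integrable_mult_L2) simp_all
      then have "integrable lborel (\<lambda>x. norm (\<psi> x *\<^sub>R h0 x))"
        by (rule Bochner_Integration.integrable_bound) (auto simp: abs_mult)
      then show ?thesis by (subst (asm) integrable_norm_iff) simp_all
    qed
    have w0_int: "integrable lborel (\<lambda>x. (norm (w0 x))\<^sup>2)"
    proof (rule Bochner_Integration.integrable_bound)
      show "integrable lborel (\<lambda>x. (16 * C0)\<^sup>2 * (norm (f0 x))\<^sup>2)" using f0_int by simp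
      show "AE x in lborel. norm ((norm (w0 x))\<^sup>2) \<le> norm ((16 * C0)\<^sup>2 * (norm (f0 x))\<^sup>2)"
        using w_le
      proof eventually_elim
        case (elim x)
        note elim
        also have "16 * C0 * japanese_bracket x powr - \<rho> * norm (f0 x) \<le> 16 * C0 * 1 * norm (f0 x)"
          using C0(1) \<rho> by (intro mult_right_mono mult_left_mono japanese_bracket_powr_le_1) auto
        finally have "(norm (w0 x))\<^sup>2 \<le> (16 * C0 * norm (f0 x))\<^sup>2" by (intro power_mono) auto
        then show ?case by (simp add: power_mult_distrib)
      qed
    qed simp
    show ?thesis
    proof (rule vec_eq_iff[THEN iffD2], rule allI)
      fix i
      have "(\<Sum>j\<in>UNIV. dirac_alpha j *v (\<integral>x. partial_derivative j \<phi> x *\<^sub>R f0 x \<partial>lborel)) $ i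
        = (\<Sum>j\<in>UNIV. \<Sum>l\<in>UNIV. dirac_alpha j $ i $ l * (\<integral>x. partial_derivative j \<phi> x *\<^sub>R f0 x \<partial>lborel) $ l)"
        by (simp add: matrix_vector_mult_def)
      also have "\<dots> = (\<Sum>j\<in>UNIV. \<Sum>l\<in>UNIV. dirac_alpha j $ i $ l * (\<integral>x. of_real (partial_derivative j \<phi> x) * f x $ l \<partial>lebesgue))"
        using f0_int f_meas f0_eq partial_derivative_eq_0_outside_support cont(2)
        by (intro sum.cong refl arg_cong2[where f="(*)"] component int) auto
      also have "\<dots> = (\<integral>x. of_real (\<phi> x) * w x $ i \<partial>lebesgue)"
        using dirac_weak_identity[OF dom zero Qf_meas \<phi>] by (simp add: w_def)
      also have "\<dots> = (\<integral>x. \<phi> x *\<^sub>R w0 x \<partial>lborel) $ i"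
        using w0_int w_meas w0_eq cont(1) closure_subset[of "{x. \<phi> x \<noteq> 0}"]
        by (intro component[symmetric] int) auto
      finally show "(\<Sum>j\<in>UNIV. dirac_alpha j *v (\<integral>x. partial_derivative j \<phi> x *\<^sub>R f0 x \<partial>lborel)) $ i
        = (\<integral>x. \<phi> x *\<^sub>R w0 x \<partial>lborel) $ i" .
    qed
  qed
  obtain C g where g: "AE x in lborel. g x = f0 x" "\<And>x. norm (g x) \<le> C * japanese_bracket x powr - 2" "continuous_on UNIV g"
    using weak_solution_decay[of "\<lambda>j v. dirac_alpha j *v v" f0 w0 \<rho> "16 * C0",
        OF matrix_vector_mul_bounded_linear dirac_alpha_clifford weak f0 w0 f0_int \<rho> _ w_le] C0(1)
    by auto
  have "AE x in lebesgue. g x = f x"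
    using AE_completion[OF g(1)] f0_eq by eventually_elim simp
  then show ?thesis using g by blast
qed

text \<open>The constant is chosen before \<rho> and \<open>Q\<close>, and the conclusion mentions
  neither of them. If some constant and some representative satisfy the conclusion for
  \<open>f\<close>, that constant serves every admissible pair; if none do,
  \<open>zero_mode_decay\<close> shows that \<open>f\<close> is a zero mode for no admissible pair,
  and any constant will do.\<close>

theorem theorem2p1:
  fixes f :: "real^3 \<Rightarrow> complex^4"
  shows "\<exists>C::real. \<forall>(\<rho>::real) (Q :: real^3 \<Rightarrow> complex^4^4).
    \<rho> > 1 \<and>
    (\<forall>x. hermitian (Q x)) \<and>
    (\<forall>j k. (\<lambda>x. Q x $ j $ k) \<in> borel_measurable lebesgue) \<and>
    (\<exists>C\<^sub>0>0. \<forall>x j k. cmod (Q x $ j $ k) \<le> C\<^sub>0 * japanese_bracket x powr (- \<rho>)) \<and>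
    zero_mode Q f \<longrightarrow>
    (\<exists>g :: real^3 \<Rightarrow> complex^4.
       (AE x in lebesgue. g x = f x) \<and>
       (\<forall>x. norm (g x) \<le> C * japanese_bracket x powr (- 2)) \<and>
       continuous_on UNIV g)"
proof (cases "\<exists>C g. (AE x in lebesgue. g x = f x) \<and>
    (\<forall>x. norm (g x) \<le> C * japanese_bracket x powr (- 2)) \<and> continuous_on UNIV g")
  case True
  then show ?thesis by blast
next
  case False
  then show ?thesis using zero_mode_decay[of _ _ _ f] by blast
qed

end
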